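(* The parametric matroid one-interdiction problem can be solved in time $$\mathcal{O}\bigl(m^2(k f(m)+k^{1/3}\log(mk))\bigr),$$ where $m$ is the number of elements of the matroid, $k$ is its rank, and $f(m)$ is the time needed to perform a single independence test.
   Context: $\mathcal{M}=(E,\mathcal{F})$ is a matroid on a finite ground set $E$ with independent sets $\mathcal{F}$, $m=|E|$, and $k$ is its rank. $I\subseteq\mathbb{R}$ is an interval, and each $e\in E$ has weight $w(e,\lambda)=a_e+\lambda b_e$ with $a_e,b_e\in\mathbb{Q}$, $\lambda\in I$. For a basis $B$, $w(B,\lambda)=\sum_{e\in B}w(e,\lambda)$. For $e\in E$, $\mathcal{M}_e$ is the restriction of $\mathcal{M}$ to $E\setminus\{e\}$, $B_\lambda^e$ is a minimum weight basis of $\mathcal{M}_e$ at $\lambda$, and $y_e(\lambda)=w(B_\lambda^e,\lambda)$. An element $e^*\in E$ is most vital at $\lambda$ if $y_{e^*}(\lambda)\ge y_e(\lambda)$ for all $e\in E$. The optimal interdiction value function is $y(\lambda)=\max\{y_e(\lambda): e\in E\}$; it is continuous and piecewise linear. Parametric matroid one-interdiction problem: given $\mathcal{M}$ with parametric weights $w(e,\lambda)$ and the interval $I$, compute, for every $\lambda\in I$, a most vital element $e^*$ and the corresponding value $y(\lambda)=y_{e^*}(\lambda)$ (i.e. a partition of $I$ into subintervals on each of which $y$ is linear, together with a most vital element valid on each subinterval). Independence in $\mathcal{M}$ is accessed through independence tests, each taking time $f(m)$. An equality point $\lambda(e,f)$ is a point at which the weights of two distinct elements $e,f$ become equal. Standing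 assumptions: (a) for every $\lambda\in I$ there is a unique minimum weight basis $B_\lambda^*$ of $\mathcal{M}$ (ties being resolved by a fixed ordering of $E$); (b) for every $e\in E$, $\mathcal{M}_e$ has a basis of cardinality $k$; (c) no two distinct pairs of elements have weights that become equal simultaneously (distinct pairs have distinct equality points). *)

theory Defs
  imports "HOL-Analysis.Analysis"
begin

section \<open>Matroids\<close>

locale matroid =
  fixes E :: "'a set" and F :: "'a set set"
  assumes finite_ground: "finite E"
    and indep_subset_ground: "X \<in> F \<Longrightarrow> X \<subseteq> E"
    and indep_empty: "{} \<in> F"
    and indep_mono: "X \<in> F \<Longrightarrow> Y \<subseteq> X \<Longrightarrow> Y \<in> F"
    and indep_augment: "X \<in> F \<Longrightarrow> Y \<in> F \<Longrightarrow> card X < card Y \<Longrightarrow> \<exists>e\<in>Y - X. insert e X \<in> F"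

definition is_basis :: "'a set set \<Rightarrow> 'a set \<Rightarrow> bool" where
  "is_basis F B \<longleftrightarrow> B \<in> F \<and> (\<forall>X\<in>F. B \<subseteq> X \<longrightarrow> X = B)"

definition matroid_rank :: "'a set set \<Rightarrow> nat" where
  "matroid_rank F = Max (card ` F)"

definition restriction :: "'a set set \<Rightarrow> 'a set \<Rightarrow> 'a set set" where
  "restriction F S = {X \<in> F. X \<subseteq> S}"

definition min_weight_basis :: "'a set set \<Rightarrow> ('a \<Rightarrow> real) \<Rightarrow> 'a set \<Rightarrow> bool" where
  "min_weight_basis F w B \<longleftrightarrow>
     is_basis F B \<and> (\<forall>B'. is_basis F B' \<longrightarrow> (\<Sum>e\<in>B. w e) \<le> (\<Sum>e\<in>B'. w e))"

definition lex_less :: "nat set \<Rightarrow> nat set \<Rightarrow> bool" where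
  "lex_less A B \<longleftrightarrow> (\<exists>x. x \<in> A \<and> x \<notin> B \<and> (\<forall>z<x. z \<in> A \<longleftrightarrow> z \<in> B))"

text \<open>Ties between minimum weight bases are resolved by the ordering of the ground set, which
  is the order of the natural numbers: of two bases of the same weight, the one containing the
  first element on which they differ is preferred.\<close>

definition tie_broken_min_basis :: "nat set set \<Rightarrow> (nat \<Rightarrow> real) \<Rightarrow> nat set \<Rightarrow> bool" where
  "tie_broken_min_basis F w B \<longleftrightarrow>
     min_weight_basis F w B \<and> (\<forall>B'. min_weight_basis F w B' \<longrightarrow> B' = B \<or> lex_less B B')"

lemma lex_less_linear:
  assumes "A \<noteq> B"
  shows "lex_less A B \<or> lex_less B A"
proof -
  define x where "x = (LEAST x. (x \<in> A) \<noteq> (x \<in> B))"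
  from assms have "\<exists>x. (x \<in> A) \<noteq> (x \<in> B)" by blast
  then have "(x \<in> A) \<noteq> (x \<in> B)" unfolding x_def by (rule LeastI_ex)
  moreover have "\<forall>z<x. z \<in> A \<longleftrightarrow> z \<in> B" unfolding x_def using not_less_Least by blast
  ultimately show ?thesis unfolding lex_less_def by metis
qed

lemma lex_less_irrefl: "\<not> lex_less A A"
  by (simp add: lex_less_def)

lemma lex_less_trans:
  assumes "lex_less A B" "lex_less B C"
  shows "lex_less A C"
proof -
  from assms obtain x y
    where x: "x \<in> A" "x \<notin> B" "\<forall>z<x. z \<in> A \<longleftrightarrow> z \<in> B"
      and y: "y \<in> B" "y \<notin> C" "\<forall>z<y. z \<in> B \<longleftrightarrow> z \<in> C"
    unfolding lex_less_def by metis
  consider "x < y" | "y < x" using x(2) y(1) by (metis nat_neq_iff)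
  then show ?thesis
  proof cases
    case 1
    then show ?thesis unfolding lex_less_def using x y by (intro exI[of _ x]) auto
  next
    case 2
    then show ?thesis unfolding lex_less_def using x y by (intro exI[of _ y]) auto
  qed
qed

text \<open>With ties resolved in this way there always is a unique minimum weight basis.\<close>

lemma (in matroid) ex_basis: "\<exists>B. is_basis F B"
proof -
  have fin: "finite F"
    using finite_ground indep_subset_ground by (auto intro: finite_subset[of F "Pow E"])
  obtain B where B: "B \<in> F" "\<forall>X\<in>F. B \<subseteq> X \<longrightarrow> X = B"
    using finite_has_maximal[OF fin] indep_empty by (metis empty_iff)
  then show ?thesis unfolding is_basis_def by blast
qed

lemma ex1_tie_broken_min_basis:
  assumes "matroid {..<m} F"
  shows "\<exists>!B. tie_broken_min_basis F w B"
proof -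
  interpret matroid "{..<m}" F by fact
  let ?M = "{B. min_weight_basis F w B}"
  have fin: "finite F"
    using indep_subset_ground by (auto intro: finite_subset[of F "Pow {..<m}"])
  have bs: "finite {B. is_basis F B}" "{B. is_basis F B} \<noteq> {}"
    using fin ex_basis by (auto simp: is_basis_def)
  obtain B0 where "is_basis F B0" "\<forall>B'. is_basis F B' \<longrightarrow> (\<Sum>e\<in>B0. w e) \<le> (\<Sum>e\<in>B'. w e)"
    using ex_min_if_finite[of "(\<lambda>B. \<Sum>e\<in>B. w e) ` {B. is_basis F B}"] bs
    by (auto simp: not_less)
  then have ne: "?M \<noteq> {}" unfolding min_weight_basis_def by blast
  have finM: "finite ?M"
    by (rule finite_subset[OF _ bs(1)]) (auto simp: min_weight_basis_def)
  have "\<exists>B\<in>S. \<forall>B'\<in>S. B' = B \<or> lex_less B B'" if "finite S" "S \<noteq> {}" for S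
    using that
  proof (induction rule: finite_ne_induct)
    case (insert A S)
    then obtain B where "B \<in> S" "\<forall>B'\<in>S. B' = B \<or> lex_less B B'" by blast
    then show ?case using lex_less_linear[of A B] lex_less_trans by (metis insert_iff)
  qed simp
  from this[OF finM ne] obtain B where B: "tie_broken_min_basis F w B"
    by (auto simp: tie_broken_min_basis_def)
  moreover have "B' = B" if "tie_broken_min_basis F w B'" for B'
    using that B lex_less_trans lex_less_irrefl unfolding tie_broken_min_basis_def by metis
  ultimately show ?thesis by blast
qed


section \<open>The parametric matroid one-interdiction problem\<close>

definition weight :: "(nat \<Rightarrow> rat) \<Rightarrow> (nat \<Rightarrow> rat) \<Rightarrow> real \<Rightarrow> nat \<Rightarrow> real" where
  "weight a b x e = of_rat (a e) + x * of_rat (b e)"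

text \<open>The weights of two elements become equal only where their graphs cross, so elements with
  identical weight functions have no equality point.\<close>

definition equality_point :: "(nat \<Rightarrow> rat) \<Rightarrow> (nat \<Rightarrow> rat) \<Rightarrow> nat \<Rightarrow> nat \<Rightarrow> real \<Rightarrow> bool" where
  "equality_point a b e f x \<longleftrightarrow>
     e \<noteq> f \<and> b e \<noteq> b f \<and> weight a b x e = weight a b x f"

locale parametric_matroid = matroid "{..<m}" F
  for m :: nat and F :: "nat set set" +
  fixes a b :: "nat \<Rightarrow> rat" and I :: "real set"
  assumes interval: "is_interval I"
    and unique_min_basis: "x \<in> I \<Longrightarrow> \<exists>!B. tie_broken_min_basis F (weight a b x) B"
    and deletion_rank:
      "e < m \<Longrightarrow> \<exists>B. is_basis (restriction F ({..<m} - {e})) B \<and> card B = matroid_rank F"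
    and distinct_equality_points:
      "\<lbrakk>e < m; f < m; g < m; h < m; x \<in> I; equality_point a b e f x; equality_point a b g h x\<rbrakk>
         \<Longrightarrow> {e, f} = {g, h}"

definition interdiction_value ::
    "nat \<Rightarrow> nat set set \<Rightarrow> (nat \<Rightarrow> rat) \<Rightarrow> (nat \<Rightarrow> rat) \<Rightarrow> nat \<Rightarrow> real \<Rightarrow> real" where
  "interdiction_value m F a b e x =
     (let B = (SOME B. min_weight_basis (restriction F ({..<m} - {e})) (weight a b x) B)
      in \<Sum>g\<in>B. weight a b x g)"

definition most_vital ::
    "nat \<Rightarrow> nat set set \<Rightarrow> (nat \<Rightarrow> rat) \<Rightarrow> (nat \<Rightarrow> rat) \<Rightarrow> real \<Rightarrow> nat \<Rightarrow> bool" where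
  "most_vital m F a b x e \<longleftrightarrow>
     e < m \<and> (\<forall>g<m. interdiction_value m F a b g x \<le> interdiction_value m F a b e x)"

definition optimal_value ::
    "nat \<Rightarrow> nat set set \<Rightarrow> (nat \<Rightarrow> rat) \<Rightarrow> (nat \<Rightarrow> rat) \<Rightarrow> real \<Rightarrow> real" where
  "optimal_value m F a b x = Max ((\<lambda>e. interdiction_value m F a b e x) ` {..<m})"


section \<open>Representation of intervals\<close>

datatype bound = Unbounded | Closed real | Open real

fun above :: "bound \<Rightarrow> real \<Rightarrow> bool" where
  "above Unbounded x \<longleftrightarrow> True"
| "above (Closed c) x \<longleftrightarrow> c \<le> x"
| "above (Open c) x \<longleftrightarrow> c < x"

fun below :: "bound \<Rightarrow> real \<Rightarrow> bool" where
  "below Unbounded x \<longleftrightarrow> True"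
| "below (Closed c) x \<longleftrightarrow> x \<le> c"
| "below (Open c) x \<longleftrightarrow> x < c"

definition ivl :: "bound \<Rightarrow> bound \<Rightarrow> real set" where
  "ivl l u = {x. above l x \<and> below u x}"

lemma is_interval_iff_ivl: "is_interval S \<longleftrightarrow> (\<exists>l u. S = ivl l u)"
proof
  assume "is_interval S"
  from is_real_interval[OF this] obtain a b :: real where
    "S = {} \<or> S = UNIV \<or> S = {..<b} \<or> S = {..b} \<or> S = {a<..} \<or> S = {a..} \<or>
     S = {a<..<b} \<or> S = {a<..b} \<or> S = {a..<b} \<or> S = {a..b}" by blast
  moreover have "{} = ivl (Open 0) (Open 0)" "UNIV = ivl Unbounded Unbounded"
    "{..<b} = ivl Unbounded (Open b)" "{..b} = ivl Unbounded (Closed b)"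
    "{a<..} = ivl (Open a) Unbounded" "{a..} = ivl (Closed a) Unbounded"
    "{a<..<b} = ivl (Open a) (Open b)" "{a<..b} = ivl (Open a) (Closed b)"
    "{a..<b} = ivl (Closed a) (Open b)" "{a..b} = ivl (Closed a) (Closed b)"
    by (auto simp: ivl_def)
  ultimately show "\<exists>l u. S = ivl l u" by metis
next
  assume "\<exists>l u. S = ivl l u"
  then obtain l u where "S = ivl l u" by blast
  then show "is_interval S"
    by (cases l; cases u) (auto simp: ivl_def is_interval_1)
qed

fun bound_code :: "bound \<Rightarrow> nat" where
  "bound_code Unbounded = 0"
| "bound_code (Closed c) = 1"
| "bound_code (Open c) = 2"

fun bound_val :: "bound \<Rightarrow> real" where
  "bound_val Unbounded = 0"
| "bound_val (Closed c) = c"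
| "bound_val (Open c) = c"

definition decode_bound :: "nat \<Rightarrow> real \<Rightarrow> bound" where
  "decode_bound n x = (if n = 0 then Unbounded else if n = 1 then Closed x else Open x)"

lemma decode_bound [simp]: "decode_bound (bound_code c) (bound_val c) = c"
  by (cases c) (simp_all add: decode_bound_def)


section \<open>The machine model\<close>

text \<open>
  A unit-cost random access machine over the reals with an independence oracle, presented as a
  structured language. There are two kinds of memory, for indices (natural numbers) and
  for reals. Each consists of arrays; the array that an instruction accesses is given by a literal
  in the program, so a program uses finitely many arrays, whereas the position inside the
  array is computed. A scalar variable is an array cell at a constant position.

  Index arithmetic has only addition and truncated subtraction, and the real operations
  are the field operations and comparison. There is no conversion between the two kinds of
  memory (in particular no rounding), and the real constants of a program are rational, so that
  neither large numbers nor constants can be used to do many steps of work in a single one.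
\<close>

record state =
  idx :: "nat \<Rightarrow> nat \<Rightarrow> nat"
  num :: "nat \<Rightarrow> nat \<Rightarrow> real"

datatype iexp = IConst nat | IRead nat iexp | IAdd iexp iexp | ISub iexp iexp

datatype rexp = RConst rat | RRead nat iexp | RAdd rexp rexp | RSub rexp rexp
  | RMul rexp rexp | RDiv rexp rexp

datatype bexp = ILess iexp iexp | RLess rexp rexp | BNot bexp | BAnd bexp bexp

text \<open>\<open>Query r i q\<close> stores in position \<open>i\<close> of the index array \<open>r\<close> whether the set is
  independent whose characteristic vector is held in the first \<open>m\<close> cells of the index array \<open>q\<close>.\<close>

datatype com =
    Skip
  | IWrite nat iexp iexp
  | RWrite nat iexp rexp
  | Query nat iexp nat
  | Seq com com
  | If bexp com com
  | While bexp com

primrec ieval :: "state \<Rightarrow> iexp \<Rightarrow> nat" where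
  "ieval s (IConst n) = n"
| "ieval s (IRead r i) = idx s r (ieval s i)"
| "ieval s (IAdd x y) = ieval s x + ieval s y"
| "ieval s (ISub x y) = ieval s x - ieval s y"

primrec reval :: "state \<Rightarrow> rexp \<Rightarrow> real" where
  "reval s (RConst q) = of_rat q"
| "reval s (RRead r i) = num s r (ieval s i)"
| "reval s (RAdd x y) = reval s x + reval s y"
| "reval s (RSub x y) = reval s x - reval s y"
| "reval s (RMul x y) = reval s x * reval s y"
| "reval s (RDiv x y) = reval s x / reval s y"

primrec beval :: "state \<Rightarrow> bexp \<Rightarrow> bool" where
  "beval s (ILess x y) \<longleftrightarrow> ieval s x < ieval s y"
| "beval s (RLess x y) \<longleftrightarrow> reval s x < reval s y"
| "beval s (BNot c) \<longleftrightarrow> \<not> beval s c"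
| "beval s (BAnd c d) \<longleftrightarrow> beval s c \<and> beval s d"

primrec icost :: "iexp \<Rightarrow> nat" where
  "icost (IConst n) = 1"
| "icost (IRead r i) = 1 + icost i"
| "icost (IAdd x y) = 1 + icost x + icost y"
| "icost (ISub x y) = 1 + icost x + icost y"

primrec rcost :: "rexp \<Rightarrow> nat" where
  "rcost (RConst q) = 1"
| "rcost (RRead r i) = 1 + icost i"
| "rcost (RAdd x y) = 1 + rcost x + rcost y"
| "rcost (RSub x y) = 1 + rcost x + rcost y"
| "rcost (RMul x y) = 1 + rcost x + rcost y"
| "rcost (RDiv x y) = 1 + rcost x + rcost y"

primrec bcost :: "bexp \<Rightarrow> nat" where
  "bcost (ILess x y) = 1 + icost x + icost y"
| "bcost (RLess x y) = 1 + rcost x + rcost y"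
| "bcost (BNot c) = 1 + bcost c"
| "bcost (BAnd c d) = 1 + bcost c + bcost d"

definition iupd :: "nat \<Rightarrow> nat \<Rightarrow> nat \<Rightarrow> state \<Rightarrow> state" where
  "iupd r i v s = s\<lparr>idx := (idx s)(r := (idx s r)(i := v))\<rparr>"

definition rupd :: "nat \<Rightarrow> nat \<Rightarrow> real \<Rightarrow> state \<Rightarrow> state" where
  "rupd r i v s = s\<lparr>num := (num s)(r := (num s r)(i := v))\<rparr>"

text \<open>\<open>exec m F d P s t s'\<close>: started in \<open>s\<close>, the program \<open>P\<close> halts in \<open>s'\<close> after \<open>t\<close> steps, where
  the oracle answers for the ground set \<open>{..<m}\<close> with independent sets \<open>F\<close> and each
  of its answers takes \<open>d\<close> steps.\<close>

inductive exec :: "nat \<Rightarrow> nat set set \<Rightarrow> nat \<Rightarrow> com \<Rightarrow> state \<Rightarrow> nat \<Rightarrow> state \<Rightarrow> bool"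
  for m :: nat and F :: "nat set set" and d :: nat where
  Skip: "exec m F d Skip s 1 s"
| IWrite: "exec m F d (IWrite r i x) s (1 + icost i + icost x) (iupd r (ieval s i) (ieval s x) s)"
| RWrite: "exec m F d (RWrite r i x) s (1 + icost i + rcost x) (rupd r (ieval s i) (reval s x) s)"
| Query: "exec m F d (Query r i q) s (1 + icost i + d)
            (iupd r (ieval s i) (if {e. e < m \<and> idx s q e \<noteq> 0} \<in> F then 1 else 0) s)"
| Seq: "exec m F d P s t s' \<Longrightarrow> exec m F d Q s' t' s'' \<Longrightarrow> exec m F d (Seq P Q) s (1 + t + t') s''"
| IfTrue: "beval s c \<Longrightarrow> exec m F d P s t s' \<Longrightarrow> exec m F d (If c P Q) s (1 + bcost c + t) s'"
| IfFalse: "\<not> beval s c \<Longrightarrow> exec m F d Q s t s' \<Longrightarrow> exec m F d (If c P Q) s (1 + bcost c + t) s'"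
| WhileFalse: "\<not> beval s c \<Longrightarrow> exec m F d (While c P) s (1 + bcost c) s"
| WhileTrue: "beval s c \<Longrightarrow> exec m F d P s t s' \<Longrightarrow> exec m F d (While c P) s' t' s'' \<Longrightarrow>
                exec m F d (While c P) s (1 + bcost c + t + t') s''"

lemma exec_deterministic:
  "exec m F d P s t s' \<Longrightarrow> exec m F d P s u s'' \<Longrightarrow> u = t \<and> s'' = s'"
proof (induction arbitrary: u s'' rule: exec.induct)
  case (Seq P s t s' Q t' s1)
  from Seq.prems show ?case
    by cases (use Seq.IH in blast)
next
  case (WhileTrue s c P t s' t' s1)
  from WhileTrue.prems WhileTrue.hyps show ?case
    by cases (use WhileTrue.IH in blast)+
qed (erule exec.cases; fastforce)+


section \<open>Input and output\<close>

text \<open>Input: cells 0, 1, 2 of index array 0 hold the number of elements and the kinds of the two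
  endpoints of the parameter interval; cells 0, 1 of real array 0 hold the endpoints; real arrays
  1 and 2 hold the coefficients of the weights. The matroid itself is only
  accessible through the oracle; its rank is not part of the input.\<close>

definition input_state ::
    "nat \<Rightarrow> (nat \<Rightarrow> rat) \<Rightarrow> (nat \<Rightarrow> rat) \<Rightarrow> bound \<Rightarrow> bound \<Rightarrow> state" where
  "input_state m a b l u = \<lparr>
     idx = (\<lambda>r i. if r = 0 \<and> i = 0 then m
                  else if r = 0 \<and> i = 1 then bound_code l
                  else if r = 0 \<and> i = 2 then bound_code u
                  else 0),
     num = (\<lambda>r i. if r = 0 \<and> i = 0 then bound_val l
                  else if r = 0 \<and> i = 1 then bound_val u
                  else if r = 1 \<and> i < m then of_rat (a i)
                  else if r = 2 \<and> i < m then of_rat (b i)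
                  else 0) \<rparr>"

text \<open>Output: cell 0 of index array 1 holds the number of pieces. Piece \<open>j\<close> has its two
  endpoints in cell \<open>j\<close> of index arrays 2, 3 and of real arrays 3, 4, its
  most vital element in index array 4, and intercept and slope of the optimal value function in real
  arrays 5 and 6.\<close>

definition out_count :: "state \<Rightarrow> nat" where
  "out_count s = idx s 1 0"

definition out_piece :: "state \<Rightarrow> nat \<Rightarrow> real set" where
  "out_piece s j = ivl (decode_bound (idx s 2 j) (num s 3 j)) (decode_bound (idx s 3 j) (num s 4 j))"

definition out_element :: "state \<Rightarrow> nat \<Rightarrow> nat" where
  "out_element s j = idx s 4 j"

definition out_value :: "state \<Rightarrow> nat \<Rightarrow> real \<Rightarrow> real" where
  "out_value s j x = num s 5 j + x * num s 6 j"

definition correct_output ::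
    "nat \<Rightarrow> nat set set \<Rightarrow> (nat \<Rightarrow> rat) \<Rightarrow> (nat \<Rightarrow> rat) \<Rightarrow> real set \<Rightarrow> state \<Rightarrow> bool" where
  "correct_output m F a b I s \<longleftrightarrow>
     (\<Union>j<out_count s. out_piece s j) = I \<and>
     disjoint_family_on (out_piece s) {..<out_count s} \<and>
     (\<forall>j<out_count s. out_piece s j \<noteq> {} \<and>
        (\<forall>x\<in>out_piece s j.
           most_vital m F a b x (out_element s j) \<and>
           optimal_value m F a b x = out_value s j x))"

end

theory Submission
  imports Defs "HOL-Library.Discrete_Functions"
begin

text \<open>
  Fix a parameter value and order the elements by weight, ties being broken by index. Let \<open>B\<close> be the
  optimal basis. Deleting an element outside \<open>B\<close> costs nothing. Deleting \<open>g \<in> B\<close> turns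
  \<open>B\<close> into \<open>B - g + r\<close>, where the replacement \<open>r\<close> of \<open>g\<close> is the first element for which this is
  a basis (\<open>exchange_optimal_delete\<close>). So as long as the order does not change, the optimal
  interdiction value is the maximum of the \<open>k + 1\<close> linear functions \<open>w B\<close> and
  \<open>w B + w r - w g\<close> (\<open>best_entry_correct\<close>).

  The order changes only at an equality point, where an element \<open>e\<close> and its successor \<open>f\<close> change
  places (\<open>cell_transposed\<close>). One of three things happens. If \<open>e \<in> B\<close>, \<open>f \<notin> B\<close> and
  \<open>B - e + f\<close> is independent, then this is the new basis, and \<open>e\<close> takes the place of \<open>f\<close> as a
  replacement. If \<open>e, f \<notin> B\<close>, then \<open>f\<close> takes the place of \<open>e\<close> as the replacement of each \<open>g\<close> for which
  \<open>B - g + f\<close> is independent. Otherwise nothing changes. In every case \<open>O(k)\<close> independence tests suffice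
  (\<open>wp_update\<close>).

  The algorithm sweeps over the at most \<open>m\<^sup>2\<close> equality points and computes the upper envelope of the
  \<open>k + 1\<close> lines on each cell between two of them. The running time comes from spending only \<open>O(k)\<close> on each
  cell. A stack scan achieves this when the lines are sorted by slope (\<open>wp_emit_cell\<close>). They can be kept sorted in
  time \<open>O(k)\<close>: relative to \<open>w B\<close>, all lines that change at an event change their slope by the same
  amount, so the changed and the unchanged lines both stay sorted, and one merge suffices
  (\<open>wp_resort\<close>). In the case of a basis exchange this holds because the line \<open>w B\<close> itself is kept
  as an entry \<open>(h, h)\<close> with \<open>h \<notin> B\<close>: it becomes the line of \<open>f\<close>, while the line of \<open>e\<close> becomes
  the line of the new basis.

  Apart from this \<open>O(m\<^sup>2 k f(m))\<close>, a tournament tree finds the next equality point in time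
  \<open>O(log m)\<close> (\<open>wp_set_leaf\<close>), and \<open>m\<^sup>2 log m\<close> is at most a constant times
  \<open>m\<^sup>2 k powr (1/3) log (m k)\<close> because \<open>k \<ge> 1\<close> (\<open>sweep_cost_le\<close>).
\<close>

section \<open>Optimal bases and adjacent transpositions of the order\<close>

locale strict_linear =
  fixes prec :: "'a \<Rightarrow> 'a \<Rightarrow> bool"
  assumes irrefl: "\<not> prec x x"
    and trans: "prec x y \<Longrightarrow> prec y z \<Longrightarrow> prec x z"
    and total: "x \<noteq> y \<Longrightarrow> prec x y \<or> prec y x"
begin

lemma asym: "prec x y \<Longrightarrow> \<not> prec y x"
  using irrefl trans by blast

lemma ex_greatest:
  assumes "finite S" "S \<noteq> {}"
  shows "\<exists>x\<in>S. \<forall>y\<in>S. y = x \<or> prec y x"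
  using assms
proof (induction rule: finite_ne_induct)
  case (insert x S)
  then show ?case using total[of x] trans by (metis insert_iff)
qed simp

text \<open>If every initial segment of the order contains at least as many elements of \<open>A\<close> as of
  \<open>B\<close>, then the \<open>i\<close>-th element of \<open>A\<close> does not come after the \<open>i\<close>-th element of \<open>B\<close>. The
  induction removes the last elements of both sets.\<close>

lemma sum_le_if_dominated:
  fixes w :: "'a \<Rightarrow> real"
  assumes "finite A" "finite B" "card A = card B"
    and "\<And>x y. x \<in> A \<Longrightarrow> y \<in> B \<Longrightarrow> prec x y \<Longrightarrow> w x \<le> w y"
    and "\<And>t. t \<in> B \<Longrightarrow> card {x\<in>B. \<not> prec t x} \<le> card {x\<in>A. \<not> prec t x}"
  shows "sum w A \<le> sum w B"
  using assms
proof (induction "card A" arbitrary: A B)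
  case 0
  then show ?case by simp
next
  case (Suc n)
  then have "A \<noteq> {}" "B \<noteq> {}" by auto
  with Suc.prems obtain p q where p: "p \<in> A" "\<forall>y\<in>A. y = p \<or> prec y p"
    and q: "q \<in> B" "\<forall>y\<in>B. y = q \<or> prec y q"
    using ex_greatest by metis
  have "{x\<in>B. \<not> prec q x} = B" using q asym irrefl by auto
  then have "card B \<le> card {x\<in>A. \<not> prec q x}" using Suc.prems(5)[OF q(1)] by simp
  then have "{x\<in>A. \<not> prec q x} = A"
    using Suc.prems by (intro card_seteq) auto
  then have pq: "p = q \<or> prec p q" using p total by blast
  then have "w p \<le> w q" using Suc.prems p(1) q(1) by auto
  moreover have "sum w (A - {p}) \<le> sum w (B - {q})"
  proof (rule Suc.hyps(1))
    show "n = card (A - {p})" using Suc p by simp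
    show "card (A - {p}) = card (B - {q})" using Suc.prems p q by simp
    fix t assume t: "t \<in> B - {q}"
    show "card {x \<in> B - {q}. \<not> prec t x} \<le> card {x \<in> A - {p}. \<not> prec t x}"
    proof (cases "prec t p")
      case False
      then have "{x \<in> A - {p}. \<not> prec t x} = A - {p}" using p trans by blast
      moreover have "card {x \<in> B - {q}. \<not> prec t x} \<le> card (B - {q})"
        using Suc.prems by (intro card_mono) auto
      ultimately show ?thesis using Suc.prems p q by simp
    next
      case True
      then have "{x \<in> A - {p}. \<not> prec t x} = {x \<in> A. \<not> prec t x}" by auto
      moreover have "card {x \<in> B - {q}. \<not> prec t x} \<le> card {x \<in> B. \<not> prec t x}"
        using Suc.prems by (intro card_mono) auto
      ultimately show ?thesis using Suc.prems(5)[of t] t by simp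
    qed
  qed (use Suc.prems in auto)
  ultimately show ?case
    using sum.remove[OF Suc.prems(1) p(1), of w] sum.remove[OF Suc.prems(2) q(1), of w] by linarith
qed

end

context matroid
begin

lemma finite_indep: "X \<in> F \<Longrightarrow> finite X"
  using finite_ground indep_subset_ground finite_subset by metis

lemma basis_indep: "is_basis F B \<Longrightarrow> B \<in> F"
  by (simp add: is_basis_def)

lemma card_le_basis:
  assumes "is_basis F B" "X \<in> F"
  shows "card X \<le> card B"
proof (rule ccontr)
  assume "\<not> ?thesis"
  with assms obtain e where "e \<in> X - B" "insert e B \<in> F"
    using indep_augment[of B X] by (auto simp: is_basis_def)
  then show False using assms by (auto simp: is_basis_def)
qed

lemma is_basis_if_card:
  assumes "is_basis F B" "X \<in> F" "card X = card B"
  shows "is_basis F X"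
  unfolding is_basis_def
proof (intro conjI ballI impI)
  fix Y assume "Y \<in> F" "X \<subseteq> Y"
  then show "Y = X" using card_le_basis[OF assms(1), of Y] assms finite_indep card_seteq by metis
qed (fact assms)

lemma rank_eq_card_basis:
  assumes "is_basis F B"
  shows "matroid_rank F = card B"
proof -
  have "finite F"
    using finite_ground indep_subset_ground by (auto intro: finite_subset[of F "Pow E"])
  then show ?thesis
    unfolding matroid_rank_def using card_le_basis[OF assms] basis_indep[OF assms]
    by (intro Max_eqI) auto
qed

lemma extend_indep:
  assumes "X \<in> F" "Y \<in> F" "card X \<le> card Y"
  shows "\<exists>Z\<in>F. X \<subseteq> Z \<and> Z \<subseteq> X \<union> Y \<and> card Z = card Y"
  using assms
proof (induction "card Y - card X" arbitrary: X)
  case 0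
  then show ?case by auto
next
  case (Suc n)
  then obtain e where e: "e \<in> Y - X" "insert e X \<in> F"
    using indep_augment[of X Y] by force
  then have "card (insert e X) = Suc (card X)" using Suc.prems finite_indep by simp
  then have "\<exists>Z\<in>F. insert e X \<subseteq> Z \<and> Z \<subseteq> insert e X \<union> Y \<and> card Z = card Y"
    using Suc e by (intro Suc.hyps(1)) auto
  then show ?case using e by blast
qed

lemma augment_from_two:
  assumes "X \<in> F" "Y \<in> F" "card X < card Y" "Y \<subseteq> X \<union> {u, v}"
  shows "insert u X \<in> F \<or> insert v X \<in> F"
  using indep_augment[OF assms(1-3)] assms(4) by auto

lemma card_swap:
  assumes "B \<in> F" "e \<in> B" "f \<notin> B"
  shows "card (insert f (B - {e})) = card B"
  using assms finite_indep[OF assms(1)] card_Suc_Diff1[of B e] by auto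

text \<open>The matroid form of a fact about determinants: a nonsingular \<open>2 \<times> 2\<close> matrix whose lower right
  entry vanishes has two nonzero entries off the diagonal. The entry for \<open>x\<close> and \<open>y\<close> is nonzero if \<open>B - x + y\<close> is
  independent. The proof augments sets of size \<open>card B - 1\<close>.\<close>

lemma double_swap:
  assumes B: "B \<in> F" "e \<in> B" "x \<in> B" "e \<noteq> x" "f \<notin> B" "y \<notin> B" "f \<noteq> y"
    and D: "insert y (insert f (B - {e}) - {x}) \<in> F"
  shows "insert y (B - {x}) \<in> F \<or> insert y (B - {e}) \<in> F \<and> insert f (B - {x}) \<in> F"
proof -
  have fin: "finite B" using B finite_indep by blast
  let ?D = "insert y (insert f (B - {e}) - {x})"
  have cD: "card ?D = card B"
    using fin B card_swap[OF B(1,2,5)] by (auto simp: card_insert_if)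
  have "insert y (B - {e} - {x}) \<in> F" by (rule indep_mono[OF D]) auto
  moreover have "card (insert y (B - {e} - {x})) < card B"
    using fin B card_gt_0_iff[of "B - {e}"] by (auto simp: card_insert_if)
  ultimately have 1: "insert e (insert y (B - {e} - {x})) \<in> F \<or> insert x (insert y (B - {e} - {x})) \<in> F"
    using B by (intro augment_from_two[of _ B]) auto
  have 2: "insert e (insert y (B - {e} - {x})) = insert y (B - {x})"
    "insert x (insert y (B - {e} - {x})) = insert y (B - {e})" using B by auto
  have "B - {x} \<in> F" by (rule indep_mono[OF B(1)]) auto
  moreover have "card (B - {x}) < card ?D" using cD fin B by (metis card_Diff1_less)
  ultimately have "insert y (B - {x}) \<in> F \<or> insert f (B - {x}) \<in> F"
    using B D by (intro augment_from_two[of _ ?D]) auto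
  then show ?thesis using 1 2 by auto
qed

text \<open>Optimality as a local condition, which makes it easy to see what a transposition of the order
  does to it. Here \<open>prec\<close> is a linear order, so there are no ties.\<close>

definition exchange_optimal :: "('a \<Rightarrow> 'a \<Rightarrow> bool) \<Rightarrow> 'a set \<Rightarrow> bool" where
  "exchange_optimal prec B \<longleftrightarrow>
     is_basis F B \<and> (\<forall>e\<in>B. \<forall>f\<in>E - B. insert f (B - {e}) \<in> F \<longrightarrow> prec e f)"

lemma exchange_optimalD:
  assumes "exchange_optimal prec B"
  shows "is_basis F B" "B \<in> F" "B \<subseteq> E" "finite B"
    "e \<in> B \<Longrightarrow> f \<notin> B \<Longrightarrow> insert f (B - {e}) \<in> F \<Longrightarrow> prec e f"
proof -
  show 1: "is_basis F B" and 2: "B \<in> F" using assms by (simp_all add: exchange_optimal_def is_basis_def)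
  show "B \<subseteq> E" "finite B" using 2 indep_subset_ground finite_indep by blast+
  assume *: "e \<in> B" "f \<notin> B" "insert f (B - {e}) \<in> F"
  then have "f \<in> E" using indep_subset_ground by blast
  then show "prec e f" using assms * by (simp add: exchange_optimal_def)
qed

text \<open>A locally optimal basis is a maximal independent subset of every initial segment \<open>P\<close>:
  if \<open>f \<in> P\<close> could be added to \<open>B \<inter> P\<close>, then some \<open>B - e + f\<close> with \<open>e\<close> outside \<open>P\<close> would be a basis, although
  \<open>e\<close> comes after \<open>f\<close>. Hence it dominates every other basis on initial segments.\<close>

lemma exchange_optimal_min_weight:
  assumes lin: "strict_linear prec" and opt: "exchange_optimal prec B"
    and w: "\<And>x y. x \<in> E \<Longrightarrow> y \<in> E \<Longrightarrow> prec x y \<Longrightarrow> w x \<le> w y"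
  shows "min_weight_basis F w B"
  unfolding min_weight_basis_def
proof (intro conjI allI impI)
  interpret strict_linear prec by fact
  note B = exchange_optimalD[OF opt]
  show "is_basis F B" by (rule B)
  fix B' assume B': "is_basis F B'"
  have B'F: "B' \<in> F" "B' \<subseteq> E" "finite B'"
    using B' indep_subset_ground finite_indep by (auto simp: is_basis_def)
  show "sum w B \<le> sum w B'"
  proof (rule sum_le_if_dominated)
    show "card B = card B'"
      using card_le_basis B' B B'F by (metis le_antisym)
    fix t
    let ?P = "{x. \<not> prec t x}"
    have "card (B' \<inter> ?P) \<le> card (B \<inter> ?P)"
    proof (rule ccontr)
      assume "\<not> ?thesis"
      moreover have "B \<inter> ?P \<in> F" "B' \<inter> ?P \<in> F"
        using indep_mono[OF B(2)] indep_mono[OF B'F(1)] by auto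
      ultimately obtain f where f: "f \<in> B' \<inter> ?P - B \<inter> ?P" "insert f (B \<inter> ?P) \<in> F"
        using indep_augment[of "B \<inter> ?P" "B' \<inter> ?P"] by auto
      then have fB: "f \<notin> B" by auto
      obtain Z where Z: "Z \<in> F" "insert f (B \<inter> ?P) \<subseteq> Z" "Z \<subseteq> insert f (B \<inter> ?P) \<union> B" "card Z = card B"
        using extend_indep[OF f(2) B(2) card_le_basis[OF B(1) f(2)]] by blast
      have "\<not> B \<subseteq> Z"
      proof
        assume "B \<subseteq> Z"
        then have "insert f B \<subseteq> Z" using Z by auto
        then have "card (insert f B) \<le> card Z" using Z finite_indep by (intro card_mono) auto
        then show False using Z(4) fB B(4) by simp
      qed
      then obtain e where e: "e \<in> B" "e \<notin> Z" by auto
      have "Z \<subseteq> insert f (B - {e})" using Z e by auto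
      then have "Z = insert f (B - {e})"
        using card_swap[OF B(2) e(1) fB] Z(4) B(4) by (intro card_seteq) auto
      then have "prec e f" using B(5)[OF e(1) fB] Z(1) by simp
      then have "e \<in> ?P" using f(1) trans by auto
      then show False using e Z by auto
    qed
    then show "card {x \<in> B'. \<not> prec t x} \<le> card {x \<in> B. \<not> prec t x}"
      unfolding Collect_conj_eq Collect_mem_eq .
  qed (use B(3,4) B'F w in \<open>blast+\<close>)
qed

lemma greedy_exchange_optimal:
  assumes lin: "strict_linear prec" and BE: "B \<subseteq> E" and BF: "B \<in> F"
    and greedy: "\<And>x. x \<in> E \<Longrightarrow> x \<in> B \<longleftrightarrow> insert x {y\<in>B. prec y x} \<in> F"
  shows "exchange_optimal prec B"
proof -
  interpret strict_linear prec by fact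
  have "is_basis F B"
    unfolding is_basis_def
  proof (intro conjI ballI impI)
    fix X assume X: "X \<in> F" "B \<subseteq> X"
    have "x \<in> B" if "x \<in> X" for x
    proof -
      have "insert x {y\<in>B. prec y x} \<in> F" by (rule indep_mono[OF X(1)]) (use that X in auto)
      then show ?thesis using greedy that X indep_subset_ground by blast
    qed
    then show "X = B" using X by auto
  qed (fact BF)
  moreover have "prec e f" if "e \<in> B" "f \<in> E - B" "insert f (B - {e}) \<in> F" for e f
  proof (rule ccontr)
    assume "\<not> prec e f"
    then have "insert f {y\<in>B. prec y f} \<subseteq> insert f (B - {e})" by auto
    then have "insert f {y\<in>B. prec y f} \<in> F" using indep_mono that by blast
    then show False using greedy that by blast
  qed
  ultimately show ?thesis by (auto simp: exchange_optimal_def)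
qed

definition is_replacement :: "('a \<Rightarrow> 'a \<Rightarrow> bool) \<Rightarrow> 'a set \<Rightarrow> 'a \<Rightarrow> 'a \<Rightarrow> bool" where
  "is_replacement prec B g r \<longleftrightarrow>
     r \<notin> B \<and> insert r (B - {g}) \<in> F \<and>
     (\<forall>y. y \<notin> B \<longrightarrow> insert y (B - {g}) \<in> F \<longrightarrow> y = r \<or> prec r y)"

lemma restriction_matroid: "matroid (S \<inter> E) (restriction F S)"
proof
  show "finite (S \<inter> E)" using finite_ground by simp
  fix X Y assume "X \<in> restriction F S" "Y \<in> restriction F S" "card X < card Y"
  then show "\<exists>e\<in>Y - X. insert e X \<in> restriction F S"
    using indep_augment[of X Y] by (auto simp: restriction_def)
qed (use indep_subset_ground indep_empty indep_mono in \<open>auto simp: restriction_def\<close>)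

text \<open>The element \<open>r\<close> takes the role of \<open>g\<close>; an exchange in \<open>B - g + r\<close> that would be an
  improvement is split by \<open>double_swap\<close> into exchanges in \<open>B\<close>.\<close>

lemma exchange_optimal_delete:
  assumes lin: "strict_linear prec" and opt: "exchange_optimal prec B"
    and g: "g \<in> B" and r: "is_replacement prec B g r"
  shows "matroid.exchange_optimal (E - {g}) (restriction F (E - {g})) prec (insert r (B - {g}))"
proof -
  interpret strict_linear prec by fact
  interpret D: matroid "E - {g}" "restriction F (E - {g})"
    using restriction_matroid[of "E - {g}"] by (simp add: Int_absorb2 Diff_subset)
  note B = exchange_optimalD[OF opt]
  let ?A = "insert r (B - {g})"
  have A: "r \<notin> B" "?A \<in> F" "card ?A = card B"
    using r card_swap[OF B(2) g] by (auto simp: is_replacement_def)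
  then have bA: "is_basis F ?A" using is_basis_if_card[OF B(1)] by blast
  have "r \<noteq> g" using A g by auto
  then have "?A \<in> restriction F (E - {g})"
    using A indep_subset_ground[OF A(2)] by (auto simp: restriction_def)
  then have "is_basis (restriction F (E - {g})) ?A"
    using bA by (auto simp: is_basis_def restriction_def)
  moreover have "prec x y" if x: "x \<in> ?A" and y: "y \<in> E - {g} - ?A"
    and Fy: "insert y (?A - {x}) \<in> restriction F (E - {g})" for x y
  proof -
    have Fy: "insert y (?A - {x}) \<in> F" using Fy by (simp add: restriction_def)
    have yB: "y \<notin> B" "y \<noteq> r" using y by auto
    show ?thesis
    proof (cases "x = r")
      case True
      then have "insert y (B - {g}) \<in> F" using Fy A by (auto simp: insert_Diff_if)
      then show ?thesis using r yB True by (auto simp: is_replacement_def)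
    next
      case False
      then have xB: "x \<in> B" "x \<noteq> g" using x by auto
      from double_swap[OF B(2) g xB(1) xB(2)[symmetric] A(1) yB(1) yB(2)[symmetric] Fy]
      consider "insert y (B - {x}) \<in> F" | "insert y (B - {g}) \<in> F" "insert r (B - {x}) \<in> F" by auto
      then show ?thesis
      proof cases
        case 1
        then show ?thesis using B(5) xB yB by blast
      next
        case 2
        then have "prec r y" "prec x r" using r yB B(5)[OF xB(1) A(1)] by (auto simp: is_replacement_def)
        then show ?thesis using trans by blast
      qed
    qed
  qed
  ultimately show ?thesis by (auto simp: D.exchange_optimal_def)
qed

lemma exchange_optimal_delete_outside:
  assumes opt: "exchange_optimal prec B" and g: "g \<notin> B"
  shows "matroid.exchange_optimal (E - {g}) (restriction F (E - {g})) prec B"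
proof -
  interpret D: matroid "E - {g}" "restriction F (E - {g})"
    using restriction_matroid[of "E - {g}"] by (simp add: Int_absorb2 Diff_subset)
  note B = exchange_optimalD[OF opt]
  have "B \<in> restriction F (E - {g})" using B(2,3) g by (auto simp: restriction_def)
  then have "is_basis (restriction F (E - {g})) B"
    using B(1) by (simp add: is_basis_def restriction_def)
  then show ?thesis
    unfolding D.exchange_optimal_def using B(5) by (simp add: restriction_def)
qed

text \<open>If both relations are linear orders, then transitivity forces \<open>f\<close> to be the successor of \<open>e\<close>
  in \<open>prec\<close>, so the definition describes an adjacent transposition.\<close>

definition transposed :: "('a \<Rightarrow> 'a \<Rightarrow> bool) \<Rightarrow> ('a \<Rightarrow> 'a \<Rightarrow> bool) \<Rightarrow> 'a \<Rightarrow> 'a \<Rightarrow> bool" where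
  "transposed prec prec' e f \<longleftrightarrow>
     e \<in> E \<and> f \<in> E \<and> prec e f \<and> prec' f e \<and>
     (\<forall>x\<in>E. \<forall>y\<in>E. {x, y} \<noteq> {e, f} \<longrightarrow> prec x y \<longrightarrow> prec' x y)"

lemma is_replacement_ground: "is_replacement prec B g r \<Longrightarrow> r \<in> E"
  using indep_subset_ground by (auto simp: is_replacement_def)

context
  fixes prec prec' e f B
  assumes lin: "strict_linear prec" and lin': "strict_linear prec'"
    and tr: "transposed prec prec' e f" and opt: "exchange_optimal prec B"
begin

interpretation P: strict_linear prec by (fact lin)
interpretation P': strict_linear prec' by (fact lin')

lemma transposed_pair: "e \<in> E" "f \<in> E" "e \<noteq> f" "prec e f" "prec' f e"
  using tr P.irrefl by (auto simp: transposed_def)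

lemma transposed_other: "x \<in> E \<Longrightarrow> y \<in> E \<Longrightarrow> prec x y \<Longrightarrow> x \<noteq> e \<or> y \<noteq> f \<Longrightarrow> prec' x y"
  using tr P.asym transposed_pair unfolding transposed_def by (metis doubleton_eq_iff)

lemma transposed_above: "y \<in> E \<Longrightarrow> prec e y \<Longrightarrow> y \<noteq> f \<Longrightarrow> prec' e y \<and> prec' f y \<and> prec f y"
  using transposed_other transposed_pair P'.trans P.total P'.asym by metis

lemma transposed_below: "x \<in> E \<Longrightarrow> prec x f \<Longrightarrow> x \<noteq> e \<Longrightarrow> prec' x f \<and> prec' x e \<and> prec x e"
  using transposed_other transposed_pair P'.trans P.total P'.asym by metis

text \<open>Only the pair \<open>(e, f)\<close> is compared differently, and the exchange of \<open>e\<close> for \<open>f\<close> is impossible by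
  assumption.\<close>

lemma transposed_keep_basis:
  assumes "\<not> (e \<in> B \<and> f \<notin> B \<and> insert f (B - {e}) \<in> F)"
  shows "exchange_optimal prec' B"
  unfolding exchange_optimal_def
proof (intro conjI ballI impI)
  note B = exchange_optimalD[OF opt]
  show "is_basis F B" by (rule B)
  fix x y assume "x \<in> B" "y \<in> E - B" "insert y (B - {x}) \<in> F"
  then show "prec' x y" using B(5)[of x y] B(3) assms transposed_other[of x y] by auto
qed

lemma transposed_keep_replacement:
  assumes g: "g \<in> B" and r: "is_replacement prec B g r"
  shows "is_replacement prec' B g (if r = e \<and> f \<notin> B \<and> insert f (B - {g}) \<in> F then f else r)"
proof -
  have rB: "r \<notin> B" "insert r (B - {g}) \<in> F"
    and rmin: "\<And>y. y \<notin> B \<Longrightarrow> insert y (B - {g}) \<in> F \<Longrightarrow> y = r \<or> prec r y"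
    using r by (auto simp: is_replacement_def)
  have ground: "y \<in> E" if "insert y (B - {g}) \<in> F" for y
    using indep_subset_ground[OF that] by simp
  note rE = is_replacement_ground[OF r]
  show ?thesis
  proof (cases "r = e \<and> f \<notin> B \<and> insert f (B - {g}) \<in> F")
    case True
    have "y = f \<or> prec' f y" if y: "y \<notin> B" "insert y (B - {g}) \<in> F" for y
      using rmin[OF y] True transposed_above[OF ground[OF y(2)]] transposed_pair(5) by metis
    then show ?thesis using True by (simp add: is_replacement_def)
  next
    case False
    have "y = r \<or> prec' r y" if y: "y \<notin> B" "insert y (B - {g}) \<in> F" for y
      using rmin[OF y] y False transposed_other[OF rE ground[OF y(2)]] by metis
    then show ?thesis unfolding if_not_P[OF False] using rB by (simp add: is_replacement_def)
  qed
qed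

context
  assumes e: "e \<in> B" and f: "f \<notin> B" and Fef: "insert f (B - {e}) \<in> F"
begin

lemma transposed_swap_basis:
  "exchange_optimal prec' (insert f (B - {e}))" (is "exchange_optimal _ ?B")
  unfolding exchange_optimal_def
proof (intro conjI ballI impI)
  note B = exchange_optimalD[OF opt]
  show "is_basis F ?B" using is_basis_if_card[OF B(1) Fef card_swap[OF B(2) e f]] .
  fix x y assume x: "x \<in> ?B" and y: "y \<in> E - ?B" and Fxy: "insert y (?B - {x}) \<in> F"
  have xE: "x \<in> E" using x B(3) transposed_pair by auto
  show "prec' x y"
  proof (cases "x = f")
    case True
    show ?thesis
    proof (cases "y = e")
      case False
      then have "insert y (B - {e}) \<in> F" using Fxy True f by (auto simp: insert_Diff_if)
      then have "prec e y" using B(5)[OF e, of y] False y by auto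
      then show ?thesis using transposed_above True y by auto
    qed (use True transposed_pair in auto)
  next
    case False
    then have xB: "x \<in> B" "x \<noteq> e" using x by auto
    show ?thesis
    proof (cases "y = e")
      case True
      have "insert e (?B - {x}) = insert f (B - {x})" using xB e False by auto
      then have "prec x f" using Fxy True B(5)[OF xB(1) f] by simp
      then show ?thesis using transposed_below xE xB True by auto
    next
      case ye: False
      then have yB: "y \<notin> B" "y \<noteq> f" "y \<in> E" using y by auto
      from double_swap[OF B(2) e xB(1) xB(2)[symmetric] f yB(1) yB(2)[symmetric] Fxy]
      consider "insert y (B - {x}) \<in> F" | "insert y (B - {e}) \<in> F" "insert f (B - {x}) \<in> F" by auto
      then show ?thesis
      proof cases
        case 1
        then show ?thesis using B(5)[OF xB(1) yB(1)] transposed_other xE yB xB by auto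
      next
        case 2
        then have "prec e y" "prec x f" using B(5)[OF e yB(1)] B(5)[OF xB(1) f] by auto
        then show ?thesis using transposed_above transposed_below xE yB xB P'.trans by metis
      qed
    qed
  qed
qed

lemma transposed_swap_entering:
  "is_replacement prec' (insert f (B - {e})) f e" (is "is_replacement _ ?B _ _")
  unfolding is_replacement_def
proof (intro conjI allI impI)
  note B = exchange_optimalD[OF opt]
  have 1: "?B - {f} = B - {e}" using f by auto
  show "e \<notin> ?B" using transposed_pair by auto
  show "insert e (?B - {f}) \<in> F" unfolding 1 using B(2) e by (simp add: insert_absorb)
  fix y assume y: "y \<notin> ?B" and Fy: "insert y (?B - {f}) \<in> F"
  show "y = e \<or> prec' e y"
  proof (cases "y = e")
    case False
    then have "prec e y" using B(5)[OF e, of y] y Fy unfolding 1 by auto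
    moreover have "y \<in> E" using Fy indep_subset_ground by auto
    ultimately show ?thesis using transposed_above[of y] y by auto
  qed simp
qed

text \<open>The element that leaves the basis had \<open>f\<close> as its replacement: nothing lies between \<open>e\<close> and \<open>f\<close>.
  This is why its entry \<open>(e, f)\<close> is turned into \<open>(e, e)\<close> by the rule that renames replacements.\<close>

lemma transposed_swap_leaving:
  assumes "is_replacement prec B e r"
  shows "r = f"
proof (rule ccontr)
  assume "r \<noteq> f"
  then have "prec r f" "r \<notin> B" "r \<in> E"
    using assms f Fef is_replacement_ground by (auto simp: is_replacement_def)
  moreover have "prec e r"
    using assms exchange_optimalD(5)[OF opt e] by (auto simp: is_replacement_def)
  ultimately show False using transposed_above[of r] \<open>r \<noteq> f\<close> P.asym by blast
qed

text \<open>For \<open>g \<noteq> e\<close> in the basis a replacement \<open>f\<close> is renamed to \<open>e\<close>, since \<open>B - e + f - g + e = B - g + f\<close>. Every other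
  replacement is kept: if it ceased to be feasible, then both \<open>B - g + f\<close> and \<open>B - e + r\<close>
  would be independent, which would put \<open>r\<close> between \<open>e\<close> and \<open>f\<close>.\<close>

lemma transposed_swap_replacement:
  assumes g: "g \<in> B" "g \<noteq> e" and r: "is_replacement prec B g r"
  shows "is_replacement prec' (insert f (B - {e})) g (if r = f then e else r)" (is "is_replacement _ ?B _ _")
proof -
  note B = exchange_optimalD[OF opt]
  have rB: "r \<notin> B" "insert r (B - {g}) \<in> F"
    and rmin: "\<And>y. y \<notin> B \<Longrightarrow> insert y (B - {g}) \<in> F \<Longrightarrow> y = r \<or> prec r y"
    using r by (auto simp: is_replacement_def)
  have rE: "r \<in> E" using is_replacement_ground[OF r] .
  have re: "r \<noteq> e" using rB e by auto
  have fg: "f \<noteq> g" using f g by auto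
  have eB: "insert e (?B - {g}) = insert f (B - {g})" using e g fg by auto
  have split: "insert y (B - {g}) \<in> F \<or> insert y (B - {e}) \<in> F \<and> insert f (B - {g}) \<in> F"
    if "y \<notin> ?B" "insert y (?B - {g}) \<in> F" "y \<noteq> e" for y
    using double_swap[OF B(2) e g(1) g(2)[symmetric] f _ _ that(2)] that by auto
  have yE: "y \<in> E" if "insert y (?B - {g}) \<in> F" for y using indep_subset_ground that by auto
  have fin: "finite B" by (rule B)
  show ?thesis
  proof (cases "r = f")
    case True
    have "y = e \<or> prec' e y" if y: "y \<notin> ?B" "insert y (?B - {g}) \<in> F" for y
    proof (cases "y = e")
      case False
      then have yB: "y \<notin> B" "y \<noteq> f" using y by auto
      have "prec e y" using split[OF y False] B(5)[OF e yB(1)] rmin[OF yB(1)] yB True transposed_pair P.trans by metis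
      then show ?thesis using transposed_above yE[OF y(2)] yB by auto
    qed simp
    then show ?thesis using True eB rB transposed_pair by (auto simp: is_replacement_def)
  next
    case False
    have D: "insert r (?B - {g}) \<in> F"
    proof -
      have c: "card (insert r (B - {g})) = card B" "card ?B = card B"
        using card_swap[OF B(2)] rB e f g by auto
      have X: "?B - {g} \<in> F" by (rule indep_mono[OF Fef]) auto
      have "card (?B - {g}) < card B" using card_Diff1_less[of ?B g] c(2) fin g by simp
      then have 1: "insert e (?B - {g}) \<in> F \<or> insert r (?B - {g}) \<in> F"
        using augment_from_two[OF X rB(2), of e r] c by auto
      have Y: "insert r (B - {g} - {e}) \<in> F" by (rule indep_mono[OF rB(2)]) auto
      have "card (insert r (B - {g} - {e})) < card B"
        using fin g e rB card_gt_0_iff[of "B - {g}"] by (auto simp: card_insert_if)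
      then have 2: "insert g (insert r (B - {g} - {e})) \<in> F \<or> insert f (insert r (B - {g} - {e})) \<in> F"
        using augment_from_two[OF Y Fef, of g f] c by auto
      have 3: "insert g (insert r (B - {g} - {e})) = insert r (B - {e})"
        "insert f (insert r (B - {g} - {e})) = insert r (?B - {g})" using g fg by auto
      show ?thesis
      proof (rule ccontr)
        assume "\<not> ?thesis"
        then have "insert f (B - {g}) \<in> F" "insert r (B - {e}) \<in> F" using 1 2 3 eB by auto
        then have "prec r f" "prec e r" using rmin[OF f] False B(5)[OF e rB(1)] by auto
        then show False using transposed_above[OF rE] False P.asym by blast
      qed
    qed
    have "y = r \<or> prec' r y" if y: "y \<notin> ?B" "insert y (?B - {g}) \<in> F" for y
    proof (cases "y = e")
      case True
      then have "insert f (B - {g}) \<in> F" using y eB by simp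
      then have "prec r f" using rmin[OF f] False by auto
      then show ?thesis using transposed_below[OF rE] re True by auto
    next
      case ye: False
      then have yB: "y \<notin> B" using y by auto
      from split[OF y ye] show ?thesis
      proof
        assume "insert y (B - {g}) \<in> F"
        then show ?thesis using rmin[OF yB] transposed_other[OF rE yE[OF y(2)]] re by auto
      next
        assume "insert y (B - {e}) \<in> F \<and> insert f (B - {g}) \<in> F"
        then have "prec e y" "prec r f" using B(5)[OF e yB] rmin[OF f] False by auto
        then have "prec' e y" "prec' r e" using transposed_above[OF yE[OF y(2)]] transposed_below[OF rE] re y by auto
        then show ?thesis using P'.trans by blast
      qed
    qed
    then show ?thesis using False D rB by (auto simp: is_replacement_def)
  qed
qed

end
end
end

section \<open>Weakest preconditions with running times\<close>

lemma idx_iupd [simp]: "idx (iupd r i v s) r' = (if r' = r then (idx s r)(i := v) else idx s r')"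
  and num_iupd [simp]: "num (iupd r i v s) = num s"
  and idx_rupd [simp]: "idx (rupd r i x s) = idx s"
  and num_rupd [simp]: "num (rupd r i x s) r' = (if r' = r then (num s r)(i := x) else num s r')"
  by (simp_all add: iupd_def rupd_def)

abbreviation ivar :: "nat \<Rightarrow> iexp" where "ivar r \<equiv> IRead r (IConst 0)"
abbreviation rvar :: "nat \<Rightarrow> rexp" where "rvar r \<equiv> RRead r (IConst 0)"
abbreviation iset :: "nat \<Rightarrow> iexp \<Rightarrow> com" where "iset r x \<equiv> IWrite r (IConst 0) x"
abbreviation rset :: "nat \<Rightarrow> rexp \<Rightarrow> com" where "rset r x \<equiv> RWrite r (IConst 0) x"
abbreviation BOr :: "bexp \<Rightarrow> bexp \<Rightarrow> bexp" where "BOr x y \<equiv> BNot (BAnd (BNot x) (BNot y))"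
abbreviation IEq :: "iexp \<Rightarrow> iexp \<Rightarrow> bexp" where
  "IEq x y \<equiv> BAnd (BNot (ILess x y)) (BNot (ILess y x))"
abbreviation succ :: "iexp \<Rightarrow> iexp" where "succ x \<equiv> IAdd x (IConst 1)"
notation Seq (infixr ";;" 60)

definition For :: "nat \<Rightarrow> iexp \<Rightarrow> com \<Rightarrow> com" where
  "For r bnd c = iset r (IConst 0) ;; While (ILess (ivar r) bnd) (c ;; iset r (succ (ivar r)))"

locale oracle_machine =
  fixes m :: nat and F :: "nat set set" and d :: nat
begin

definition wp :: "com \<Rightarrow> (nat \<Rightarrow> state \<Rightarrow> bool) \<Rightarrow> state \<Rightarrow> bool" where
  "wp c Q s \<longleftrightarrow> (\<exists>t s'. exec m F d c s t s' \<and> Q t s')"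

lemma wp_mono: "wp c Q s \<Longrightarrow> (\<And>t s'. Q t s' \<Longrightarrow> Q' t s') \<Longrightarrow> wp c Q' s"
  unfolding wp_def by blast

lemma wp_Skip [simp]: "wp Skip Q s \<longleftrightarrow> Q 1 s"
  unfolding wp_def using exec.Skip by (blast elim: exec.cases)

lemma wp_IWrite [simp]:
  "wp (IWrite r i x) Q s \<longleftrightarrow> Q (1 + icost i + icost x) (iupd r (ieval s i) (ieval s x) s)"
  unfolding wp_def using exec.IWrite by (blast elim: exec.cases)

lemma wp_RWrite [simp]:
  "wp (RWrite r i x) Q s \<longleftrightarrow> Q (1 + icost i + rcost x) (rupd r (ieval s i) (reval s x) s)"
  unfolding wp_def using exec.RWrite by (blast elim: exec.cases)

lemma wp_Query [simp]:
  "wp (Query r i q) Q s \<longleftrightarrow>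
     Q (1 + icost i + d) (iupd r (ieval s i) (if {e. e < m \<and> idx s q e \<noteq> 0} \<in> F then 1 else 0) s)"
  unfolding wp_def using exec.Query by (blast elim: exec.cases)

lemma wp_Seq [simp]: "wp (P ;; R) Q s \<longleftrightarrow> wp P (\<lambda>t s'. wp R (\<lambda>t' s''. Q (1 + t + t') s'') s') s"
  unfolding wp_def by (blast intro: exec.Seq elim: exec.cases)

lemma wp_If [simp]:
  "wp (If c P R) Q s \<longleftrightarrow>
     (if beval s c then wp P (\<lambda>t s'. Q (1 + bcost c + t) s') s
      else wp R (\<lambda>t s'. Q (1 + bcost c + t) s') s)"
proof -
  have "exec m F d (If c P R) s t s' \<longleftrightarrow>
      (\<exists>u. t = 1 + bcost c + u \<and> exec m F d (if beval s c then P else R) s u s')" for t s'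
    by (subst exec.simps) auto
  then show ?thesis unfolding wp_def by auto
qed

lemma wp_While_False: "\<not> beval s c \<Longrightarrow> Q (1 + bcost c) s \<Longrightarrow> wp (While c P) Q s"
  unfolding wp_def by (blast intro: exec.WhileFalse)

lemma wp_While_True:
  "beval s c \<Longrightarrow> wp P (\<lambda>t s'. wp (While c P) (\<lambda>t' s''. Q (1 + bcost c + t + t') s'') s') s \<Longrightarrow>
   wp (While c P) Q s"
  unfolding wp_def by (blast intro: exec.WhileTrue)

text \<open>The invariant carries a bound \<open>n\<close> on the number of remaining iterations, so correctness and
  running time are proved together.\<close>

lemma wp_While:
  assumes "Inv n s"
    and step: "\<And>n s. Inv n s \<Longrightarrow> beval s c \<Longrightarrow> wp P (\<lambda>t s'. t \<le> K \<and> (\<exists>n'<n. Inv n' s')) s"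
    and "\<And>t n' s'. Inv n' s' \<Longrightarrow> \<not> beval s' c \<Longrightarrow> t \<le> n * (K + 1 + bcost c) + 1 + bcost c \<Longrightarrow> Q t s'"
  shows "wp (While c P) Q s"
  using assms(1,3)
proof (induction n arbitrary: s Q rule: less_induct)
  case (less n)
  show ?case
  proof (cases "beval s c")
    case False
    then show ?thesis using less.prems by (intro wp_While_False) auto
  next
    case True
    show ?thesis
    proof (rule wp_While_True[OF True], rule wp_mono[OF step[OF less.prems(1) True]], elim conjE exE)
      fix t s' n' assume t: "t \<le> K" and n': "n' < n" "Inv n' s'"
      then have "Suc n' * (K + 1 + bcost c) \<le> n * (K + 1 + bcost c)" by (intro mult_right_mono) auto
      then show "wp (While c P) (\<lambda>t' s''. Q (1 + bcost c + t + t') s'') s'"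
        using t n' by (intro less.IH[OF n'] less.prems(2)) auto
    qed
  qed
qed

text \<open>Here \<open>K\<close> bounds the cost of one execution of the body; the number 12 covers the loop's own test and counter.
  The numerals in the time bounds below are generous bounds on step counts of straight-line code.\<close>

lemma wp_For:
  assumes init: "Inv 0 (iupd r 0 0 s)"
    and bnd: "\<And>i s. Inv i s \<Longrightarrow> ieval s bnd = n"
    and step: "\<And>i s. i < n \<Longrightarrow> Inv i s \<Longrightarrow> idx s r 0 = i \<Longrightarrow>
      wp c (\<lambda>t s'. t \<le> K \<and> idx s' r 0 = i \<and> Inv (Suc i) (iupd r 0 (Suc i) s')) s"
    and post: "\<And>t s'. Inv n s' \<Longrightarrow> idx s' r 0 = n \<Longrightarrow>
      t \<le> n * (K + icost bnd + 12) + icost bnd + 12 \<Longrightarrow> Q t s'"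
  shows "wp (For r bnd c) Q s"
proof -
  let ?I = "\<lambda>k s. k \<le> n \<and> idx s r 0 = n - k \<and> Inv (n - k) s"
  have "wp (While (ILess (ivar r) bnd) (c ;; iset r (succ (ivar r))))
          (\<lambda>t s'. Q (t + 4) s') (iupd r 0 0 s)"
  proof (rule wp_While[where Inv = ?I and n = n and K = "K + 7"])
    show "n \<le> n \<and> idx (iupd r 0 0 s) r 0 = n - n \<and> Inv (n - n) (iupd r 0 0 s)" using init by simp
  next
    fix k s assume I: "?I k s" and b: "beval s (ILess (ivar r) bnd)"
    then have k: "0 < k" using bnd[of "n - k" s] by simp
    then have "n - k < n" and "Suc (n - k) = n - (k - 1)" using I by auto
    then show "wp (c ;; iset r (succ (ivar r))) (\<lambda>t s'. t \<le> K + 7 \<and> (\<exists>n'<k. ?I n' s')) s"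
      using step[of "n - k" s] I k by (auto elim!: wp_mono intro!: exI[of _ "k - 1"])
  next
    fix t k s' assume I: "?I k s'" and "\<not> beval s' (ILess (ivar r) bnd)"
      and t: "t \<le> n * (K + 7 + 1 + bcost (ILess (ivar r) bnd)) + 1 + bcost (ILess (ivar r) bnd)"
    then have "\<not> n - k < n" using bnd[of "n - k" s'] by simp
    then have "k = 0" using I by linarith
    then show "Q (t + 4) s'" using I t by (intro post) (auto simp: algebra_simps)
  qed
  then show ?thesis unfolding For_def by (simp add: numeral_eq_Suc)
qed

end

section \<open>Memory layout\<close>

text \<open>Each variable of the program has an array of its own (a scalar uses cell 0), so that two
  variables do not interfere as soon as their array numbers differ, which the simplifier decides.
  Arrays 0 to 6 carry input and output. The events are the pairs \<open>(EVE i, EVF i)\<close>, \<open>1 \<le> i \<le> NEV\<close>,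
  with parameter value \<open>KEY i\<close>; a tournament \<open>TREE\<close> with \<open>LV\<close> leaves selects the next one.
  \<open>BAS\<close> is the characteristic vector of the optimal basis and \<open>WA\<close>, \<open>WB\<close> are the coefficients
  of its weight. \<open>(LG i, LR i)\<close>, \<open>i < LEN\<close>, are the lines whose maximum is the interdiction value,
  \<open>MK\<close> marks the lines that have just changed, and \<open>XG\<close> to \<open>YP\<close> are buffers for merging.
  \<open>(SG j, SR j)\<close>, \<open>j < SN\<close>, is the upper envelope of these lines, with breakpoints \<open>PB j\<close>.
  The piece of the interval in which the sweep currently stays has the bounds
  \<open>(SK, CL)\<close> and \<open>(EK, CU)\<close>, encoded as in the input.\<close>

abbreviation (input) EVE :: nat where "EVE \<equiv> 10"
abbreviation (input) EVF :: nat where "EVF \<equiv> 11"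
abbreviation (input) NEV :: nat where "NEV \<equiv> 34"
abbreviation (input) TREE :: nat where "TREE \<equiv> 12"
abbreviation (input) HALF :: nat where "HALF \<equiv> 13"
abbreviation (input) LV :: nat where "LV \<equiv> 52"
abbreviation (input) CUR :: nat where "CUR \<equiv> 30"
abbreviation (input) VAL :: nat where "VAL \<equiv> 31"
abbreviation (input) BAS :: nat where "BAS \<equiv> 14"
abbreviation (input) CAND :: nat where "CAND \<equiv> 15"
abbreviation (input) BEST :: nat where "BEST \<equiv> 35"
abbreviation (input) RES :: nat where "RES \<equiv> 36"
abbreviation (input) HH :: nat where "HH \<equiv> 51"
abbreviation (input) LG :: nat where "LG \<equiv> 16"
abbreviation (input) LR :: nat where "LR \<equiv> 17"
abbreviation (input) MK :: nat where "MK \<equiv> 18"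
abbreviation (input) LEN :: nat where "LEN \<equiv> 37"
abbreviation (input) XG :: nat where "XG \<equiv> 19"
abbreviation (input) XR :: nat where "XR \<equiv> 20"
abbreviation (input) XN :: nat where "XN \<equiv> 38"
abbreviation (input) XP :: nat where "XP \<equiv> 40"
abbreviation (input) YG :: nat where "YG \<equiv> 21"
abbreviation (input) YR :: nat where "YR \<equiv> 22"
abbreviation (input) YN :: nat where "YN \<equiv> 39"
abbreviation (input) YP :: nat where "YP \<equiv> 41"
abbreviation (input) GG :: nat where "GG \<equiv> 49"
abbreviation (input) RR :: nat where "RR \<equiv> 50"
abbreviation (input) EE :: nat where "EE \<equiv> 46"
abbreviation (input) FF :: nat where "FF \<equiv> 47"
abbreviation (input) SG :: nat where "SG \<equiv> 23"
abbreviation (input) SR :: nat where "SR \<equiv> 24"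
abbreviation (input) SN :: nat where "SN \<equiv> 42"
abbreviation (input) LI :: nat where "LI \<equiv> 43"
abbreviation (input) SK :: nat where "SK \<equiv> 44"
abbreviation (input) EK :: nat where "EK \<equiv> 45"
abbreviation (input) CI :: nat where "CI \<equiv> 32"
abbreviation (input) CJ :: nat where "CJ \<equiv> 33"
abbreviation (input) KI :: nat where "KI \<equiv> 48"
abbreviation (input) KEY :: nat where "KEY \<equiv> 10"
abbreviation (input) PB :: nat where "PB \<equiv> 11"
abbreviation (input) X0 :: nat where "X0 \<equiv> 20"
abbreviation (input) CL :: nat where "CL \<equiv> 21"
abbreviation (input) CU :: nat where "CU \<equiv> 22"
abbreviation (input) WA :: nat where "WA \<equiv> 23"
abbreviation (input) WB :: nat where "WB \<equiv> 24"
abbreviation (input) TMP :: nat where "TMP \<equiv> 25"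

text \<open>Frame conditions: only the listed arrays may have changed.\<close>

abbreviation idx_kept :: "nat set \<Rightarrow> state \<Rightarrow> state \<Rightarrow> bool" where
  "idx_kept R s s' \<equiv> \<forall>r. r \<notin> R \<longrightarrow> idx s' r = idx s r"

abbreviation num_kept :: "nat set \<Rightarrow> state \<Rightarrow> state \<Rightarrow> bool" where
  "num_kept R s s' \<equiv> \<forall>r. r \<notin> R \<longrightarrow> num s' r = num s r"

section \<open>The tournament tree of events\<close>

abbreviation earlier :: "iexp \<Rightarrow> iexp \<Rightarrow> bexp" where
  "earlier x y \<equiv> BAnd (ILess (IConst 0) x)
     (BNot (BAnd (ILess (IConst 0) y) (BNot (RLess (RRead KEY x) (RRead KEY y)))))"

definition set_leaf :: com where
  "set_leaf = IWrite TREE (ivar CUR) (ivar VAL) ;;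
     While (ILess (IConst 1) (ivar CUR))
       (iset CUR (IRead HALF (ivar CUR)) ;;
        If (earlier (IRead TREE (IAdd (ivar CUR) (ivar CUR))) (IRead TREE (succ (IAdd (ivar CUR) (ivar CUR)))))
          (IWrite TREE (ivar CUR) (IRead TREE (IAdd (ivar CUR) (ivar CUR))))
          (IWrite TREE (ivar CUR) (IRead TREE (succ (IAdd (ivar CUR) (ivar CUR))))))"

text \<open>The identifier 0 stands for an absent event.\<close>

definition event_time :: "(nat \<Rightarrow> real) \<Rightarrow> nat \<Rightarrow> ereal" where
  "event_time key i = (if i = 0 then \<infinity> else ereal (key i))"

definition node_ok :: "(nat \<Rightarrow> real) \<Rightarrow> (nat \<Rightarrow> nat) \<Rightarrow> nat \<Rightarrow> bool" where
  "node_ok key T j \<longleftrightarrow>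
     T j = (if event_time key (T (2 * j)) < event_time key (T (2 * j + 1)) then T (2 * j) else T (2 * j + 1))"

definition tournament :: "(nat \<Rightarrow> real) \<Rightarrow> (nat \<Rightarrow> nat) \<Rightarrow> nat \<Rightarrow> bool" where
  "tournament key T n \<longleftrightarrow> (\<forall>j. 1 \<le> j \<longrightarrow> j < n \<longrightarrow> node_ok key T j)"

lemma tournament_root_minimal:
  assumes "tournament key T n" "1 \<le> j" "j < 2 * n"
  shows "event_time key (T 1) \<le> event_time key (T j)"
  using assms(2,3)
proof (induction j rule: less_induct)
  case (less j)
  show ?case
  proof (cases "j = 1")
    case False
    then have i: "1 \<le> j div 2" "j div 2 < n" "j div 2 < j" using less.prems by auto
    then have "node_ok key T (j div 2)" using assms(1) by (auto simp: tournament_def)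
    moreover have "j = 2 * (j div 2) \<or> j = 2 * (j div 2) + 1" by auto
    ultimately have "event_time key (T (j div 2)) \<le> event_time key (T j)"
      unfolding node_ok_def by (smt (verit) linorder_not_less order.refl order.strict_implies_order)
    then show ?thesis using less.IH[of "j div 2"] i less.prems by auto
  qed simp
qed

lemma tournament_root_leaf:
  assumes "tournament key T n" "1 \<le> j" "j < 2 * n"
  shows "\<exists>i. n \<le> i \<and> i < 2 * n \<and> T j = T i"
  using assms(2,3)
proof (induction "2 * n - j" arbitrary: j rule: less_induct)
  case less
  show ?case
  proof (cases "j < n")
    case True
    then have "node_ok key T j" using assms(1) less.prems by (auto simp: tournament_def)
    then have "T j = T (2 * j) \<or> T j = T (2 * j + 1)" by (auto simp: node_ok_def)
    then obtain j' where j': "T j = T j'" "j < j'" "j' < 2 * n" using True less.prems(1) by force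
    then show ?thesis using less.hyps[of j'] less.prems by auto
  next
    case False
    then show ?thesis using less.prems by (intro exI[of _ j]) auto
  qed
qed

context oracle_machine
begin

text \<open>Writing a leaf, and afterwards any node on the way up, can violate the tournament condition
  only at the parent of the node written last; the path ends at the root, whose parent 0 is not a node.\<close>

lemma wp_set_leaf:
  assumes T: "tournament (num s KEY) (idx s TREE) n"
    and half: "\<And>j. j < 2 * n \<Longrightarrow> idx s HALF j = j div 2"
    and c: "idx s CUR 0 = c" "n \<le> c" "c < 2 * n"
  shows "wp set_leaf (\<lambda>t s'. t \<le> 70 * floor_log c + 70 \<and>
      tournament (num s KEY) (idx s' TREE) n \<and>
      (\<forall>j\<ge>n. idx s' TREE j = (if j = c then idx s VAL 0 else idx s TREE j)) \<and>
      idx_kept {TREE, CUR} s s' \<and> num s' = num s) s"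
proof -
  define Inv where "Inv = (\<lambda>k (s' :: state). \<exists>c'. idx s' CUR 0 = c' \<and> 1 \<le> c' \<and> c' < 2 * n \<and> floor_log c' = k \<and>
      (\<forall>j. 1 \<le> j \<longrightarrow> j < n \<longrightarrow> j \<noteq> c' div 2 \<longrightarrow> node_ok (num s KEY) (idx s' TREE) j) \<and>
      (\<forall>j\<ge>n. idx s' TREE j = (if j = c then idx s VAL 0 else idx s TREE j)) \<and>
      idx_kept {TREE, CUR} s s' \<and> num s' = num s)"
  show ?thesis
    unfolding set_leaf_def wp_Seq wp_IWrite
  proof (rule wp_While[where Inv = Inv and n = "floor_log c" and K = 60])
    show "Inv (floor_log c) (iupd TREE (ieval s (ivar CUR)) (ieval s (ivar VAL)) s)"
    proof -
      have "node_ok (num s KEY) ((idx s TREE)(c := idx s VAL 0)) j" if "1 \<le> j" "j < n" "j \<noteq> c div 2" for j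
      proof -
        have "2 * j \<noteq> c" "2 * j + 1 \<noteq> c" "j \<noteq> c" using that c by auto
        then show ?thesis using T that by (simp add: tournament_def node_ok_def)
      qed
      then show ?thesis unfolding Inv_def using c by auto
    qed
  next
    fix k s' assume I: "Inv k s'" and b: "beval s' (ILess (IConst 1) (ivar CUR))"
    from I obtain c' where c': "idx s' CUR 0 = c'" "1 \<le> c'" "c' < 2 * n" "floor_log c' = k"
      and ok: "\<And>j. 1 \<le> j \<Longrightarrow> j < n \<Longrightarrow> j \<noteq> c' div 2 \<Longrightarrow> node_ok (num s KEY) (idx s' TREE) j"
      and lf: "\<And>j. j \<ge> n \<Longrightarrow> idx s' TREE j = (if j = c then idx s VAL 0 else idx s TREE j)"
      and fr: "idx_kept {TREE, CUR} s s'" "num s' = num s"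
      unfolding Inv_def by blast
    have c2: "2 \<le> c'" using b c' by simp
    define p where "p = c' div 2"
    have p: "1 \<le> p" "p < n" "floor_log p < k"
      using c2 c'(3,4) floor_log_rec[OF c2] by (auto simp: p_def simp del: floor_log_half)
    have h: "idx s' HALF c' = p" using fr half c' by (simp add: p_def)
    define T' where "T' = (idx s' TREE)(p := (if event_time (num s KEY) (idx s' TREE (2 * p)) <
      event_time (num s KEY) (idx s' TREE (2 * p + 1)) then idx s' TREE (2 * p) else idx s' TREE (2 * p + 1)))"
    have "node_ok (num s KEY) T' j" if "1 \<le> j" "j < n" "j \<noteq> p div 2" for j
    proof (cases "j = p")
      case True
      then show ?thesis using p by (simp add: node_ok_def T'_def)
    next
      case False
      have "2 * j \<noteq> p" "2 * j + 1 \<noteq> p" using that by auto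
      then show ?thesis using ok[of j] that False by (simp add: node_ok_def T'_def p_def[symmetric])
    qed
    then have new: "Inv (floor_log p) s''" if "idx s'' CUR 0 = p" "idx s'' TREE = T'"
        "idx_kept {TREE, CUR} s s''" "num s'' = num s" for s''
      unfolding Inv_def using that p lf by (auto simp: T'_def)
    have pp: "p + p = 2 * p" by simp
    show "wp (iset CUR (IRead HALF (ivar CUR)) ;;
        If (earlier (IRead TREE (IAdd (ivar CUR) (ivar CUR))) (IRead TREE (succ (IAdd (ivar CUR) (ivar CUR)))))
          (IWrite TREE (ivar CUR) (IRead TREE (IAdd (ivar CUR) (ivar CUR))))
          (IWrite TREE (ivar CUR) (IRead TREE (succ (IAdd (ivar CUR) (ivar CUR))))))
        (\<lambda>t s'. t \<le> 60 \<and> (\<exists>n'<k. Inv n' s')) s'"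
    proof -
      let ?s = "iupd TREE p (T' p) (iupd CUR 0 p s')"
      have "Inv (floor_log p) ?s" by (rule new) (use fr in \<open>auto simp: T'_def\<close>)
      then have "\<exists>n'<k. Inv n' ?s" using p(3) by blast
      then show ?thesis using h fr(2) by (simp add: pp event_time_def c'(1) T'_def split: if_splits)
    qed
  next
    fix t k s'
    assume I: "Inv k s'" and b: "\<not> beval s' (ILess (IConst 1) (ivar CUR))"
      and t: "t \<le> floor_log c * (60 + 1 + bcost (ILess (IConst 1) (ivar CUR))) + 1 + bcost (ILess (IConst 1) (ivar CUR))"
    have "idx s' CUR 0 div 2 = 0" using b by simp
    then show "1 + (1 + icost (ivar CUR) + icost (ivar VAL)) + t \<le> 70 * floor_log c + 70 \<and>
      tournament (num s KEY) (idx s' TREE) n \<and>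
      (\<forall>j\<ge>n. idx s' TREE j = (if j = c then idx s VAL 0 else idx s TREE j)) \<and>
      idx_kept {TREE, CUR} s s' \<and> num s' = num s"
      using I t unfolding Inv_def tournament_def by auto
  qed
qed

end

section \<open>The list of lines\<close>

abbreviation melems :: iexp where "melems \<equiv> IRead 0 (IConst 0)"
abbreviation incr :: "nat \<Rightarrow> com" where "incr r \<equiv> iset r (succ (ivar r))"

definition before :: "(nat \<Rightarrow> real) \<Rightarrow> (nat \<Rightarrow> real) \<Rightarrow> real \<Rightarrow> nat \<Rightarrow> nat \<Rightarrow> bool" where
  "before \<alpha> \<beta> x e f \<longleftrightarrow>
     \<alpha> e + x * \<beta> e < \<alpha> f + x * \<beta> f \<or> \<alpha> e + x * \<beta> e = \<alpha> f + x * \<beta> f \<and> e < f"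

lemma strict_linear_before: "strict_linear (before \<alpha> \<beta> x)"
  by standard (auto simp: before_def)

abbreviation weight_exp :: "iexp \<Rightarrow> rexp" where
  "weight_exp i \<equiv> RAdd (RRead 1 i) (RMul (rvar X0) (RRead 2 i))"

definition pick_lightest :: com where
  "pick_lightest = iset BEST melems ;;
     For CJ melems
       (If (BAnd (ILess (IConst 0) (IRead CAND (ivar CJ)))
             (BOr (IEq (ivar BEST) melems) (RLess (weight_exp (ivar CJ)) (weight_exp (ivar BEST)))))
         (iset BEST (ivar CJ)) Skip)"

definition entry :: "state \<Rightarrow> nat \<Rightarrow> nat \<Rightarrow> nat \<Rightarrow> nat \<times> nat" where
  "entry s G R i = (idx s G i, idx s R i)"

lemma entry_iupd [simp]:
  "r \<noteq> G \<Longrightarrow> r \<noteq> R \<Longrightarrow> entry (iupd r i v s) G R = entry s G R"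
  "G \<noteq> R \<Longrightarrow> entry (iupd G i v s) G R = (entry s G R)(i := (v, snd (entry s G R i)))"
  "G \<noteq> R \<Longrightarrow> entry (iupd R i v s) G R = (entry s G R)(i := (fst (entry s G R i), v))"
  "entry (rupd r i x s) G R = entry s G R"
  by (auto simp: entry_def fun_eq_iff)

text \<open>The line of an entry \<open>(g, r)\<close> is \<open>w r - w g\<close>; applied to the intercepts or to the slopes of the
  weights, \<open>gain\<close> gives its intercept or its slope.\<close>

definition gain :: "(nat \<Rightarrow> real) \<Rightarrow> nat \<times> nat \<Rightarrow> real" where
  "gain \<beta> p = \<beta> (snd p) - \<beta> (fst p)"

abbreviation slope_exp :: "nat \<Rightarrow> nat \<Rightarrow> iexp \<Rightarrow> rexp" where
  "slope_exp G R i \<equiv> RSub (RRead 2 (IRead R i)) (RRead 2 (IRead G i))"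

definition distribute :: com where
  "distribute = iset XN (IConst 0) ;; iset YN (IConst 0) ;;
     For CJ (ivar LEN)
       (If (ILess (IConst 0) (IRead MK (ivar CJ)))
          (IWrite YG (ivar YN) (IRead LG (ivar CJ)) ;; IWrite YR (ivar YN) (IRead LR (ivar CJ)) ;;
           incr YN ;; IWrite MK (ivar CJ) (IConst 0))
          (IWrite XG (ivar XN) (IRead LG (ivar CJ)) ;; IWrite XR (ivar XN) (IRead LR (ivar CJ)) ;;
           incr XN))"

definition merge_back :: com where
  "merge_back = iset XP (IConst 0) ;; iset YP (IConst 0) ;;
     For CJ (ivar LEN)
       (If (BAnd (ILess (ivar YP) (ivar YN))
             (BNot (BAnd (ILess (ivar XP) (ivar XN))
               (BNot (RLess (slope_exp YG YR (ivar YP)) (slope_exp XG XR (ivar XP)))))))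
          (IWrite LG (ivar CJ) (IRead YG (ivar YP)) ;; IWrite LR (ivar CJ) (IRead YR (ivar YP)) ;; incr YP)
          (IWrite LG (ivar CJ) (IRead XG (ivar XP)) ;; IWrite LR (ivar CJ) (IRead XR (ivar XP)) ;; incr XP))"

definition resort :: com where
  "resort = distribute ;; merge_back"

text \<open>The invariant of a merge: \<open>xp\<close> and \<open>yp\<close> elements have been taken from \<open>X\<close> and \<open>Y\<close>, and everything
  already in \<open>L\<close> is at most what is still to come. It is symmetric in \<open>X\<close> and \<open>Y\<close>, which halves the proof.\<close>

definition merged :: "('a \<Rightarrow> real) \<Rightarrow> (nat \<Rightarrow> 'a) \<Rightarrow> nat \<Rightarrow> (nat \<Rightarrow> 'a) \<Rightarrow> nat \<Rightarrow> (nat \<Rightarrow> 'a) \<Rightarrow> nat \<Rightarrow> nat \<Rightarrow> bool" where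
  "merged sl X xn Y yn L xp yp \<longleftrightarrow>
     xp \<le> xn \<and> yp \<le> yn \<and> L ` {..<xp + yp} = X ` {..<xp} \<union> Y ` {..<yp} \<and>
     (\<forall>i j. i < j \<longrightarrow> j < xp + yp \<longrightarrow> sl (L i) \<le> sl (L j)) \<and>
     (\<forall>q<xp + yp. (xp < xn \<longrightarrow> sl (L q) \<le> sl (X xp)) \<and> (yp < yn \<longrightarrow> sl (L q) \<le> sl (Y yp)))"

lemma merged_sym: "merged sl X xn Y yn L xp yp \<Longrightarrow> merged sl Y yn X xn L yp xp"
  by (auto simp: merged_def add.commute)

lemma merged_step:
  assumes M: "merged sl X xn Y yn L xp yp"
    and X: "\<And>i j. i < j \<Longrightarrow> j < xn \<Longrightarrow> sl (X i) \<le> sl (X j)"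
    and x: "xp < xn" "yp < yn \<Longrightarrow> sl (X xp) \<le> sl (Y yp)"
    and L': "\<And>i. L' i = (if i = xp + yp then X xp else L i)"
  shows "merged sl X xn Y yn L' (Suc xp) yp"
proof -
  have "L' ` {..<Suc xp + yp} = insert (X xp) (L ` {..<xp + yp})"
    using L' by (auto simp: lessThan_Suc image_iff less_Suc_eq)
  moreover have "X ` {..<Suc xp} = insert (X xp) (X ` {..<xp})"
    by (simp add: lessThan_Suc)
  moreover have "sl (L' i) \<le> sl (X xp)" if "i < Suc (xp + yp)" for i
    using that M x L' by (auto simp: merged_def less_Suc_eq)
  moreover have "sl (X xp) \<le> sl (X (Suc xp))" if "Suc xp < xn" using X that by simp
  ultimately show ?thesis
    using M x L' unfolding merged_def
    by (auto simp: less_Suc_eq intro: order.trans[of _ "sl (X xp)"])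
qed

context oracle_machine
begin

definition support :: "(nat \<Rightarrow> nat) \<Rightarrow> nat set" where
  "support f = {e. e < m \<and> f e \<noteq> 0}"

lemma support_upd [simp]:
  "support (f(i := 0)) = support f - {i}"
  "i < m \<Longrightarrow> support (f(i := Suc v)) = insert i (support f)"
  by (auto simp: support_def)

lemma support_less: "e \<in> support f \<Longrightarrow> e < m"
  by (simp add: support_def)

lemma finite_support [simp]: "finite (support f)"
  by (simp add: support_def)

lemma wp_Query_support [simp]:
  "wp (Query r i q) Q s \<longleftrightarrow>
     Q (1 + icost i + d) (iupd r (ieval s i) (if support (idx s q) \<in> F then 1 else 0) s)"
  unfolding wp_Query support_def ..

declare wp_Query [simp del]

text \<open>Ties are resolved by the index because candidates are scanned in ascending order and only a strictly
  lighter one displaces the current choice.\<close>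

lemma wp_pick_lightest:
  assumes m: "idx s 0 0 = m" and ex: "j0 < m" "idx s CAND j0 \<noteq> 0"
  shows "wp pick_lightest (\<lambda>t s'. t \<le> 80 * m + 60 \<and>
      idx s' BEST 0 < m \<and> idx s CAND (idx s' BEST 0) \<noteq> 0 \<and>
      (\<forall>j<m. idx s CAND j \<noteq> 0 \<longrightarrow> j = idx s' BEST 0 \<or>
         before (num s 1) (num s 2) (num s X0 0) (idx s' BEST 0) j) \<and>
      idx_kept {BEST, CJ} s s' \<and> num s' = num s) s"
proof -
  let ?w = "\<lambda>j. num s 1 j + num s X0 0 * num s 2 j"
  define Inv where "Inv = (\<lambda>i (s' :: state).
      (idx s' BEST 0 = m \<and> (\<forall>j<i. idx s CAND j = 0) \<or>
       idx s' BEST 0 < i \<and> idx s' BEST 0 < m \<and> idx s CAND (idx s' BEST 0) \<noteq> 0 \<and>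
       (\<forall>j<i. idx s CAND j \<noteq> 0 \<longrightarrow> j = idx s' BEST 0 \<or>
         before (num s 1) (num s 2) (num s X0 0) (idx s' BEST 0) j)) \<and>
      idx_kept {BEST, CJ} s s' \<and> num s' = num s)"
  show ?thesis
    unfolding pick_lightest_def wp_Seq wp_IWrite
  proof (rule wp_For[where Inv = Inv and n = m and K = 60])
    fix i s' assume i: "i < m" "Inv i s'" "idx s' CJ 0 = i"
    have fr: "idx_kept {BEST, CJ} s s'" "num s' = num s"
      using i(2) by (auto simp: Inv_def)
    have C: "idx s' CAND = idx s CAND" "idx s' 0 0 = m" using fr m by auto
    obtain b where b: "idx s' BEST 0 = b" by simp
    have keep: "Inv (Suc i) (iupd CJ 0 (Suc i) s')"
      if "idx s CAND i = 0 \<or> b \<noteq> m \<and> \<not> ?w i < ?w b"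
      using i b that by (auto simp: Inv_def less_Suc_eq before_def not_less order.order_iff_strict)
    have new: "Inv (Suc i) (iupd CJ 0 (Suc i) (iupd BEST 0 i s'))"
      if "idx s CAND i \<noteq> 0" "b = m \<or> ?w i < ?w b"
      using i b that by (auto simp: Inv_def less_Suc_eq before_def)
    show "wp (If (BAnd (ILess (IConst 0) (IRead CAND (ivar CJ)))
             (BOr (IEq (ivar BEST) melems) (RLess (weight_exp (ivar CJ)) (weight_exp (ivar BEST)))))
         (iset BEST (ivar CJ)) Skip)
       (\<lambda>t s'. t \<le> 60 \<and> idx s' CJ 0 = i \<and> Inv (Suc i) (iupd CJ 0 (Suc i) s')) s'"
    proof (cases "idx s CAND i \<noteq> 0 \<and> (b = m \<or> ?w i < ?w b)")
      case True
      then show ?thesis using new by (auto simp: C b i(3) fr(2))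
    next
      case False
      then show ?thesis using keep by (auto simp: C b i(3) fr(2))
    qed
  qed (use m ex in \<open>auto simp: Inv_def\<close>)
qed

lemma wp_distribute:
  fixes s :: state
  defines "sl \<equiv> gain (num s 2)" and "L \<equiv> entry s LG LR"
  assumes n: "idx s LEN 0 = n"
    and un: "\<And>i j. i < j \<Longrightarrow> j < n \<Longrightarrow> idx s MK i = 0 \<Longrightarrow> idx s MK j = 0 \<Longrightarrow> sl (L i) \<le> sl (L j)"
    and mk: "\<And>i j. i < j \<Longrightarrow> j < n \<Longrightarrow> idx s MK i \<noteq> 0 \<Longrightarrow> idx s MK j \<noteq> 0 \<Longrightarrow> sl (L i) \<le> sl (L j)"
  shows "wp distribute (\<lambda>t s'. t \<le> 80 * n + 40 \<and>
      idx s' XN 0 + idx s' YN 0 = n \<and>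
      (\<forall>p q. p < q \<longrightarrow> q < idx s' XN 0 \<longrightarrow> sl (entry s' XG XR p) \<le> sl (entry s' XG XR q)) \<and>
      (\<forall>p q. p < q \<longrightarrow> q < idx s' YN 0 \<longrightarrow> sl (entry s' YG YR p) \<le> sl (entry s' YG YR q)) \<and>
      entry s' XG XR ` {..<idx s' XN 0} \<union> entry s' YG YR ` {..<idx s' YN 0} = L ` {..<n} \<and>
      (\<forall>i<n. idx s' MK i = 0) \<and>
      idx_kept {MK, XG, XR, YG, YR, XN, YN, CJ} s s' \<and> num s' = num s) s"
proof -
  define Inv where "Inv = (\<lambda>i (s' :: state).
      idx s' XN 0 + idx s' YN 0 = i \<and>
      (\<forall>p<idx s' XN 0. \<exists>q<i. idx s MK q = 0 \<and> entry s' XG XR p = L q) \<and>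
      (\<forall>p<idx s' YN 0. \<exists>q<i. idx s MK q \<noteq> 0 \<and> entry s' YG YR p = L q) \<and>
      (\<forall>p q. p < q \<longrightarrow> q < idx s' XN 0 \<longrightarrow> sl (entry s' XG XR p) \<le> sl (entry s' XG XR q)) \<and>
      (\<forall>p q. p < q \<longrightarrow> q < idx s' YN 0 \<longrightarrow> sl (entry s' YG YR p) \<le> sl (entry s' YG YR q)) \<and>
      entry s' XG XR ` {..<idx s' XN 0} \<union> entry s' YG YR ` {..<idx s' YN 0} = L ` {..<i} \<and>
      (\<forall>q. idx s' MK q = (if q < i then 0 else idx s MK q)) \<and>
      idx_kept {MK, XG, XR, YG, YR, XN, YN, CJ} s s' \<and> num s' = num s)"
  show ?thesis
    unfolding distribute_def wp_Seq wp_IWrite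
  proof (rule wp_For[where Inv = Inv and n = n and K = 60], goal_cases)
    case 1
    show ?case by (auto simp: Inv_def)
  next
    case (2 i s')
    then show ?case using n by (simp add: Inv_def)
  next
    case i: (3 i s')
    define x y where "x = idx s' XN 0" and "y = idx s' YN 0"
    have I: "x + y = i"
      "\<forall>p<x. \<exists>q<i. idx s MK q = 0 \<and> entry s' XG XR p = L q"
      "\<forall>p<y. \<exists>q<i. idx s MK q \<noteq> 0 \<and> entry s' YG YR p = L q"
      "\<forall>p q. p < q \<longrightarrow> q < x \<longrightarrow> sl (entry s' XG XR p) \<le> sl (entry s' XG XR q)"
      "\<forall>p q. p < q \<longrightarrow> q < y \<longrightarrow> sl (entry s' YG YR p) \<le> sl (entry s' YG YR q)"
      "entry s' XG XR ` {..<x} \<union> entry s' YG YR ` {..<y} = L ` {..<i}"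
      "\<forall>q. idx s' MK q = (if q < i then 0 else idx s MK q)"
      "idx_kept {MK, XG, XR, YG, YR, XN, YN, CJ} s s'" "num s' = num s"
      using i(2) unfolding Inv_def x_def y_def by - (elim conjE, assumption)+
    have Li: "idx s' LG = idx s LG" "idx s' LR = idx s LR" using I(8) by auto
    show ?case
    proof (cases "idx s MK i = 0")
      case True
      let ?s = "iupd CJ 0 (Suc i) (iupd XN 0 (Suc x) (iupd XR x (idx s LR i) (iupd XG x (idx s LG i) s')))"
      have E: "entry ?s XG XR = (entry s' XG XR)(x := L i)" "entry ?s YG YR = entry s' YG YR"
        by (auto simp: entry_def L_def)
      have "Inv (Suc i) ?s"
        unfolding Inv_def E
      proof (intro conjI allI impI)
        show "idx ?s XN 0 + idx ?s YN 0 = Suc i" using I(1) by (simp add: y_def)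
      next
        fix p assume "p < idx ?s XN 0"
        then show "\<exists>q<Suc i. idx s MK q = 0 \<and> ((entry s' XG XR)(x := L i)) p = L q"
          using I(2)[rule_format, of p] True by (auto simp: less_Suc_eq)
      next
        fix p assume "p < idx ?s YN 0"
        then show "\<exists>q<Suc i. idx s MK q \<noteq> 0 \<and> entry s' YG YR p = L q"
          using I(3)[rule_format, of p] by (auto simp: less_Suc_eq y_def)
      next
        fix p q assume "p < q" "q < idx ?s XN 0"
        then show "sl (((entry s' XG XR)(x := L i)) p) \<le> sl (((entry s' XG XR)(x := L i)) q)"
          using I(2)[rule_format, of p] I(4)[rule_format, of p q] un[of _ i] True i(1) by (auto simp: less_Suc_eq)
      next
        fix p q assume "p < q" "q < idx ?s YN 0"
        then show "sl (entry s' YG YR p) \<le> sl (entry s' YG YR q)"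
          using I(5)[rule_format, of p q] by (auto simp: y_def)
      next
        have "((entry s' XG XR)(x := L i)) ` {..<Suc x} = insert (L i) (entry s' XG XR ` {..<x})"
          by (auto simp: lessThan_Suc)
        then show "((entry s' XG XR)(x := L i)) ` {..<idx ?s XN 0} \<union> entry s' YG YR ` {..<idx ?s YN 0} = L ` {..<Suc i}"
          using I(6) by (simp add: y_def lessThan_Suc)
      qed (use I(7-9) True in \<open>auto simp: less_Suc_eq\<close>)
      then show ?thesis
        using True I(7,9) i(3) Li by (simp add: x_def[symmetric])
    next
      case False
      let ?s = "iupd CJ 0 (Suc i) (iupd MK i 0 (iupd YN 0 (Suc y) (iupd YR y (idx s LR i) (iupd YG y (idx s LG i) s'))))"
      have E: "entry ?s YG YR = (entry s' YG YR)(y := L i)" "entry ?s XG XR = entry s' XG XR"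
        by (auto simp: entry_def L_def)
      have "Inv (Suc i) ?s"
        unfolding Inv_def E
      proof (intro conjI allI impI)
        show "idx ?s XN 0 + idx ?s YN 0 = Suc i" using I(1) by (simp add: x_def)
      next
        fix p assume "p < idx ?s YN 0"
        then show "\<exists>q<Suc i. idx s MK q \<noteq> 0 \<and> ((entry s' YG YR)(y := L i)) p = L q"
          using I(3)[rule_format, of p] False by (auto simp: less_Suc_eq)
      next
        fix p assume "p < idx ?s XN 0"
        then show "\<exists>q<Suc i. idx s MK q = 0 \<and> entry s' XG XR p = L q"
          using I(2)[rule_format, of p] by (auto simp: less_Suc_eq x_def)
      next
        fix p q assume "p < q" "q < idx ?s YN 0"
        then show "sl (((entry s' YG YR)(y := L i)) p) \<le> sl (((entry s' YG YR)(y := L i)) q)"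
          using I(3)[rule_format, of p] I(5)[rule_format, of p q] mk[of _ i] False i(1) by (auto simp: less_Suc_eq)
      next
        fix p q assume "p < q" "q < idx ?s XN 0"
        then show "sl (entry s' XG XR p) \<le> sl (entry s' XG XR q)"
          using I(4)[rule_format, of p q] by (auto simp: x_def)
      next
        have "((entry s' YG YR)(y := L i)) ` {..<Suc y} = insert (L i) (entry s' YG YR ` {..<y})"
          by (auto simp: lessThan_Suc)
        then show "entry s' XG XR ` {..<idx ?s XN 0} \<union> ((entry s' YG YR)(y := L i)) ` {..<idx ?s YN 0} = L ` {..<Suc i}"
          using I(6) by (simp add: x_def lessThan_Suc)
      qed (use I(7-9) False in \<open>auto simp: less_Suc_eq\<close>)
      then show ?thesis
        using False I(7,9) i(3) Li by (simp add: y_def[symmetric])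
    qed
  next
    case (4 t s')
    then show ?case unfolding Inv_def by simp
  qed
qed

lemma wp_merge_back:
  fixes s :: state
  defines "sl \<equiv> gain (num s 2)"
  assumes n: "idx s LEN 0 = n" and xy: "idx s XN 0 + idx s YN 0 = n"
    and X: "\<And>i j. i < j \<Longrightarrow> j < idx s XN 0 \<Longrightarrow> sl (entry s XG XR i) \<le> sl (entry s XG XR j)"
    and Y: "\<And>i j. i < j \<Longrightarrow> j < idx s YN 0 \<Longrightarrow> sl (entry s YG YR i) \<le> sl (entry s YG YR j)"
  shows "wp merge_back (\<lambda>t s'. t \<le> 80 * n + 40 \<and>
      (\<forall>i j. i < j \<longrightarrow> j < n \<longrightarrow> sl (entry s' LG LR i) \<le> sl (entry s' LG LR j)) \<and>
      entry s' LG LR ` {..<n} = entry s XG XR ` {..<idx s XN 0} \<union> entry s YG YR ` {..<idx s YN 0} \<and>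
      idx_kept {LG, LR, XP, YP, CJ} s s' \<and> num s' = num s) s"
proof -
  define x y where "x = idx s XN 0" and "y = idx s YN 0"
  define Inv where "Inv = (\<lambda>i (s' :: state).
      idx s' XP 0 + idx s' YP 0 = i \<and>
      merged sl (entry s XG XR) x (entry s YG YR) y (entry s' LG LR) (idx s' XP 0) (idx s' YP 0) \<and>
      idx_kept {LG, LR, XP, YP, CJ} s s' \<and> num s' = num s)"
  show ?thesis
    unfolding merge_back_def wp_Seq wp_IWrite
  proof (rule wp_For[where Inv = Inv and n = n and K = 60], goal_cases)
    case 1
    show ?case by (auto simp: Inv_def merged_def)
  next
    case (2 i s')
    then show ?case using n by (simp add: Inv_def)
  next
    case i: (3 i s')
      define xp yp where "xp = idx s' XP 0" and "yp = idx s' YP 0"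
      have J: "xp + yp = i" "merged sl (entry s XG XR) x (entry s YG YR) y (entry s' LG LR) xp yp"
        "idx_kept {LG, LR, XP, YP, CJ} s s'" "num s' = num s"
        using i(2) unfolding Inv_def xp_def yp_def by - (elim conjE, assumption)+
      have A: "idx s' XN 0 = x" "idx s' YN 0 = y" "idx s' XG = idx s XG" "idx s' XR = idx s XR"
        "idx s' YG = idx s YG" "idx s' YR = idx s YR" using J(3) by (auto simp: x_def y_def)
      have le: "xp \<le> x" "yp \<le> y" using J(2) by (auto simp: merged_def)
      let ?c = "yp < y \<and> (xp < x \<longrightarrow> sl (entry s YG YR yp) < sl (entry s XG XR xp))"
      have new: "Inv (Suc i) (iupd CJ 0 (Suc i) (iupd YP 0 (Suc yp)
          (iupd LR i (idx s YR yp) (iupd LG i (idx s YG yp) s'))))" (is "Inv _ ?s") if c: ?c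
      proof -
        have "merged sl (entry s YG YR) y (entry s XG XR) x (entry ?s LG LR) (Suc yp) xp"
          by (rule merged_step[OF merged_sym[OF J(2)]]) (use c X Y J(1) in \<open>auto simp: entry_def x_def y_def\<close>)
        then have "merged sl (entry s XG XR) x (entry s YG YR) y (entry ?s LG LR) xp (Suc yp)"
          by (rule merged_sym)
        then show ?thesis unfolding Inv_def using J(1,3,4) by (simp add: xp_def)
      qed
      have old: "Inv (Suc i) (iupd CJ 0 (Suc i) (iupd XP 0 (Suc xp)
          (iupd LR i (idx s XR xp) (iupd LG i (idx s XG xp) s'))))" (is "Inv _ ?s") if c: "\<not> ?c"
      proof -
        have "xp < x" using c le i(1) J(1) xy by (auto simp: x_def y_def)
        then have "merged sl (entry s XG XR) x (entry s YG YR) y (entry ?s LG LR) (Suc xp) yp"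
          by (intro merged_step[OF J(2)]) (use c X Y J(1) in \<open>auto simp: entry_def x_def y_def\<close>)
        then show ?thesis unfolding Inv_def using J(1,3,4) by (simp add: yp_def)
      qed
      show ?case
        using new old i(3) J(4) by (simp add: A xp_def[symmetric] yp_def[symmetric] gain_def entry_def sl_def)
  next
    case (4 t s')
    then have M: "merged sl (entry s XG XR) x (entry s YG YR) y (entry s' LG LR) (idx s' XP 0) (idx s' YP 0)"
      and XY: "idx s' XP 0 + idx s' YP 0 = n" by (auto simp: Inv_def)
    then have p: "idx s' XP 0 = x" "idx s' YP 0 = y" using xy by (auto simp: merged_def x_def y_def)
    show ?case
      using M[unfolded p] xy 4 unfolding Inv_def merged_def x_def y_def by simp
  qed
qed

text \<open>The list is the union of two sorted subsequences, distinguished by the marks.\<close>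

lemma wp_resort:
  fixes s :: state
  defines "sl \<equiv> gain (num s 2)" and "L \<equiv> entry s LG LR"
  assumes n: "idx s LEN 0 = n"
    and un: "\<And>i j. i < j \<Longrightarrow> j < n \<Longrightarrow> idx s MK i = 0 \<Longrightarrow> idx s MK j = 0 \<Longrightarrow> sl (L i) \<le> sl (L j)"
    and mk: "\<And>i j. i < j \<Longrightarrow> j < n \<Longrightarrow> idx s MK i \<noteq> 0 \<Longrightarrow> idx s MK j \<noteq> 0 \<Longrightarrow> sl (L i) \<le> sl (L j)"
  shows "wp resort (\<lambda>t s'. t \<le> 160 * n + 90 \<and>
      (\<forall>i j. i < j \<longrightarrow> j < n \<longrightarrow> sl (entry s' LG LR i) \<le> sl (entry s' LG LR j)) \<and>
      entry s' LG LR ` {..<n} = L ` {..<n} \<and>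
      (\<forall>i<n. idx s' MK i = 0) \<and>
      idx_kept {LG, LR, MK, XG, XR, YG, YR, XN, YN, XP, YP, CJ} s s' \<and>
      num s' = num s) s"
  unfolding resort_def wp_Seq
proof (rule wp_mono[OF wp_distribute[where n = n]], goal_cases)
  case (4 t s')
  then show ?case
    by (intro wp_mono[OF wp_merge_back[where n = n]]) (use n in \<open>auto simp: sl_def L_def\<close>)
qed (use n un mk in \<open>auto simp: sl_def L_def\<close>)

end

section \<open>Computing and updating the optimal basis and its replacements\<close>

definition greedy_basis :: com where
  "greedy_basis =
     For CI melems (IWrite CAND (ivar CI) (IConst 1)) ;;
     rset WA (RConst 0) ;; rset WB (RConst 0) ;;
     For CI melems
       (pick_lightest ;; IWrite CAND (ivar BEST) (IConst 0) ;; IWrite BAS (ivar BEST) (IConst 1) ;;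
        Query RES (IConst 0) BAS ;;
        If (ILess (IConst 0) (ivar RES))
          (rset WA (RAdd (rvar WA) (RRead 1 (ivar BEST))) ;; rset WB (RAdd (rvar WB) (RRead 2 (ivar BEST))))
          (IWrite BAS (ivar BEST) (IConst 0)))"

definition sorted_entries :: "state \<Rightarrow> nat \<Rightarrow> (nat \<times> nat) set \<Rightarrow> bool" where
  "sorted_entries s n E \<longleftrightarrow>
     idx s LEN 0 = n \<and> entry s LG LR ` {..<n} = E \<and> (\<forall>i<n. idx s MK i = 0) \<and>
     (\<forall>i j. i < j \<longrightarrow> j < n \<longrightarrow> gain (num s 2) (entry s LG LR i) \<le> gain (num s 2) (entry s LG LR j))"

definition append_entry :: com where
  "append_entry =
     IWrite LG (ivar LEN) (ivar GG) ;; IWrite LR (ivar LEN) (ivar RR) ;;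
     IWrite MK (ivar LEN) (IConst 1) ;; incr LEN ;; resort"

definition scan_candidates :: com where
  "scan_candidates = For CJ melems
     (If (ILess (IConst 0) (IRead BAS (ivar CJ)))
        (IWrite CAND (ivar CJ) (IConst 0))
        (IWrite BAS (ivar CI) (IConst 0) ;; IWrite BAS (ivar CJ) (IConst 1) ;;
         Query CAND (ivar CJ) BAS ;;
         IWrite BAS (ivar CJ) (IConst 0) ;; IWrite BAS (ivar CI) (IConst 1)))"

definition build_entries :: com where
  "build_entries = iset LEN (IConst 0) ;;
     For CI melems
       (If (ILess (IConst 0) (IRead BAS (ivar CI)))
          (scan_candidates ;; pick_lightest ;; iset GG (ivar CI) ;; iset RR (ivar BEST) ;; append_entry)
          (iset HH (ivar CI))) ;;
     iset GG (ivar HH) ;; iset RR (ivar HH) ;; append_entry"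

text \<open>An entry with two equal components is the line of the basis itself; it becomes the entry of
  the element \<open>f\<close> that enters the basis.\<close>

definition swap_entries :: com where
  "swap_entries = For CJ (ivar LEN)
     (If (IEq (IRead LG (ivar CJ)) (IRead LR (ivar CJ)))
        (IWrite LG (ivar CJ) (ivar FF) ;; IWrite LR (ivar CJ) (ivar EE) ;; IWrite MK (ivar CJ) (IConst 1))
        (If (IEq (IRead LR (ivar CJ)) (ivar FF))
          (IWrite LR (ivar CJ) (ivar EE) ;; IWrite MK (ivar CJ) (IConst 1)) Skip))"

definition replace_entries :: com where
  "replace_entries = For CJ (ivar LEN)
     (If (BAnd (IEq (IRead LR (ivar CJ)) (ivar EE)) (BNot (IEq (IRead LG (ivar CJ)) (ivar EE))))
        (IWrite BAS (IRead LG (ivar CJ)) (IConst 0) ;; IWrite BAS (ivar FF) (IConst 1) ;;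
         Query RES (IConst 0) BAS ;;
         IWrite BAS (ivar FF) (IConst 0) ;; IWrite BAS (IRead LG (ivar CJ)) (IConst 1) ;;
         If (ILess (IConst 0) (ivar RES))
           (IWrite LR (ivar CJ) (ivar FF) ;; IWrite MK (ivar CJ) (IConst 1)) Skip)
        Skip)"

definition update :: com where
  "update =
     If (ILess (IConst 0) (IRead BAS (ivar EE)))
       (If (ILess (IConst 0) (IRead BAS (ivar FF))) Skip
          (IWrite BAS (ivar EE) (IConst 0) ;; IWrite BAS (ivar FF) (IConst 1) ;;
           Query RES (IConst 0) BAS ;;
           If (ILess (IConst 0) (ivar RES))
             (rset WA (RAdd (RSub (rvar WA) (RRead 1 (ivar EE))) (RRead 1 (ivar FF))) ;;
              rset WB (RAdd (RSub (rvar WB) (RRead 2 (ivar EE))) (RRead 2 (ivar FF))) ;;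
              swap_entries)
             (IWrite BAS (ivar FF) (IConst 0) ;; IWrite BAS (ivar EE) (IConst 1))))
       (If (ILess (IConst 0) (IRead BAS (ivar FF))) Skip replace_entries) ;;
     resort"

locale matroid_machine = oracle_machine m F d + matroid "{..<m}" F
  for m :: nat and F :: "nat set set" and d :: nat
begin

text \<open>The elements are taken by repeated selection instead of sorting, which costs only \<open>O(m\<^sup>2)\<close>. A
  cleared candidate flag means that the element has been considered.\<close>

lemma wp_greedy_basis:
  fixes s :: state
  defines "prec \<equiv> before (num s 1) (num s 2) (num s X0 0)"
  assumes m: "idx s 0 0 = m" and B0: "support (idx s BAS) = {}"
  shows "wp greedy_basis (\<lambda>t s'. t \<le> m * (80 * m + d + 250) + 100 \<and>
      support (idx s' BAS) \<in> F \<and>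
      (\<forall>x<m. x \<in> support (idx s' BAS) \<longleftrightarrow> insert x {y \<in> support (idx s' BAS). prec y x} \<in> F) \<and>
      num s' WA 0 = sum (num s 1) (support (idx s' BAS)) \<and>
      num s' WB 0 = sum (num s 2) (support (idx s' BAS)) \<and>
      idx_kept {CI, CAND, BEST, CJ, BAS, RES} s s' \<and>
      num_kept {WA, WB} s s') s"
proof -
  interpret P: strict_linear prec unfolding prec_def by (rule strict_linear_before)
  define Inv1 where "Inv1 = (\<lambda>i (s' :: state). (\<forall>j<i. idx s' CAND j \<noteq> 0) \<and>
    idx_kept {CI, CAND} s s' \<and> num s' = num s)"
  define Inv2 where "Inv2 = (\<lambda>i (s' :: state). 
    let D = {j. j < m \<and> idx s' CAND j = 0}; B = support (idx s' BAS) in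
      card D = i \<and> (\<forall>x\<in>D. \<forall>y<m. y \<notin> D \<longrightarrow> prec x y) \<and> B \<subseteq> D \<and> B \<in> F \<and>
      (\<forall>x\<in>D. x \<in> B \<longleftrightarrow> insert x {y \<in> B. prec y x} \<in> F) \<and>
      num s' WA 0 = sum (num s 1) B \<and> num s' WB 0 = sum (num s 2) B \<and>
      idx_kept {CI, CAND, BEST, CJ, BAS, RES} s s' \<and>
      num_kept {WA, WB} s s')"
  show ?thesis
    unfolding greedy_basis_def wp_Seq
  proof (rule wp_For[where Inv = Inv1 and n = m and K = 10], goal_cases)
    case (4 t1 s1)
    have t1: "t1 \<le> 24 * m + 14" using 4(3) by simp
    have D0: "{j. j < m \<and> idx s1 CAND j = 0} = {}" and S0: "support (idx s1 BAS) = {}"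
      and fr1: "idx_kept {CI, CAND} s s1" "num s1 = num s"
      and CA: "\<forall>j<m. 0 < idx s1 CAND j"
      using 4(1) B0 by (auto simp: Inv1_def)
    show ?case unfolding wp_RWrite
    proof (rule wp_For[where Inv = Inv2 and n = m and K = "80 * m + 200 + d"], goal_cases)
      case 1
      show ?case using S0 fr1 CA indep_empty by (auto simp: Inv2_def Let_def D0)
    next
      case (2 i s')
      then show ?case using m by (simp add: Inv2_def Let_def)
    next
      case (3 i s')
      define D B where "D = {j. j < m \<and> idx s' CAND j = 0}" and "B = support (idx s' BAS)"
      have I: "card D = i" "\<forall>x\<in>D. \<forall>y<m. y \<notin> D \<longrightarrow> prec x y" "B \<subseteq> D" "B \<in> F"
        "\<forall>x\<in>D. x \<in> B \<longleftrightarrow> insert x {y \<in> B. prec y x} \<in> F"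
        "num s' WA 0 = sum (num s 1) B" "num s' WB 0 = sum (num s 2) B"
        "idx_kept {CI, CAND, BEST, CJ, BAS, RES} s s'"
        "num_kept {WA, WB} s s'"
        using 3(2) unfolding Inv2_def Let_def D_def B_def by - (elim conjE, assumption)+
      have "\<not> {..<m} \<subseteq> D"
      proof
        assume "{..<m} \<subseteq> D"
        then have "D = {..<m}" by (auto simp: D_def)
        then show False using I(1) 3(1) by simp
      qed
      then obtain j0 where j0: "j0 < m" "idx s' CAND j0 \<noteq> 0" by (auto simp: D_def)
      have n1: "num s' 1 = num s 1" "num s' 2 = num s 2" "num s' X0 = num s X0" "idx s' 0 0 = m"
        using I(8,9) m by auto
      show ?case unfolding wp_Seq
      proof (rule wp_mono[OF wp_pick_lightest[OF n1(4) j0]], goal_cases)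
        case (1 t2 s2)
        obtain b where b: "idx s2 BEST 0 = b" by simp
        have bm: "b < m" "b \<notin> D" and bmin: "\<forall>j<m. j \<notin> D \<longrightarrow> j = b \<or> prec b j"
          and t2: "t2 \<le> 80 * m + 60"
          and fr2: "idx_kept {BEST, CJ} s' s2" "num s2 = num s'"
          using 1 n1 by (auto simp: b D_def prec_def)
        have bB: "b \<notin> B" using bm I(3) by auto
        have new: "Inv2 (Suc i) s3"
          if C3: "idx s3 CAND = (idx s' CAND)(b := 0)"
            and B3: "support (idx s3 BAS) = (if insert b B \<in> F then insert b B else B)"
            and W3: "num s3 WA 0 = sum (num s 1) (support (idx s3 BAS))"
              "num s3 WB 0 = sum (num s 2) (support (idx s3 BAS))"
            and fr3: "idx_kept {CI, CAND, BEST, CJ, BAS, RES} s s3"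
              "num_kept {WA, WB} s s3" for s3
        proof -
          define B' where "B' = (if insert b B \<in> F then insert b B else B)"
          have D3: "{j. j < m \<and> idx s3 CAND j = 0} = insert b D" using C3 bm by (auto simp: D_def)
          have "finite D" by (simp add: D_def)
          then have "card (insert b D) = Suc i" using bm I(1) by simp
          moreover have "\<forall>x\<in>insert b D. \<forall>y<m. y \<notin> insert b D \<longrightarrow> prec x y" using I(2) bmin by auto
          moreover have "B' \<subseteq> insert b D" "B' \<in> F" using I(3,4) by (auto simp: B'_def)
          moreover have "x \<in> B' \<longleftrightarrow> insert x {y \<in> B'. prec y x} \<in> F" if x: "x \<in> insert b D" for x
          proof (cases "x = b")
            case True
            have "{y \<in> B'. prec y x} = B" 
              using True I(2,3) bm P.irrefl by (auto simp: B'_def split: if_splits)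
            then show ?thesis using True bB by (auto simp: B'_def)
          next
            case False
            then have xD: "x \<in> D" using x by simp
            then have "prec x b" using I(2) bm by auto
            then have "\<not> prec b x" using P.asym by blast
            then have "{y \<in> B'. prec y x} = {y \<in> B. prec y x}" by (auto simp: B'_def)
            then show ?thesis using I(5) xD False by (auto simp: B'_def)
          qed
          ultimately show ?thesis
            unfolding Inv2_def Let_def D3 B3 B'_def[symmetric] using W3[unfolded B3 B'_def[symmetric]] fr3 by blast
        qed
        have S: "support ((idx s' BAS)(b := Suc 0)) = insert b B" "support ((idx s' BAS)(b := 0)) = B"
          using bm bB by (auto simp: B_def)
        have bs: "idx s2 BAS = idx s' BAS" "idx s2 CAND = idx s' CAND" "idx s2 CI 0 = i" using fr2 3(3) by auto
        have finB: "finite B" by (simp add: B_def)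
        show ?case
        proof (cases "insert b B \<in> F")
          case True
          let ?s = "rupd WB 0 (num s' WB 0 + num s' 2 b) (rupd WA 0 (num s' WA 0 + num s' 1 b)
             (iupd RES 0 1 (iupd BAS b 1 (iupd CAND b 0 s2))))"
          have "Inv2 (Suc i) (iupd CI 0 (Suc i) ?s)"
            by (rule new) (use True S I bs fr2 bB finB n1 in \<open>auto simp: algebra_simps\<close>)
          then show ?thesis using True S bs fr2 t2 by (simp add: b)
        next
          case False
          let ?s = "iupd BAS b 0 (iupd RES 0 0 (iupd BAS b 1 (iupd CAND b 0 s2)))"
          have "Inv2 (Suc i) (iupd CI 0 (Suc i) ?s)"
            by (rule new) (use False S I bs fr2 bB finB n1 in \<open>auto\<close>)
          then show ?thesis using False S bs fr2 t2 by (simp add: b)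
        qed
      qed
    next
      case (4 t s')
      have "{j. j < m \<and> idx s' CAND j = 0} = {..<m}"
        using 4(1) card_seteq[of "{..<m}" "{j. j < m \<and> idx s' CAND j = 0}"] by (auto simp: Inv2_def Let_def)
      then have D: "j < m \<Longrightarrow> idx s' CAND j = 0" for j by auto
      have "t \<le> m * (80 * m + 200 + d + 14) + 14" using 4(3) by (simp add: algebra_simps)
      then have "1 + t1 + (1 + (1 + 1 + 1) + (1 + (1 + 1 + 1) + t)) \<le> m * (80 * m + d + 250) + 100"
        using t1 by (simp add: algebra_simps)
      then show ?case using 4(1) D unfolding Inv2_def Let_def by simp
    qed
  qed (use m in \<open>auto simp: Inv1_def less_Suc_eq\<close>)
qed

lemma wp_append_entry:
  assumes L: "sorted_entries s n E"
  shows "wp append_entry (\<lambda>t s'. t \<le> 160 * n + 300 \<and>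
      sorted_entries s' (Suc n) (insert (idx s GG 0, idx s RR 0) E) \<and>
      idx_kept {LG, LR, MK, XG, XR, YG, YR, XN, YN, XP, YP, CJ, LEN} s s' \<and>
      num s' = num s) s"
proof -
  let ?g = "idx s GG 0" and ?r = "idx s RR 0"
  let ?s = "iupd LEN 0 (Suc n) (iupd MK n (Suc 0) (iupd LR n ?r (iupd LG n ?g s)))"
  have E: "entry ?s LG LR i = (if i = n then (?g, ?r) else entry s LG LR i)" for i by (simp add: entry_def)
  have "wp resort (\<lambda>t s'. t \<le> 160 * Suc n + 90 \<and>
      (\<forall>i j. i < j \<longrightarrow> j < Suc n \<longrightarrow> gain (num ?s 2) (entry s' LG LR i) \<le> gain (num ?s 2) (entry s' LG LR j)) \<and>
      entry s' LG LR ` {..<Suc n} = entry ?s LG LR ` {..<Suc n} \<and>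
      (\<forall>i<Suc n. idx s' MK i = 0) \<and>
      idx_kept {LG, LR, MK, XG, XR, YG, YR, XN, YN, XP, YP, CJ} ?s s' \<and>
      num s' = num ?s) ?s"
    by (rule wp_resort) (use L in \<open>auto simp: E sorted_entries_def less_Suc_eq split: if_splits\<close>)
  moreover have "entry ?s LG LR ` {..<Suc n} = insert (?g, ?r) E"
    using L by (auto simp: E sorted_entries_def lessThan_Suc)
  moreover have n: "idx s LEN 0 = n" using L by (simp add: sorted_entries_def)
  ultimately show ?thesis
    unfolding append_entry_def by (auto simp: sorted_entries_def elim!: wp_mono)
qed

lemma wp_scan_candidates:
  fixes s :: state
  defines "B \<equiv> support (idx s BAS)" and "g \<equiv> idx s CI 0"
  assumes m: "idx s 0 0 = m" and g: "g \<in> B"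
  shows "wp scan_candidates (\<lambda>t s'. t \<le> m * (d + 70) + 20 \<and>
      support (idx s' BAS) = B \<and>
      (\<forall>j<m. idx s' CAND j \<noteq> 0 \<longleftrightarrow> j \<notin> B \<and> insert j (B - {g}) \<in> F) \<and>
      idx_kept {BAS, CAND, CJ} s s' \<and> num s' = num s) s"
proof -
  define Inv where "Inv = (\<lambda>i (s' :: state). support (idx s' BAS) = B \<and>
      (\<forall>j<i. idx s' CAND j \<noteq> 0 \<longleftrightarrow> j \<notin> B \<and> insert j (B - {g}) \<in> F) \<and>
      idx_kept {BAS, CAND, CJ} s s' \<and> num s' = num s)"
  show ?thesis
    unfolding scan_candidates_def
  proof (rule wp_For[where Inv = Inv and n = m and K = "d + 50"], goal_cases)
    case (3 i s')
    have I: "support (idx s' BAS) = B"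
      "\<forall>j<i. idx s' CAND j \<noteq> 0 \<longleftrightarrow> j \<notin> B \<and> insert j (B - {g}) \<in> F"
      "idx_kept {BAS, CAND, CJ} s s'" "num s' = num s"
      using 3(2) unfolding Inv_def by - (elim conjE, assumption)+
    have gm: "g < m" "idx s' CI 0 = g" using g I(3) by (auto simp: B_def g_def support_def)
    have iB: "0 < idx s' BAS i \<longleftrightarrow> i \<in> B" using I(1) 3(1) by (auto simp: support_def)
    show ?case
    proof (cases "i \<in> B")
      case True
      have "Inv (Suc i) (iupd CJ 0 (Suc i) (iupd CAND i 0 s'))"
        using I True by (auto simp: Inv_def less_Suc_eq)
      then show ?thesis using True iB 3(3) by simp
    next
      case False
      then have ig: "i \<noteq> g" using g by auto
      have S: "support ((idx s' BAS)(g := 0, i := Suc 0)) = insert i (B - {g})"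
        using gm 3(1) I(1) by simp
      have S': "support ((idx s' BAS)(g := Suc 0, i := 0)) = B"
        using gm 3(1) I(1) False g by auto
      have "Inv (Suc i) (iupd CJ 0 (Suc i) (iupd BAS g (Suc 0) (iupd BAS i 0
         (iupd CAND i (if insert i (B - {g}) \<in> F then 1 else 0) (iupd BAS i (Suc 0) (iupd BAS g 0 s'))))))"
        using I False S' ig by (auto simp: Inv_def less_Suc_eq fun_upd_twist)
      then show ?thesis using False iB 3(3) gm S by (simp add: fun_upd_twist[OF ig])
    qed
  qed (use m in \<open>auto simp: Inv_def B_def algebra_simps\<close>)
qed

text \<open>A set of entries that describes all lines. An entry \<open>(h, h)\<close> with \<open>h \<notin> B\<close> describes the
  line of the basis, which is the common interdiction value of all elements outside \<open>B\<close>.\<close>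

definition entry_set :: "(nat \<Rightarrow> nat \<Rightarrow> bool) \<Rightarrow> nat set \<Rightarrow> (nat \<times> nat) set \<Rightarrow> bool" where
  "entry_set prec B E \<longleftrightarrow>
     (\<exists>h<m. h \<notin> B \<and> (h, h) \<in> E) \<and> (\<forall>g\<in>B. \<exists>r. (g, r) \<in> E) \<and>
     (\<forall>(g, r)\<in>E. g = r \<and> g < m \<and> g \<notin> B \<or> g \<in> B \<and> is_replacement prec B g r)"

text \<open>The list is built by insertion: an entry is appended as the only marked one and merged in.\<close>

lemma wp_build_entries:
  fixes s :: state
  defines "B \<equiv> support (idx s BAS)" and "prec \<equiv> before (num s 1) (num s 2) (num s X0 0)"
  assumes m: "idx s 0 0 = m"
    and ex: "\<And>g. g \<in> B \<Longrightarrow> \<exists>j. j \<notin> B \<and> insert j (B - {g}) \<in> F"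
    and h: "\<exists>h<m. h \<notin> B"
  shows "wp build_entries (\<lambda>t s'. t \<le> m * (m * (d + 400) + 800) + 600 \<and>
      (\<exists>E. sorted_entries s' (Suc (card B)) E \<and> entry_set prec B E) \<and>
      support (idx s' BAS) = B \<and>
      idx_kept {BAS, CAND, CI, CJ, BEST, GG, RR, HH, LG, LR, MK, XG, XR, YG, YR, XN, YN, XP, YP, LEN} s s' \<and> num s' = num s) s"
proof -
  define Inv where "Inv = (\<lambda>i (s' :: state). support (idx s' BAS) = B \<and>
      (\<exists>E. sorted_entries s' (card (B \<inter> {..<i})) E \<and> (\<forall>(g, r)\<in>E. g \<in> B \<and> is_replacement prec B g r) \<and>
        (\<forall>g\<in>B. g < i \<longrightarrow> (\<exists>r. (g, r) \<in> E))) \<and>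
      ((\<exists>h<i. h \<notin> B) \<longrightarrow> idx s' HH 0 < m \<and> idx s' HH 0 \<notin> B) \<and>
      idx_kept {BAS, CAND, CI, CJ, BEST, GG, RR, HH, LG, LR, MK, XG, XR, YG, YR, XN, YN, XP, YP, LEN} s s' \<and> num s' = num s)"
  have cB: "card (B \<inter> {..<i}) \<le> m" for i
  proof -
    have "card (B \<inter> {..<i}) \<le> card {..<m}" by (intro card_mono) (auto simp: B_def support_def)
    then show ?thesis by simp
  qed
  have BI: "B \<inter> {..<Suc i} = (if i \<in> B then insert i (B \<inter> {..<i}) else B \<inter> {..<i})" for i
    by (auto simp: less_Suc_eq)
  show ?thesis
    unfolding build_entries_def wp_Seq wp_IWrite
  proof (rule wp_For[where Inv = Inv and n = m and K = "m * (d + 320) + 500"], goal_cases)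
    case 1
    show ?case by (auto simp: Inv_def sorted_entries_def B_def)
  next
    case (2 i s')
    then show ?case using m by (simp add: Inv_def)
  next
    case (3 i s')
    obtain E where I: "support (idx s' BAS) = B" "sorted_entries s' (card (B \<inter> {..<i})) E"
      "\<forall>(g, r)\<in>E. g \<in> B \<and> is_replacement prec B g r" "\<forall>g\<in>B. g < i \<longrightarrow> (\<exists>r. (g, r) \<in> E)"
      "(\<exists>h<i. h \<notin> B) \<longrightarrow> idx s' HH 0 < m \<and> idx s' HH 0 \<notin> B"
      "idx_kept {BAS, CAND, CI, CJ, BEST, GG, RR, HH, LG, LR, MK, XG, XR, YG, YR, XN, YN, XP, YP, LEN} s s'" "num s' = num s"
      using 3(2) unfolding Inv_def by blast
    have iB: "0 < idx s' BAS i \<longleftrightarrow> i \<in> B" using I(1) 3(1) by (auto simp: support_def)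
    have mm: "idx s' 0 0 = m" using I(6) m by simp
    show ?case
    proof (cases "i \<in> B")
      case False
      have "Inv (Suc i) (iupd CI 0 (Suc i) (iupd HH 0 i s'))"
        unfolding Inv_def using I False 3(1)
        by (auto simp: BI less_Suc_eq sorted_entries_def entry_def intro!: exI[of _ E])
      then show ?thesis using False iB 3(3) by simp
    next
      case True
      have "wp (scan_candidates ;; pick_lightest ;; iset GG (ivar CI) ;; iset RR (ivar BEST) ;; append_entry)
         (\<lambda>t s'. t \<le> m * (d + 320) + 480 \<and> idx s' CI 0 = i \<and> Inv (Suc i) (iupd CI 0 (Suc i) s')) s'"
        unfolding wp_Seq
      proof (rule wp_mono[OF wp_scan_candidates[of s']], goal_cases)
        case (3 t1 s1)
        have A: "t1 \<le> m * (d + 70) + 20" "support (idx s1 BAS) = B"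
          "\<forall>j<m. idx s1 CAND j \<noteq> 0 \<longleftrightarrow> j \<notin> B \<and> insert j (B - {i}) \<in> F"
          "idx_kept {BAS, CAND, CJ} s' s1" "num s1 = num s'"
          using 3 I(1) \<open>idx s' CI 0 = i\<close> by auto
        obtain j0 where j0: "j0 \<notin> B" "insert j0 (B - {i}) \<in> F" using ex[OF True] by auto
        then have j0m: "j0 < m" using indep_subset_ground by auto
        show ?case
        proof (rule wp_mono[OF wp_pick_lightest[of s1 j0]], goal_cases)
          case (4 t2 s2)
          obtain b where b: "idx s2 BEST 0 = b" by simp
          have C: "t2 \<le> 80 * m + 60" "b < m" "idx s1 CAND b \<noteq> 0"
            "\<forall>j<m. idx s1 CAND j \<noteq> 0 \<longrightarrow> j = b \<or> prec b j"
            "idx_kept {BEST, CJ} s1 s2" "num s2 = num s1"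
            using 4 A(5) I(7) by (auto simp: b prec_def)
          have rep: "is_replacement prec B i b"
            unfolding is_replacement_def
          proof (intro conjI allI impI)
            show "b \<notin> B" "insert b (B - {i}) \<in> F" using A(3) C(2,3) by auto
            fix y assume y: "y \<notin> B" "insert y (B - {i}) \<in> F"
            then have "y < m" using indep_subset_ground by auto
            then show "y = b \<or> prec b y" using A(3) C(4) y by auto
          qed
          let ?s = "iupd RR 0 b (iupd GG 0 i s2)"
          have L: "sorted_entries ?s (card (B \<inter> {..<i})) E"
            using I(2) A(4,5) C(5,6) by (simp add: sorted_entries_def entry_def)
          have "wp append_entry (\<lambda>t s'. t + t1 + t2 + 20 \<le> m * (d + 320) + 480 \<and> idx s' CI 0 = i \<and>
             Inv (Suc i) (iupd CI 0 (Suc i) s')) ?s"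
          proof (rule wp_mono[OF wp_append_entry[OF L]], goal_cases)
            case (1 t3 s3)
            have "t3 \<le> 160 * m + 300" using 1 cB[of i] by (meson add_le_mono1 le_trans mult_le_mono2)
            moreover have "sorted_entries s3 (Suc (card (B \<inter> {..<i}))) (insert (i, b) E)"
              using 1 by simp
            moreover have "card (B \<inter> {..<Suc i}) = Suc (card (B \<inter> {..<i}))"
              using True by (simp add: BI)
            ultimately have L3: "sorted_entries (iupd CI 0 (Suc i) s3) (card (B \<inter> {..<Suc i})) (insert (i, b) E)"
              by (simp add: sorted_entries_def entry_def)
            have fr3: "idx_kept {LG, LR, MK, XG, XR, YG, YR, XN, YN, XP, YP, CJ, LEN} ?s s3"
              "num s3 = num ?s" using 1 by blast+
            have "Inv (Suc i) (iupd CI 0 (Suc i) s3)"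
              unfolding Inv_def
            proof (intro conjI exI[of _ "insert (i, b) E"])
              show "support (idx (iupd CI 0 (Suc i) s3) BAS) = B" using fr3 C(5) A(2) by simp
              show "\<forall>(g, r)\<in>insert (i, b) E. g \<in> B \<and> is_replacement prec B g r" using I(3) True rep by auto
              show "\<forall>g\<in>B. g < Suc i \<longrightarrow> (\<exists>r. (g, r) \<in> insert (i, b) E)" using I(4) by (auto simp: less_Suc_eq)
              have "idx s3 HH = idx s' HH" using fr3 C(5) A(4) by simp
              then show "(\<exists>h<Suc i. h \<notin> B) \<longrightarrow> idx (iupd CI 0 (Suc i) s3) HH 0 < m \<and> idx (iupd CI 0 (Suc i) s3) HH 0 \<notin> B"
                using I(5) True by (auto simp: less_Suc_eq)
              show "\<forall>r. r \<notin> {BAS, CAND, CI, CJ, BEST, GG, RR, HH, LG, LR, MK, XG, XR, YG, YR, XN, YN, XP, YP, LEN} \<longrightarrow>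
                idx (iupd CI 0 (Suc i) s3) r = idx s r" using fr3(1) C(5) A(4) I(6) by simp
              show "num (iupd CI 0 (Suc i) s3) = num s" using fr3(2) C(6) A(5) I(7) by simp
            qed (rule L3)
            moreover have "t3 + t1 + t2 + 20 \<le> m * (d + 320) + 480"
              using \<open>t3 \<le> _\<close> A(1) C(1) by (simp add: algebra_simps)
            moreover have "idx s3 CI 0 = i" using fr3 C(5) A(4) \<open>idx s' CI 0 = i\<close> by simp
            ultimately show ?case by blast
          qed
          moreover have "idx s2 CI 0 = i" using C(5) A(4) \<open>idx s' CI 0 = i\<close> by simp
          ultimately show ?case by (auto simp: b elim!: wp_mono)
        qed (use A mm j0 j0m in auto)
      qed (use mm I(1) True 3(3) in auto)
      then show ?thesis using True iB 3(3) by (auto elim!: wp_mono)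
    qed
  next
    case (4 t1 s1)
    obtain E where I: "support (idx s1 BAS) = B" "sorted_entries s1 (card (B \<inter> {..<m})) E"
      "\<forall>(g, r)\<in>E. g \<in> B \<and> is_replacement prec B g r" "\<forall>g\<in>B. g < m \<longrightarrow> (\<exists>r. (g, r) \<in> E)"
      "(\<exists>h<m. h \<notin> B) \<longrightarrow> idx s1 HH 0 < m \<and> idx s1 HH 0 \<notin> B"
      "idx_kept {BAS, CAND, CI, CJ, BEST, GG, RR, HH, LG, LR, MK, XG, XR, YG, YR, XN, YN, XP, YP, LEN} s s1" "num s1 = num s"
      using 4(1) unfolding Inv_def by blast
    have BB: "B \<inter> {..<m} = B" by (auto simp: B_def support_def)
    obtain h where hh: "idx s1 HH 0 = h" by simp
    let ?s = "iupd RR 0 h (iupd GG 0 h s1)"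
    have L: "sorted_entries ?s (card B) E"
      using I(2) BB by (simp add: sorted_entries_def entry_def)
    have t1: "t1 \<le> m * (m * (d + 320) + 514) + 14" using 4(3) by (simp add: algebra_simps)
    have "wp append_entry (\<lambda>t s'. t + t1 + 20 \<le> m * (m * (d + 400) + 800) + 600 \<and> 
      (\<exists>E. sorted_entries s' (Suc (card B)) E \<and> entry_set prec B E) \<and>
      support (idx s' BAS) = B \<and>
      idx_kept {BAS, CAND, CI, CJ, BEST, GG, RR, HH, LG, LR, MK, XG, XR, YG, YR, XN, YN, XP, YP, LEN} s s' \<and> num s' = num s) ?s"
    proof (rule wp_mono[OF wp_append_entry[OF L]], goal_cases)
      case (1 t s')
      have "card B \<le> m" using cB[of m] BB by simp
      then have "t + t1 + 20 \<le> m * (m * (d + 400) + 800) + 600" using 1 t1 by (simp add: algebra_simps)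
      moreover have "entry_set prec B (insert (h, h) E)"
        using I(3,4,5) assms(5) hh unfolding entry_set_def by (auto dest: support_less simp: B_def)
      ultimately show ?case using 1 I(1,6,7) by (auto intro!: exI[of _ "insert (h, h) E"])
    qed
    then show ?case by (auto simp: hh elim!: wp_mono)
  qed
qed

lemma wp_swap_entries:
  fixes s :: state
  defines "f \<equiv> idx s FF 0" and "e \<equiv> idx s EE 0"
  assumes n: "idx s LEN 0 = n"
  shows "wp swap_entries (\<lambda>t s'. t \<le> 80 * n + 40 \<and>
      (\<forall>i<n. entry s' LG LR i = (case entry s LG LR i of (g, r) \<Rightarrow>
         if g = r then (f, e) else if r = f then (g, e) else (g, r))) \<and>
      (\<forall>i<n. idx s' MK i = (case entry s LG LR i of (g, r) \<Rightarrow> if g = r \<or> r = f then 1 else idx s MK i)) \<and>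
      idx_kept {LG, LR, MK, CJ} s s' \<and> num s' = num s) s"
proof -
  define Inv where "Inv = (\<lambda>i (s' :: state).
      (\<forall>j. entry s' LG LR j = (if j < i then (case entry s LG LR j of (g, r) \<Rightarrow>
         if g = r then (f, e) else if r = f then (g, e) else (g, r)) else entry s LG LR j)) \<and>
      (\<forall>j. idx s' MK j = (if j < i then (case entry s LG LR j of (g, r) \<Rightarrow>
         if g = r \<or> r = f then 1 else idx s MK j) else idx s MK j)) \<and>
      idx_kept {LG, LR, MK, CJ} s s' \<and> num s' = num s)"
  show ?thesis
    unfolding swap_entries_def
  proof (rule wp_For[where Inv = Inv and n = n and K = 60], goal_cases)
    case (3 i s')
    have I: "\<forall>j. entry s' LG LR j = (if j < i then (case entry s LG LR j of (g, r) \<Rightarrow>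
         if g = r then (f, e) else if r = f then (g, e) else (g, r)) else entry s LG LR j)"
      "\<forall>j. idx s' MK j = (if j < i then (case entry s LG LR j of (g, r) \<Rightarrow>
         if g = r \<or> r = f then 1 else idx s MK j) else idx s MK j)"
      "idx_kept {LG, LR, MK, CJ} s s'" "num s' = num s"
      using 3(2) unfolding Inv_def by - (elim conjE, assumption)+
    obtain g r where gr: "entry s LG LR i = (g, r)" by (cases "entry s LG LR i")
    then have gr': "idx s' LG i = g" "idx s' LR i = r" using I(1)[rule_format, of i] by (auto simp: entry_def)
    have ef: "idx s' EE 0 = e" "idx s' FF 0 = f" using I(3) by (auto simp: e_def f_def)
    consider "g = r" | "g \<noteq> r" "r = f" | "g \<noteq> r" "r \<noteq> f" by blast
    then show ?case
    proof cases
      case 1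
      have "Inv (Suc i) (iupd CJ 0 (Suc i) (iupd MK i (Suc 0) (iupd LR i e (iupd LG i f s'))))"
        unfolding Inv_def using I 1 gr by (auto simp: less_Suc_eq)
      then show ?thesis using 1 gr' ef 3(3) by simp
    next
      case 2
      have "Inv (Suc i) (iupd CJ 0 (Suc i) (iupd MK i (Suc 0) (iupd LR i e s')))"
        unfolding Inv_def using I 2 gr by (auto simp: less_Suc_eq)
      moreover have "g < f \<or> f < g" using 2 by auto
      ultimately show ?thesis using 2 gr' ef 3(3) by auto
    next
      case 3
      have "Inv (Suc i) (iupd CJ 0 (Suc i) s')"
        unfolding Inv_def using I 3 gr by (auto simp: less_Suc_eq)
      then show ?thesis using 3 gr' ef \<open>idx s' CJ 0 = i\<close> by auto
    qed
  qed (use n in \<open>auto simp: Inv_def\<close>)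
qed

lemma wp_replace_entries:
  fixes s :: state
  defines "f \<equiv> idx s FF 0" and "e \<equiv> idx s EE 0" and "B \<equiv> support (idx s BAS)"
  assumes n: "idx s LEN 0 = n" and f: "f < m" "f \<notin> B"
    and G: "\<And>i. i < n \<Longrightarrow> idx s LG i \<noteq> e \<Longrightarrow> idx s LR i = e \<Longrightarrow> idx s LG i \<in> B"
  shows "wp replace_entries (\<lambda>t s'. t \<le> n * (d + 100) + 40 \<and>
      (\<forall>i<n. entry s' LG LR i = (case entry s LG LR i of (g, r) \<Rightarrow>
         if r = e \<and> g \<noteq> e \<and> insert f (B - {g}) \<in> F then (g, f) else (g, r))) \<and>
      (\<forall>i<n. idx s' MK i = (case entry s LG LR i of (g, r) \<Rightarrow>
         if r = e \<and> g \<noteq> e \<and> insert f (B - {g}) \<in> F then 1 else idx s MK i)) \<and>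
      support (idx s' BAS) = B \<and>
      idx_kept {LR, MK, CJ, BAS, RES} s s' \<and> num s' = num s) s"
proof -
  define Inv where "Inv = (\<lambda>i (s' :: state).
      (\<forall>j. entry s' LG LR j = (if j < i then (case entry s LG LR j of (g, r) \<Rightarrow>
         if r = e \<and> g \<noteq> e \<and> insert f (B - {g}) \<in> F then (g, f) else (g, r)) else entry s LG LR j)) \<and>
      (\<forall>j. idx s' MK j = (if j < i then (case entry s LG LR j of (g, r) \<Rightarrow>
         if r = e \<and> g \<noteq> e \<and> insert f (B - {g}) \<in> F then 1 else idx s MK j) else idx s MK j)) \<and>
      support (idx s' BAS) = B \<and>
      idx_kept {LR, MK, CJ, BAS, RES} s s' \<and> num s' = num s)"
  show ?thesis
    unfolding replace_entries_def
  proof (rule wp_For[where Inv = Inv and n = n and K = "d + 80"], goal_cases)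
    case (3 i s')
    have I: "\<forall>j. entry s' LG LR j = (if j < i then (case entry s LG LR j of (g, r) \<Rightarrow>
         if r = e \<and> g \<noteq> e \<and> insert f (B - {g}) \<in> F then (g, f) else (g, r)) else entry s LG LR j)"
      "\<forall>j. idx s' MK j = (if j < i then (case entry s LG LR j of (g, r) \<Rightarrow>
         if r = e \<and> g \<noteq> e \<and> insert f (B - {g}) \<in> F then 1 else idx s MK j) else idx s MK j)"
      "support (idx s' BAS) = B"
      "idx_kept {LR, MK, CJ, BAS, RES} s s'" "num s' = num s"
      using 3(2) unfolding Inv_def by - (elim conjE, assumption)+
    obtain g r where gr: "entry s LG LR i = (g, r)" by (cases "entry s LG LR i")
    then have gr': "idx s' LG i = g" "idx s' LR i = r" using I(1)[rule_format, of i] by (auto simp: entry_def)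
    have ef: "idx s' EE 0 = e" "idx s' FF 0 = f" using I(4) by (auto simp: e_def f_def)
    show ?case
    proof (cases "r = e \<and> g \<noteq> e")
      case True
      then have g: "g \<in> B" "g < m" "f \<noteq> g"
        using G[OF 3(1)] gr f support_less by (auto simp: entry_def B_def)
      have S: "support ((idx s' BAS)(g := 0, f := Suc 0)) = insert f (B - {g})"
        using g f I(3) by simp
      have S': "support ((idx s' BAS)(g := 0, f := 0, g := Suc 0)) = B"
        "support ((idx s' BAS)(f := 0, g := Suc 0)) = B"
        using g f I(3) by auto
      show ?thesis
      proof (cases "insert f (B - {g}) \<in> F")
        case ins: True
        have "Inv (Suc i) (iupd CJ 0 (Suc i) (iupd MK i (Suc 0) (iupd LR i f (iupd BAS g (Suc 0)
          (iupd BAS f 0 (iupd RES 0 (Suc 0) (iupd BAS f (Suc 0) (iupd BAS g 0 s'))))))))"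
          unfolding Inv_def using I True gr ins S' by (auto simp: less_Suc_eq)
        moreover have "g < e \<or> e < g" using True by auto
        ultimately show ?thesis using True gr' ef 3(3) S ins by auto
      next
        case ins: False
        have "Inv (Suc i) (iupd CJ 0 (Suc i) (iupd BAS g (Suc 0)
          (iupd BAS f 0 (iupd RES 0 0 (iupd BAS f (Suc 0) (iupd BAS g 0 s'))))))"
          unfolding Inv_def using I True gr ins S' by (auto simp: less_Suc_eq)
        moreover have "g < e \<or> e < g" using True by auto
        ultimately show ?thesis using True gr' ef 3(3) S ins by auto
      qed
    next
      case False
      have "Inv (Suc i) (iupd CJ 0 (Suc i) s')"
        unfolding Inv_def using I False gr by (auto simp: less_Suc_eq)
      then show ?thesis using False gr' ef 3(3) by auto
    qed
  qed (use n in \<open>auto simp: Inv_def B_def algebra_simps\<close>)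
qed

text \<open>What the sweep maintains about the basis while the order is \<open>prec\<close>.\<close>

definition optimal_state :: "(nat \<Rightarrow> nat \<Rightarrow> bool) \<Rightarrow> state \<Rightarrow> nat \<Rightarrow> bool" where
  "optimal_state prec s n \<longleftrightarrow>
     exchange_optimal prec (support (idx s BAS)) \<and>
     (\<exists>E. sorted_entries s n E \<and> entry_set prec (support (idx s BAS)) E) \<and>
     num s WA 0 = sum (num s 1) (support (idx s BAS)) \<and>
     num s WB 0 = sum (num s 2) (support (idx s BAS))"

lemma entry_setD:
  assumes "entry_set prec B E"
  shows "\<exists>h<m. h \<notin> B \<and> (h, h) \<in> E" "g \<in> B \<Longrightarrow> \<exists>r. (g, r) \<in> E"
    "(g, r) \<in> E \<Longrightarrow> g = r \<and> g < m \<and> g \<notin> B \<or> g \<in> B \<and> is_replacement prec B g r"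
proof -
  note E = assms[unfolded entry_set_def]
  from E show "\<exists>h<m. h \<notin> B \<and> (h, h) \<in> E" by (elim conjE)
  from E show "g \<in> B \<Longrightarrow> \<exists>r. (g, r) \<in> E" by (elim conjE) (erule bspec)
  show "g = r \<and> g < m \<and> g \<notin> B \<or> g \<in> B \<and> is_replacement prec B g r" if "(g, r) \<in> E"
    using bspec[OF conjunct2[OF conjunct2[OF E]] that] by simp
qed

lemma entry_set_swap:
  assumes "strict_linear prec" "strict_linear prec'" "transposed prec prec' e f"
    and "exchange_optimal prec B" "e \<in> B" "f \<notin> B" "insert f (B - {e}) \<in> F"
    and E: "entry_set prec B E"
  shows "entry_set prec' (insert f (B - {e}))
    ((\<lambda>(g, r). if g = r then (f, e) else if r = f then (g, e) else (g, r)) ` E)" (is "entry_set _ ?B (?u ` E)")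
proof -
  note tr = assms(1-4)
  have em: "e < m" "f < m" "e \<noteq> f" using transposed_pair[OF tr] by auto
  obtain h where h: "h < m" "h \<notin> B" "(h, h) \<in> E" using entry_setD(1)[OF E] by blast
  have rep: "g = r \<and> g < m \<and> g \<notin> B \<or> g \<in> B \<and> r \<notin> B \<and> is_replacement prec B g r" if "(g, r) \<in> E" for g r
    using entry_setD(3)[OF E that] by (auto simp: is_replacement_def)
  have up: "(g, r) \<in> E \<Longrightarrow> ?u (g, r) \<in> ?u ` E" for g r by (rule imageI)
  have "(e, f) \<in> E"
  proof -
    obtain r where r: "(e, r) \<in> E" using entry_setD(2)[OF E assms(5)] ..
    then show ?thesis using rep[OF r] transposed_swap_leaving[OF tr assms(5-7), of r] assms(5) by auto
  qed
  then have 1: "(e, e) \<in> ?u ` E" using up[of e f] em by simp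
  have 2: "\<exists>r. (g, r) \<in> ?u ` E" if g: "g \<in> ?B" for g
  proof (cases "g = f")
    case True
    have "(f, e) \<in> ?u ` E" using up[OF h(3)] by simp
    then show ?thesis using True by blast
  next
    case False
    then have gB: "g \<in> B" using g by auto
    then obtain r where r: "(g, r) \<in> E" using entry_setD(2)[OF E] by blast
    then have "g \<noteq> r" using rep[OF r] gB by auto
    then have "?u (g, r) = (g, if r = f then e else r)" by simp
    then show ?thesis using up[OF r] by metis
  qed
  have 3: "g' = r' \<and> g' < m \<and> g' \<notin> ?B \<or> g' \<in> ?B \<and> is_replacement prec' ?B g' r'"
    if "(g', r') = ?u (g, r)" "(g, r) \<in> E" for g r g' r'
  proof (cases "g = r")
    case True
    then show ?thesis using that(1) transposed_swap_entering[OF tr assms(5-7)] by auto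
  next
    case False
    then have g: "g \<in> B" "is_replacement prec B g r" using rep[OF that(2)] by auto
    show ?thesis
    proof (cases "g = e")
      case True
      then have "r = f" using transposed_swap_leaving[OF tr assms(5-7)] g by auto
      then show ?thesis using that(1) True False em by auto
    next
      case ge: False
      have "is_replacement prec' ?B g (if r = f then e else r)"
        by (rule transposed_swap_replacement[OF tr assms(5-7) g(1) ge g(2)])
      then show ?thesis using that(1) False g ge by (auto split: if_splits)
    qed
  qed
  show ?thesis
    unfolding entry_set_def
  proof (intro conjI ballI)
    show "\<exists>h<m. h \<notin> ?B \<and> (h, h) \<in> ?u ` E" using 1 em by blast
    fix x assume "x \<in> ?u ` E"
    then obtain p where p: "p \<in> E" "x = ?u p" by blast
    obtain g r g' r' where "p = (g, r)" "x = (g', r')" by (cases p, cases x)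
    then show "case x of (g, r) \<Rightarrow> g = r \<and> g < m \<and> g \<notin> ?B \<or> g \<in> ?B \<and> is_replacement prec' ?B g r"
      using 3[of g' r' g r] p by simp
  qed (rule 2)
qed

lemma entry_set_replace:
  assumes "strict_linear prec" "strict_linear prec'" "transposed prec prec' e f"
    and "exchange_optimal prec B" "f \<notin> B" "e \<notin> B"
    and E: "entry_set prec B E"
  shows "entry_set prec' B ((\<lambda>(g, r). if r = e \<and> g \<noteq> e \<and> insert f (B - {g}) \<in> F then (g, f) else (g, r)) ` E)"
    (is "entry_set _ _ (?u ` E)")
proof -
  note tr = assms(1-4)
  obtain h where h: "h < m" "h \<notin> B" "(h, h) \<in> E" using entry_setD(1)[OF E] by blast
  have rep: "g = r \<and> g < m \<and> g \<notin> B \<or> g \<in> B \<and> is_replacement prec B g r" if "(g, r) \<in> E" for g r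
    by (rule entry_setD(3)[OF E that])
  have up: "(g, r) \<in> E \<Longrightarrow> ?u (g, r) \<in> ?u ` E" for g r by (rule imageI)
  have "?u (h, h) = (h, h)" by simp
  then have 1: "(h, h) \<in> ?u ` E" using up[OF h(3)] by argo
  have 2: "\<exists>r. (g, r) \<in> ?u ` E" if "g \<in> B" for g
  proof -
    obtain r where "(g, r) \<in> E" using entry_setD(2)[OF E \<open>g \<in> B\<close>] ..
    then have "?u (g, r) \<in> ?u ` E" by (rule up)
    moreover have "?u (g, r) = (g, if r = e \<and> g \<noteq> e \<and> insert f (B - {g}) \<in> F then f else r)" by simp
    ultimately show ?thesis by metis
  qed
  have 3: "g' = r' \<and> g' < m \<and> g' \<notin> B \<or> g' \<in> B \<and> is_replacement prec' B g' r'"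
    if "(g', r') = ?u (g, r)" "(g, r) \<in> E" for g r g' r'
    using rep[OF that(2)]
  proof (elim disjE conjE)
    assume g: "g \<in> B" "is_replacement prec B g r"
    then have "g \<noteq> e" using assms by auto
    then have "(g', r') = (g, if r = e \<and> f \<notin> B \<and> insert f (B - {g}) \<in> F then f else r)"
      using that(1) assms(5) by auto
    then show ?thesis using transposed_keep_replacement[OF tr g] g by auto
  qed (use that(1) in \<open>auto split: if_splits\<close>)
  show ?thesis
    unfolding entry_set_def
  proof (intro conjI ballI)
    show "\<exists>h<m. h \<notin> B \<and> (h, h) \<in> ?u ` E" using 1 h by blast
    fix x assume "x \<in> ?u ` E"
    then obtain p where p: "p \<in> E" "x = ?u p" by blast
    obtain g r g' r' where "p = (g, r)" "x = (g', r')" by (cases p, cases x)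
    then show "case x of (g, r) \<Rightarrow> g = r \<and> g < m \<and> g \<notin> B \<or> g \<in> B \<and> is_replacement prec' B g r"
      using 3[of g' r' g r] p by simp
  qed (rule 2)
qed

lemma entry_set_keep:
  assumes "strict_linear prec" "strict_linear prec'" "transposed prec prec' e f"
    and "exchange_optimal prec B" "e \<in> B \<or> f \<in> B" "\<not> (e \<in> B \<and> f \<notin> B \<and> insert f (B - {e}) \<in> F)"
    and E: "entry_set prec B E"
  shows "entry_set prec' B E"
proof -
  have "is_replacement prec' B g r" if "g \<in> B" "is_replacement prec B g r" for g r
    using transposed_keep_replacement[OF assms(1-4) that] that assms(5)
    by (auto simp: is_replacement_def split: if_splits)
  then show ?thesis using E unfolding entry_set_def
    by (elim conjE) (intro conjI ballI, assumption, erule bspec, assumption, drule bspec, assumption,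
      auto split: prod.splits)
qed

text \<open>In each of the two cases in which entries change, all slopes that change do so by the
  same amount \<open>\<delta>\<close>: by \<open>\<beta> e - \<beta> f\<close> when \<open>e\<close> and \<open>f\<close> are exchanged in the basis, and by
  \<open>\<beta> f - \<beta> e\<close> when \<open>f\<close> becomes a replacement instead of \<open>e\<close>. So marking the changed entries makes
  \<open>resort\<close> applicable.\<close>

lemma wp_update:
  fixes s :: state
  defines "e \<equiv> idx s EE 0" and "f \<equiv> idx s FF 0"
  assumes lin: "strict_linear prec" and lin': "strict_linear prec'" and tr: "transposed prec prec' e f"
    and opt: "optimal_state prec s n"
  shows "wp update (\<lambda>t s'. t \<le> n * (d + 300) + d + 400 \<and> optimal_state prec' s' n \<and>
      idx_kept {BAS, RES, LG, LR, MK, XG, XR, YG, YR, XN, YN, XP, YP, CJ} s s' \<and>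
      num_kept {WA, WB} s s') s"
proof -
  define B where "B = support (idx s BAS)"
  from opt obtain E where xo: "exchange_optimal prec B" and L: "sorted_entries s n E" and E: "entry_set prec B E"
    and W: "num s WA 0 = sum (num s 1) B" "num s WB 0 = sum (num s 2) B"
    by (auto simp: optimal_state_def B_def)
  note tr4 = lin lin' tr xo
  have em: "e < m" "f < m" "e \<noteq> f" using transposed_pair[OF tr4] by auto
  have eB: "0 < idx s BAS e \<longleftrightarrow> e \<in> B" "0 < idx s BAS f \<longleftrightarrow> f \<in> B"
    using em by (auto simp: B_def support_def)
  have n: "idx s LEN 0 = n" "\<And>i. i < n \<Longrightarrow> idx s MK i = 0" "entry s LG LR ` {..<n} = E"
    and so: "\<And>i j. i < j \<Longrightarrow> j < n \<Longrightarrow> gain (num s 2) (entry s LG LR i) \<le> gain (num s 2) (entry s LG LR j)"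
    using L by (auto simp: sorted_entries_def)
  have resorted: "wp resort (\<lambda>t s'. t \<le> 160 * n + 90 \<and> optimal_state prec' s' n \<and>
      idx_kept {LG, LR, MK, XG, XR, YG, YR, XN, YN, XP, YP, CJ} s1 s' \<and> num s' = num s1) s1"
    if n1: "idx s1 LEN 0 = n" "num s1 1 = num s 1" "num s1 2 = num s 2"
      and u1: "\<And>i. i < n \<Longrightarrow> entry s1 LG LR i = u (entry s LG LR i)"
      and sl0: "\<And>i. i < n \<Longrightarrow> idx s1 MK i = 0 \<Longrightarrow>
         gain (num s 2) (u (entry s LG LR i)) = gain (num s 2) (entry s LG LR i)"
      and sl1: "\<And>i. i < n \<Longrightarrow> idx s1 MK i \<noteq> 0 \<Longrightarrow>
         gain (num s 2) (u (entry s LG LR i)) = gain (num s 2) (entry s LG LR i) + \<delta>"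
      and xo1: "exchange_optimal prec' (support (idx s1 BAS))"
      and E1: "entry_set prec' (support (idx s1 BAS)) (u ` E)"
      and W1: "num s1 WA 0 = sum (num s 1) (support (idx s1 BAS))" "num s1 WB 0 = sum (num s 2) (support (idx s1 BAS))"
    for s1 u \<delta>
  proof (rule wp_mono[OF wp_resort[OF n1(1)]], goal_cases)
    case (1 i j)
    then show ?case using sl0[of i] sl0[of j] so[of i j] u1[of i] u1[of j] n1 by simp
  next
    case (2 i j)
    then show ?case using sl1[of i] sl1[of j] so[of i j] u1[of i] u1[of j] n1 by simp
  next
    case (3 t s')
    have "entry s1 LG LR ` {..<n} = u ` E" using u1 unfolding n(3)[symmetric] image_image by (intro image_cong) auto
    then have "sorted_entries s' n (u ` E)" using 3 n1 by (auto simp: sorted_entries_def)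
    moreover have "idx s' BAS = idx s1 BAS" using 3 by simp
    ultimately show ?case using 3 xo1 E1 W1 n1 by (auto simp: optimal_state_def)
  qed
  show ?thesis
  proof (cases "e \<in> B \<and> f \<notin> B \<and> insert f (B - {e}) \<in> F")
    case True
    let ?B = "insert f (B - {e})"
    let ?u = "\<lambda>(g, r). if g = r then (f, e) else if r = f then (g, e) else (g, r)"
    have S: "support ((idx s BAS)(e := 0, f := Suc 0)) = ?B" using em by (simp add: B_def)
    have sumB: "sum w ?B = sum w B - w e + w f" for w :: "nat \<Rightarrow> real"
      using True em by (simp add: B_def sum_diff1)
    let ?s = "rupd WB 0 (num s WB 0 - num s 2 e + num s 2 f) (rupd WA 0 (num s WA 0 - num s 1 e + num s 1 f)
      (iupd RES 0 (Suc 0) (iupd BAS f (Suc 0) (iupd BAS e 0 s))))"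
    have es: "entry ?s LG LR = entry s LG LR" by (simp add: entry_def fun_eq_iff)
    have "wp swap_entries (\<lambda>t s'. wp resort (\<lambda>t' s''. t + t' + d + 150 \<le> n * (d + 300) + d + 400 \<and>
        optimal_state prec' s'' n \<and>
        idx_kept {BAS, RES, LG, LR, MK, XG, XR, YG, YR, XN, YN, XP, YP, CJ} s s'' \<and>
        num_kept {WA, WB} s s'') s') ?s"
    proof (rule wp_mono[OF wp_swap_entries[where n = n]], goal_cases)
      case (2 t s1)
      have fe: "idx ?s FF 0 = f" "idx ?s EE 0 = e" by (auto simp: f_def e_def)
      have u: "entry s1 LG LR i = ?u (entry s LG LR i)" if "i < n" for i
        using 2 that unfolding es fe by simp
      have mk: "idx s1 MK i = (case entry s LG LR i of (g, r) \<Rightarrow> if g = r \<or> r = f then 1 else 0)" if "i < n" for i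
        using 2 that n(2)[OF that] unfolding es fe by (simp split: prod.splits)
      have fr: "idx_kept {LG, LR, MK, CJ} ?s s1" "num s1 = num ?s"
        and t: "t \<le> 80 * n + 40" using 2 by blast+
      have B1: "support (idx s1 BAS) = ?B" using fr S by simp
      have "wp resort (\<lambda>t s'. t \<le> 160 * n + 90 \<and> optimal_state prec' s' n \<and>
        idx_kept {LG, LR, MK, XG, XR, YG, YR, XN, YN, XP, YP, CJ} s1 s' \<and> num s' = num s1) s1"
      proof (rule resorted[where u = ?u and \<delta> = "num s 2 e - num s 2 f"])
        show "entry_set prec' (support (idx s1 BAS)) (?u ` E)"
          unfolding B1 using entry_set_swap[OF tr4] True E by blast
        show "exchange_optimal prec' (support (idx s1 BAS))"
          unfolding B1 using transposed_swap_basis[OF tr4] True by blast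
        show "num s1 WA 0 = sum (num s 1) (support (idx s1 BAS))" "num s1 WB 0 = sum (num s 2) (support (idx s1 BAS))"
          unfolding B1 sumB using fr W by simp_all
      next
        fix i assume "i < n" "idx s1 MK i = 0"
        then show "gain (num s 2) (?u (entry s LG LR i)) = gain (num s 2) (entry s LG LR i)"
          using mk[of i] by (auto split: prod.splits if_splits)
      next
        fix i assume "i < n" "idx s1 MK i \<noteq> 0"
        then show "gain (num s 2) (?u (entry s LG LR i)) = gain (num s 2) (entry s LG LR i) + (num s 2 e - num s 2 f)"
          using mk[of i] by (auto simp: gain_def split: prod.splits if_splits)
      qed (use u fr n in auto)
      then show ?case
      proof (rule wp_mono, goal_cases)
        case (1 t' s'')
        then show ?case using t fr by (simp add: algebra_simps)
      qed
    qed (use n in auto)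
    then show ?thesis
      using True eB S unfolding update_def
      by (auto simp: e_def[symmetric] f_def[symmetric] elim!: wp_mono)
  next
    case no_swap: False
    have xo': "exchange_optimal prec' B" by (rule transposed_keep_basis[OF tr4 no_swap])
    show ?thesis
    proof (cases "e \<in> B \<or> f \<in> B")
      case True
      have E': "entry_set prec' B E" by (rule entry_set_keep[OF tr4 True no_swap E])
      have res: "wp resort (\<lambda>t' s''. t' + d + 150 \<le> n * (d + 300) + d + 400 \<and>
        optimal_state prec' s'' n \<and>
        idx_kept {BAS, RES, LG, LR, MK, XG, XR, YG, YR, XN, YN, XP, YP, CJ} s s'' \<and>
        num_kept {WA, WB} s s'') s1"
        if "support (idx s1 BAS) = B" "idx_kept {BAS, RES} s s1" "num s1 = num s" for s1
      proof -
        have "wp resort (\<lambda>t s'. t \<le> 160 * n + 90 \<and> optimal_state prec' s' n \<and>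
          idx_kept {LG, LR, MK, XG, XR, YG, YR, XN, YN, XP, YP, CJ} s1 s' \<and> num s' = num s1) s1"
          by (rule resorted[where u = id and \<delta> = 0]) (use that n xo' E' W in \<open>auto simp: entry_def\<close>)
        then show ?thesis
        proof (rule wp_mono, goal_cases)
          case (1 t' s'')
          then show ?case using that by (simp add: algebra_simps)
        qed
      qed
      show ?thesis
      proof (cases "e \<in> B \<and> f \<notin> B")
        case ef: True
        have S: "support ((idx s BAS)(e := 0, f := Suc 0)) = insert f (B - {e})" using em by (simp add: B_def)
        have S': "support ((idx s BAS)(e := Suc 0, f := 0)) = B" using em ef by (auto simp: B_def)
        have "wp resort (\<lambda>t' s''. t' + d + 150 \<le> n * (d + 300) + d + 400 \<and>
          optimal_state prec' s'' n \<and>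
          idx_kept {BAS, RES, LG, LR, MK, XG, XR, YG, YR, XN, YN, XP, YP, CJ} s s'' \<and>
          num_kept {WA, WB} s s'')
          (iupd BAS e (Suc 0) (iupd BAS f 0 (iupd RES 0 0 (iupd BAS f (Suc 0) (iupd BAS e 0 s)))))"
          by (rule res) (use S' em in \<open>auto simp: fun_upd_twist\<close>)
        then show ?thesis
          using ef no_swap eB S unfolding update_def
          by (auto simp: e_def[symmetric] f_def[symmetric] elim!: wp_mono)
      next
        case ef: False
        have "wp resort (\<lambda>t' s''. t' + d + 150 \<le> n * (d + 300) + d + 400 \<and>
          optimal_state prec' s'' n \<and>
          idx_kept {BAS, RES, LG, LR, MK, XG, XR, YG, YR, XN, YN, XP, YP, CJ} s s'' \<and>
          num_kept {WA, WB} s s'') s"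
          by (rule res) (auto simp: B_def)
        then show ?thesis
          using ef True eB unfolding update_def
          by (auto simp: e_def[symmetric] f_def[symmetric] elim!: wp_mono)
      qed
    next
      case False
      let ?u = "\<lambda>(g, r). if r = e \<and> g \<noteq> e \<and> insert f (B - {g}) \<in> F then (g, f) else (g, r)"
      have "wp replace_entries (\<lambda>t s'. wp resort (\<lambda>t' s''. t + t' + d + 150 \<le> n * (d + 300) + d + 400 \<and>
        optimal_state prec' s'' n \<and>
        idx_kept {BAS, RES, LG, LR, MK, XG, XR, YG, YR, XN, YN, XP, YP, CJ} s s'' \<and>
        num_kept {WA, WB} s s'') s') s"
      proof (rule wp_mono[OF wp_replace_entries[where n = n]], goal_cases)
        case (4 i)
        have "entry s LG LR i \<in> E" using 4(1) n(3) by blast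
        then show ?case using entry_setD(3)[OF E] 4(2,3) by (auto simp: entry_def e_def B_def)
      next
        case (5 t s1)
        have u: "entry s1 LG LR i = ?u (entry s LG LR i)" if "i < n" for i
          using 5 that unfolding e_def f_def B_def by blast
        have mk: "idx s1 MK i = (case entry s LG LR i of (g, r) \<Rightarrow>
           if r = e \<and> g \<noteq> e \<and> insert f (B - {g}) \<in> F then 1 else 0)" if "i < n" for i
          using 5 that n(2)[OF that] unfolding e_def f_def B_def by (simp split: prod.splits)
        have fr: "idx_kept {LR, MK, CJ, BAS, RES} s s1" "num s1 = num s"
          and t: "t \<le> n * (d + 100) + 40" using 5 by blast+
        have B1: "support (idx s1 BAS) = B" using 5 by (simp add: B_def)
        have "wp resort (\<lambda>t s'. t \<le> 160 * n + 90 \<and> optimal_state prec' s' n \<and>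
          idx_kept {LG, LR, MK, XG, XR, YG, YR, XN, YN, XP, YP, CJ} s1 s' \<and> num s' = num s1) s1"
        proof (rule resorted[where u = ?u and \<delta> = "num s 2 f - num s 2 e"])
          show "entry_set prec' (support (idx s1 BAS)) (?u ` E)"
            unfolding B1 using entry_set_replace[OF tr4 _ _ E] False by blast
        next
          fix i assume "i < n" "idx s1 MK i = 0"
          then show "gain (num s 2) (?u (entry s LG LR i)) = gain (num s 2) (entry s LG LR i)"
            using mk[of i] by (auto split: prod.splits if_splits)
        next
          fix i assume "i < n" "idx s1 MK i \<noteq> 0"
          then show "gain (num s 2) (?u (entry s LG LR i)) = gain (num s 2) (entry s LG LR i) + (num s 2 f - num s 2 e)"
            using mk[of i] by (auto simp: gain_def split: prod.splits if_splits)
        qed (use u fr n xo' B1 W in auto)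
        then show ?case
        proof (rule wp_mono, goal_cases)
          case (1 t' s'')
          then show ?case using t fr by (simp add: algebra_simps)
        qed
      qed (use n em False in \<open>auto simp: f_def B_def\<close>)
      then show ?thesis
        using False eB unfolding update_def
        by (auto simp: e_def[symmetric] f_def[symmetric] elim!: wp_mono)
    qed
  qed
qed

end

section \<open>The upper envelope on one cell\<close>

text \<open>Lines with intercepts \<open>ic\<close> and slopes \<open>sl\<close>, sorted by slope, on a set \<open>X\<close> that lies between \<open>cl\<close> and \<open>cu\<close>.
  The flags \<open>lfree\<close> and \<open>rfree\<close> stand for a missing lower or upper bound.\<close>

locale upper_envelope =
  fixes ic sl :: "'p \<Rightarrow> real" and L :: "nat \<Rightarrow> 'p" and n :: nat
    and X :: "real set" and lfree rfree :: bool and cl cu :: real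
  assumes sorted: "i < j \<Longrightarrow> j < n \<Longrightarrow> sl (L i) \<le> sl (L j)"
    and X_lower: "x \<in> X \<Longrightarrow> lfree \<or> cl \<le> x"
    and X_upper: "x \<in> X \<Longrightarrow> rfree \<or> x \<le> cu"
begin

definition val :: "'p \<Rightarrow> real \<Rightarrow> real" where
  "val q x = ic q + x * sl q"

definition crossing :: "'p \<Rightarrow> 'p \<Rightarrow> real" where
  "crossing q r = (ic q - ic r) / (sl r - sl q)"

lemma val_crossing:
  assumes "sl q < sl r"
  shows "val q x \<le> val r x \<longleftrightarrow> crossing q r \<le> x"
    and "val r x \<le> val q x \<longleftrightarrow> x \<le> crossing q r"
    and "val q (crossing q r) = val r (crossing q r)"
proof -
  have p: "0 < sl r - sl q" using assms by simp
  show "val q x \<le> val r x \<longleftrightarrow> crossing q r \<le> x"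
    unfolding crossing_def pos_divide_le_eq[OF p] val_def by (simp add: algebra_simps)
  show "val r x \<le> val q x \<longleftrightarrow> x \<le> crossing q r"
    unfolding crossing_def pos_le_divide_eq[OF p] val_def by (simp add: algebra_simps)
  have "crossing q r * (sl r - sl q) = ic q - ic r" using p by (simp add: crossing_def)
  then show "val q (crossing q r) = val r (crossing q r)" by (simp add: val_def algebra_simps)
qed

text \<open>Consecutive lines of the stack meet at strictly increasing points strictly inside the cell. The
  left end of the cell serves as \<open>p 0\<close>; a cell without lower bound imposes nothing there.\<close>

definition link :: "(nat \<Rightarrow> 'p) \<Rightarrow> (nat \<Rightarrow> real) \<Rightarrow> nat \<Rightarrow> bool" where
  "link S p j \<longleftrightarrow> sl (S j) < sl (S (Suc j)) \<and> p (Suc j) = crossing (S j) (S (Suc j)) \<and>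
     (j = 0 \<and> lfree \<or> p j < p (Suc j)) \<and> (rfree \<or> p (Suc j) < cu)"

definition chain :: "(nat \<Rightarrow> 'p) \<Rightarrow> (nat \<Rightarrow> real) \<Rightarrow> nat \<Rightarrow> bool" where
  "chain S p k \<longleftrightarrow> (0 < k \<longrightarrow> p 0 = cl) \<and> (\<forall>j. Suc j < k \<longrightarrow> link S p j)"

lemma chainD:
  assumes "chain S p k" "Suc j < k"
  shows "sl (S j) < sl (S (Suc j))" "p (Suc j) = crossing (S j) (S (Suc j))"
    "j = 0 \<and> lfree \<or> p j < p (Suc j)" "rfree \<or> p (Suc j) < cu"
proof -
  have "link S p j" using assms by (simp add: chain_def)
  then show "sl (S j) < sl (S (Suc j))" "p (Suc j) = crossing (S j) (S (Suc j))"
    "j = 0 \<and> lfree \<or> p j < p (Suc j)" "rfree \<or> p (Suc j) < cu"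
    unfolding link_def by - (elim conjE, assumption)+
qed

text \<open>After \<open>i\<close> lines have been looked at, each of them is dominated at every point by some line of the
  stack or by line \<open>i\<close>. The second alternative is what allows popping lines before line \<open>i\<close> itself is pushed.\<close>

definition scanned :: "nat \<Rightarrow> (nat \<Rightarrow> 'p) \<Rightarrow> (nat \<Rightarrow> real) \<Rightarrow> nat \<Rightarrow> bool" where
  "scanned i S p k \<longleftrightarrow> chain S p k \<and> (\<forall>j<k. \<exists>q<i. S j = L q) \<and>
     (\<forall>q<i. \<forall>x\<in>X. (\<exists>j<k. val (L q) x \<le> val (S j) x) \<or> i < n \<and> val (L q) x \<le> val (L i) x)"

lemma scanned_empty: "scanned 0 S p 0"
  by (simp add: scanned_def chain_def)

lemma scanned_slope:
  assumes "scanned i S p (Suc k)" "i < n"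
  shows "sl (S k) \<le> sl (L i)"
proof -
  obtain q where "q < i" "S k = L q" using assms(1) by (auto simp: scanned_def)
  then show ?thesis using sorted assms(2) by auto
qed

lemma scanned_push_first:
  assumes "scanned i S p 0" "i < n"
  shows "scanned (Suc i) (S(0 := L i)) (p(0 := cl)) 1"
  using assms by (auto simp: scanned_def chain_def less_Suc_eq)

lemma scanned_skip:
  assumes s: "scanned i S p (Suc k)" "i < n" and le: "\<And>x. x \<in> X \<Longrightarrow> val (L i) x \<le> val (S k) x"
  shows "scanned (Suc i) S p (Suc k)"
proof -
  have "\<exists>j<Suc k. val (L q) x \<le> val (S j) x" if "q < Suc i" "x \<in> X" for q x
    using s(1) that le[of x] order.trans unfolding scanned_def less_Suc_eq by blast
  then show ?thesis using s(1) unfolding scanned_def by (blast intro: less_SucI)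
qed

lemma scanned_pop:
  assumes s: "scanned i S p (Suc k)" "i < n"
    and le: "\<And>x. x \<in> X \<Longrightarrow> val (S k) x \<le> val (L i) x \<or> 0 < k \<and> val (S k) x \<le> val (S (k - 1)) x"
  shows "scanned i S p k"
proof -
  have "(\<exists>j<k. val (L q) x \<le> val (S j) x) \<or> i < n \<and> val (L q) x \<le> val (L i) x"
    if q: "q < i" "x \<in> X" for q x
  proof -
    consider j where "j < k" "val (L q) x \<le> val (S j) x" | "val (L q) x \<le> val (S k) x"
      | "val (L q) x \<le> val (L i) x"
      using s(1) q unfolding scanned_def less_Suc_eq by blast
    then show ?thesis
    proof cases
      case 2
      then show ?thesis using le[OF q(2)] s(2) order.trans
        by (metis diff_less zero_less_one)
    qed (use s(2) in auto)
  qed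
  then show ?thesis using s(1) by (auto simp: scanned_def chain_def)
qed

lemma scanned_pop_parallel:
  assumes s: "scanned i S p (Suc k)" "i < n" and "\<not> sl (S k) < sl (L i)" "ic (S k) \<le> ic (L i)"
  shows "scanned i S p k"
proof (rule scanned_pop[OF s])
  have "sl (S k) = sl (L i)" using scanned_slope[OF s] assms by simp
  then show "val (S k) x \<le> val (L i) x \<or> 0 < k \<and> val (S k) x \<le> val (S (k - 1)) x" for x
    using assms by (simp add: val_def)
qed

lemma scanned_skip_parallel:
  assumes s: "scanned i S p (Suc k)" "i < n" and "\<not> sl (S k) < sl (L i)" "\<not> ic (S k) \<le> ic (L i)"
  shows "scanned (Suc i) S p (Suc k)"
proof (rule scanned_skip[OF s])
  have "sl (S k) = sl (L i)" using scanned_slope[OF s] assms by simp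
  then show "val (L i) x \<le> val (S k) x" for x using assms by (simp add: val_def)
qed

text \<open>The top line exceeds its predecessor only to the right of \<open>p k\<close>, where it is already below
  the new line; for \<open>k = 0\<close> the whole cell lies to the right of \<open>p k\<close>.\<close>

lemma scanned_pop_hidden:
  assumes s: "scanned i S p (Suc k)" "i < n" and lt: "sl (S k) < sl (L i)"
    and c: "\<not> (k = 0 \<and> lfree)" "crossing (S k) (L i) \<le> p k"
  shows "scanned i S p k"
proof (rule scanned_pop[OF s])
  fix x assume x: "x \<in> X"
  show "val (S k) x \<le> val (L i) x \<or> 0 < k \<and> val (S k) x \<le> val (S (k - 1)) x"
  proof (cases "p k \<le> x")
    case True
    then show ?thesis using c(2) val_crossing(1)[OF lt] by auto
  next
    case False
    have ch: "chain S p (Suc k)" using s(1) by (simp add: scanned_def)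
    have "p 0 = cl" using ch by (simp add: chain_def)
    then have "k \<noteq> 0" using False c(1) X_lower[OF x] by (cases "k = 0") auto
    then obtain k' where k': "k = Suc k'" by (cases k) auto
    then have "sl (S k') < sl (S k)" "p k = crossing (S k') (S k)" using chainD(1,2)[OF ch, of k'] by auto
    then show ?thesis using val_crossing(2)[of "S k'" "S k" x] False k' by auto
  qed
qed

lemma scanned_push:
  assumes s: "scanned i S p (Suc k)" "i < n" and lt: "sl (S k) < sl (L i)"
    and t: "t = crossing (S k) (L i)" "k = 0 \<and> lfree \<or> p k < t" "rfree \<or> t < cu"
  shows "scanned (Suc i) (S(Suc k := L i)) (p(Suc k := t)) (Suc (Suc k))"
proof -
  have ch: "chain S p (Suc k)" and mem: "\<forall>j<Suc k. \<exists>q<i. S j = L q"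
    and cov: "\<forall>q<i. \<forall>x\<in>X. (\<exists>j<Suc k. val (L q) x \<le> val (S j) x) \<or> i < n \<and> val (L q) x \<le> val (L i) x"
    using s(1) by (simp_all add: scanned_def)
  have "chain (S(Suc k := L i)) (p(Suc k := t)) (Suc (Suc k))"
    unfolding chain_def
  proof (intro conjI allI impI)
    show "(p(Suc k := t)) 0 = cl" using ch by (simp add: chain_def)
    fix j assume "Suc j < Suc (Suc k)"
    then consider "j = k" | "Suc j < Suc k" by linarith
    then show "link (S(Suc k := L i)) (p(Suc k := t)) j"
    proof cases
      case 1
      then show ?thesis using lt t by (auto simp: link_def)
    next
      case 2
      then have "link S p j" using ch by (simp add: chain_def)
      moreover have "(S(Suc k := L i)) j = S j" "(S(Suc k := L i)) (Suc j) = S (Suc j)"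
        "(p(Suc k := t)) j = p j" "(p(Suc k := t)) (Suc j) = p (Suc j)" using 2 by auto
      ultimately show ?thesis unfolding link_def by metis
    qed
  qed
  moreover have "\<exists>q<Suc i. (S(Suc k := L i)) j = L q" if "j < Suc (Suc k)" for j
  proof (cases "j = Suc k")
    case False
    then have "j < Suc k" using that by simp
    then obtain q where "q < i" "S j = L q" using mem by blast
    then show ?thesis using False by (intro exI[of _ q]) simp
  qed auto
  moreover have "\<exists>j<Suc (Suc k). val (L q) x \<le> val ((S(Suc k := L i)) j) x" if q: "q < Suc i" "x \<in> X" for q x
  proof -
    have "(\<exists>j<Suc k. val (L q) x \<le> val (S j) x) \<or> val (L q) x \<le> val (L i) x"
    proof (cases "q = i")
      case False
      then have "q < i" using q by simp
      then show ?thesis using cov q(2) by blast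
    qed simp
    then show ?thesis
    proof (elim disjE exE conjE)
      fix j assume "j < Suc k" "val (L q) x \<le> val (S j) x"
      then show ?thesis by (intro exI[of _ j]) simp
    next
      assume "val (L q) x \<le> val (L i) x"
      then show ?thesis by (intro exI[of _ "Suc k"]) simp
    qed
  qed
  ultimately show ?thesis unfolding scanned_def by blast
qed

lemma scanned_skip_late:
  assumes s: "scanned i S p (Suc k)" "i < n" and lt: "sl (S k) < sl (L i)"
    and t: "\<not> (rfree \<or> crossing (S k) (L i) < cu)"
  shows "scanned (Suc i) S p (Suc k)"
proof (rule scanned_skip[OF s])
  fix x assume "x \<in> X"
  then have "x \<le> crossing (S k) (L i)" using X_upper[of x] t by linarith
  then show "val (L i) x \<le> val (S k) x" by (simp add: val_crossing(2)[OF lt])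
qed

lemma chain_mono:
  assumes c: "chain S p k" and ij: "0 < i" "i \<le> j" "j < k"
  shows "p i \<le> p j"
  using ij(2,3)
proof (induction j rule: dec_induct)
  case (step j)
  then show ?case using chainD(3)[OF c, of j] ij(1) by auto
qed simp

text \<open>The breakpoints increase, so at a point between \<open>p j\<close> and \<open>p (j + 1)\<close> the values of the stack lines
  increase up to \<open>S j\<close> and decrease afterwards.\<close>

lemma chain_optimal:
  assumes c: "chain S p k" and j: "j < k" "j = 0 \<or> p j \<le> x" "Suc j < k \<Longrightarrow> x \<le> p (Suc j)"
    and j': "j' < k"
  shows "val (S j') x \<le> val (S j) x"
proof (cases "j \<le> j'")
  case True
  then show ?thesis using j'
  proof (induction j' rule: dec_induct)
    case (step i)
    have "x \<le> p (Suc i)"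
      using j(3) chain_mono[OF c, of "Suc j" "Suc i"] step by auto
    then have "val (S (Suc i)) x \<le> val (S i) x"
      using chainD(1,2)[OF c, of i] step val_crossing(2)[of "S i" "S (Suc i)" x] by auto
    then show ?case using step by auto
  qed simp
next
  case False
  then have "j' \<le> j" by simp
  then show ?thesis
  proof (induction j' rule: inc_induct)
    case (step i)
    have "p (Suc i) \<le> x"
      using j(2) chain_mono[OF c, of "Suc i" j] step j(1) by auto
    then have "val (S i) x \<le> val (S (Suc i)) x"
      using chainD(1,2)[OF c, of i] step j(1) val_crossing(1)[of "S i" "S (Suc i)" x] by auto
    then show ?case using step by auto
  qed simp
qed

lemma scanned_optimal:
  assumes s: "scanned n S p k" and j: "j < k" "j = 0 \<or> p j \<le> x" "Suc j < k \<Longrightarrow> x \<le> p (Suc j)"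
    and x: "x \<in> X" and q: "q < n"
  shows "val (L q) x \<le> val (S j) x"
proof -
  obtain j' where "j' < k" "val (L q) x \<le> val (S j') x"
    using s x q unfolding scanned_def by blast
  moreover have "chain S p k" using s by (simp add: scanned_def)
  ultimately show ?thesis using chain_optimal[OF _ j] by force
qed

lemma scanned_nonempty: "scanned n S p k \<Longrightarrow> 0 < n \<Longrightarrow> x \<in> X \<Longrightarrow> 0 < k"
  by (cases k) (auto simp: scanned_def)

end

lemma above_decode: "above (decode_bound 1 v) x \<longleftrightarrow> v \<le> x"
  and below_decode: "below (decode_bound 2 v) x \<longleftrightarrow> x < v"
  by (simp_all add: decode_bound_def)

lemma above_lower: "above (decode_bound c v) x \<Longrightarrow> c = 0 \<or> v \<le> x"
  and below_upper: "below (decode_bound c v) x \<Longrightarrow> c = 0 \<or> x \<le> v"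
  and above_greater: "c = 0 \<or> v < x \<Longrightarrow> above (decode_bound c v) x"
  and below_less: "c = 0 \<or> x < v \<Longrightarrow> below (decode_bound c v) x"
  by (auto simp: decode_bound_def split: if_splits)

text \<open>The output condition with the interval replaced by the part \<open>S\<close> that has been covered so far, and
  an arbitrary condition \<open>V\<close> on the answer at a point.\<close>

definition output_ok :: "(real \<Rightarrow> nat \<Rightarrow> real \<Rightarrow> bool) \<Rightarrow> state \<Rightarrow> real set \<Rightarrow> bool" where
  "output_ok V s S \<longleftrightarrow>
     (\<Union>j<out_count s. out_piece s j) = S \<and>
     disjoint_family_on (out_piece s) {..<out_count s} \<and>
     (\<forall>j<out_count s. out_piece s j \<noteq> {} \<and>
        (\<forall>x\<in>out_piece s j. V x (out_element s j) (out_value s j x)))"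

lemma output_ok_extend:
  assumes ok: "output_ok V s S" and c: "out_count s = c" "out_count s' = Suc c"
    and same: "\<And>j. j < c \<Longrightarrow> out_piece s' j = out_piece s j"
      "\<And>j. j < c \<Longrightarrow> out_element s' j = out_element s j"
      "\<And>j. j < c \<Longrightarrow> out_value s' j = out_value s j"
    and new: "out_piece s' c = P" "P \<inter> S = {}" "P \<noteq> {}"
      "\<And>x. x \<in> P \<Longrightarrow> V x (out_element s' c) (out_value s' c x)"
  shows "output_ok V s' (S \<union> P)"
proof -
  have "(\<Union>j<Suc c. out_piece s' j) = S \<union> P"
    using ok c(1) same(1) new(1) by (auto simp: output_ok_def lessThan_Suc)
  moreover have "disjoint_family_on (out_piece s') {..<Suc c}"
  proof -
    have "out_piece s' i \<inter> out_piece s' j = {}" if "i < j" "j < Suc c" for i j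
    proof (cases "j = c")
      case True
      then have "out_piece s' i \<subseteq> S" using ok c(1) same(1) that by (auto simp: output_ok_def)
      then show ?thesis using True new by auto
    next
      case False
      then show ?thesis using ok c(1) same(1) that by (auto simp: output_ok_def disjoint_family_on_def)
    qed
    then show ?thesis unfolding disjoint_family_on_def by (metis Int_commute lessThan_iff nat_neq_iff)
  qed
  moreover have "out_piece s' j \<noteq> {} \<and> (\<forall>x\<in>out_piece s' j. V x (out_element s' j) (out_value s' j x))"
    if "j < Suc c" for j
    using that ok c(1) same new by (cases "j = c") (auto simp: output_ok_def)
  ultimately show ?thesis unfolding output_ok_def c(2) by blast
qed

abbreviation icept_exp :: "nat \<Rightarrow> nat \<Rightarrow> iexp \<Rightarrow> rexp" where
  "icept_exp G R i \<equiv> RSub (RRead 1 (IRead R i)) (RRead 1 (IRead G i))"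

definition push_line :: "rexp \<Rightarrow> com" where
  "push_line v = IWrite SG (ivar SN) (IRead LG (ivar LI)) ;; IWrite SR (ivar SN) (IRead LR (ivar LI)) ;;
     RWrite PB (ivar SN) v ;; incr SN ;; incr LI"

abbreviation top_index :: iexp where "top_index \<equiv> ISub (ivar SN) (IConst 1)"

text \<open>Each iteration either pops a line or finishes line \<open>LI\<close>, so twice the number of remaining lines plus the
  height of the stack decreases, and the scan takes linear time.\<close>

definition scan_lines :: com where
  "scan_lines = iset SN (IConst 0) ;; iset LI (IConst 0) ;;
     While (ILess (ivar LI) (ivar LEN))
       (If (ILess (ivar SN) (IConst 1)) (push_line (rvar CL))
         (If (RLess (slope_exp SG SR top_index) (slope_exp LG LR (ivar LI)))
           (rset TMP (RDiv (RSub (icept_exp SG SR top_index) (icept_exp LG LR (ivar LI)))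
              (RSub (slope_exp LG LR (ivar LI)) (slope_exp SG SR top_index))) ;;
            If (BAnd (BNot (BAnd (ILess (ivar SN) (IConst 2)) (ILess (ivar SK) (IConst 1))))
                 (BNot (RLess (RRead PB top_index) (rvar TMP))))
              (iset SN top_index)
              (If (BOr (ILess (ivar EK) (IConst 1)) (RLess (rvar TMP) (rvar CU)))
                (push_line (rvar TMP)) (incr LI)))
           (If (RLess (icept_exp LG LR (ivar LI)) (icept_exp SG SR top_index)) (incr LI) (iset SN top_index))))"

text \<open>The pieces are half-open except at the ends of the cell: each one starts closed where its
  predecessor ended open. While the first piece is written, \<open>SK\<close> is the
  kind of the left end of the cell, and it is 1 for the later ones.\<close>

definition emit_pieces :: com where
  "emit_pieces = For KI (ivar SN)
     (IWrite 2 (ivar 1) (ivar SK) ;; RWrite 3 (ivar 1) (RRead PB (ivar KI)) ;;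
      If (ILess (succ (ivar KI)) (ivar SN))
        (IWrite 3 (ivar 1) (IConst 2) ;; RWrite 4 (ivar 1) (RRead PB (succ (ivar KI))) ;; iset SK (IConst 1))
        (IWrite 3 (ivar 1) (ivar EK) ;; RWrite 4 (ivar 1) (rvar CU)) ;;
      IWrite 4 (ivar 1) (IRead SG (ivar KI)) ;;
      RWrite 5 (ivar 1) (RAdd (rvar WA) (icept_exp SG SR (ivar KI))) ;;
      RWrite 6 (ivar 1) (RAdd (rvar WB) (slope_exp SG SR (ivar KI))) ;; incr 1)"

definition emit_cell :: com where
  "emit_cell = scan_lines ;; emit_pieces"

context oracle_machine
begin

lemma wp_scan_lines:
  fixes s :: state
  defines "L \<equiv> entry s LG LR" and "lfree \<equiv> idx s SK 0 = 0" and "rfree \<equiv> idx s EK 0 = 0"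
  assumes env: "upper_envelope (gain (num s 2)) L n X lfree rfree (num s CL 0) (num s CU 0)"
    and n: "idx s LEN 0 = n"
  shows "wp scan_lines (\<lambda>t s'. t \<le> 400 * n + 40 \<and> idx s' SN 0 \<le> n \<and>
     upper_envelope.scanned (gain (num s 1)) (gain (num s 2)) L n X lfree rfree (num s CL 0) (num s CU 0)
       n (entry s' SG SR) (num s' PB) (idx s' SN 0) \<and>
     idx_kept {SG, SR, SN, LI} s s' \<and> num_kept {PB, TMP} s s') s"
proof -
  interpret U: upper_envelope "gain (num s 1)" "gain (num s 2)" L n X lfree rfree "num s CL 0" "num s CU 0"
    by (fact env)
  define Inv where "Inv = (\<lambda>N (s' :: state). \<exists>i k. i \<le> n \<and> k \<le> i \<and> N = 2 * (n - i) + k \<and>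
     idx s' LI 0 = i \<and> idx s' SN 0 = k \<and> U.scanned i (entry s' SG SR) (num s' PB) k \<and>
     idx_kept {SG, SR, SN, LI} s s' \<and> num_kept {PB, TMP} s s')"
  show ?thesis
    unfolding scan_lines_def wp_Seq wp_IWrite
  proof (rule wp_While[where Inv = Inv and n = "2 * n" and K = 180], goal_cases)
    case 1
    show ?case using U.scanned_empty by (auto simp: Inv_def)
  next
    case (2 N s')
    then obtain i k where ik: "i \<le> n" "k \<le> i" "N = 2 * (n - i) + k" "idx s' LI 0 = i" "idx s' SN 0 = k"
      and sc: "U.scanned i (entry s' SG SR) (num s' PB) k"
      and fr: "idx_kept {SG, SR, SN, LI} s s'" "num_kept {PB, TMP} s s'"
      unfolding Inv_def by blast
    have i: "i < n" using 2(2) ik(4) fr(1) n by simp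
    have fx: "idx s' LG = idx s LG" "idx s' LR = idx s LR" "idx s' SK 0 = 0 \<longleftrightarrow> lfree" "idx s' EK 0 = 0 \<longleftrightarrow> rfree"
      "0 < idx s' SK 0 \<longleftrightarrow> \<not> lfree" "0 < idx s' EK 0 \<longleftrightarrow> \<not> rfree"
      "num s' (Suc 0) = num s (Suc 0)" "num s' 2 = num s 2" "num s' CL = num s CL" "num s' CU = num s CU"
      using fr by (auto simp: lfree_def rfree_def)
    have Li: "L i = (idx s LG i, idx s LR i)" by (simp add: L_def entry_def)
    have push: "wp (push_line v) (\<lambda>t s2. t \<le> 40 + rcost v \<and> (\<exists>N'<N. Inv N' s2)) s1"
      if s1: "\<forall>r. idx s1 r = idx s' r" "\<forall>r. r \<noteq> TMP \<longrightarrow> num s1 r = num s' r"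
        and p: "U.scanned (Suc i) ((entry s' SG SR)(k := L i)) ((num s' PB)(k := reval s1 v)) (Suc k)"
        and rv: "\<And>x y. reval (iupd SR k y (iupd SG k x s1)) v = reval s1 v" for v s1
    proof -
      let ?s = "iupd LI 0 (Suc i) (iupd SN 0 (Suc k) (rupd PB k (reval s1 v) (iupd SR k (idx s LR i) (iupd SG k (idx s LG i) s1))))"
      have e1: "entry s1 SG SR = entry s' SG SR" using s1 by (simp add: entry_def fun_eq_iff)
      have "Inv (2 * (n - Suc i) + Suc k) ?s"
        unfolding Inv_def
        by (intro exI[of _ "Suc i"] exI[of _ "Suc k"]) (use i ik p s1 fr in \<open>auto simp: e1 Li\<close>)
      moreover have "2 * (n - Suc i) + Suc k < N" using i ik by simp
      ultimately have "\<exists>N'<N. Inv N' ?s" by blast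
      then show ?thesis
        unfolding push_line_def using s1 ik fx rv by simp
    qed
    have skip: "\<exists>N'<N. Inv N' (iupd LI 0 (Suc i) s1)"
      if s1: "\<forall>r. idx s1 r = idx s' r" "\<forall>r. r \<noteq> TMP \<longrightarrow> num s1 r = num s' r"
        and p: "U.scanned (Suc i) (entry s' SG SR) (num s' PB) k" for s1
    proof -
      have e1: "entry s1 SG SR = entry s' SG SR" using s1 by (simp add: entry_def fun_eq_iff)
      have "Inv (2 * (n - Suc i) + k) (iupd LI 0 (Suc i) s1)"
        unfolding Inv_def
        by (intro exI[of _ "Suc i"] exI[of _ k]) (use i ik p s1 fr in \<open>auto simp: e1\<close>)
      moreover have "2 * (n - Suc i) + k < N" using i ik by simp
      ultimately show ?thesis by blast
    qed
    have pop: "\<exists>N'<N. Inv N' (iupd SN 0 k' s1)"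
      if s1: "\<forall>r. idx s1 r = idx s' r" "\<forall>r. r \<noteq> TMP \<longrightarrow> num s1 r = num s' r" and k': "k = Suc k'"
        and p: "U.scanned i (entry s' SG SR) (num s' PB) k'" for s1 k'
    proof -
      have e1: "entry s1 SG SR = entry s' SG SR" using s1 by (simp add: entry_def fun_eq_iff)
      have "Inv (2 * (n - i) + k') (iupd SN 0 k' s1)"
        unfolding Inv_def
        by (intro exI[of _ i] exI[of _ k']) (use i ik p s1 fr k' in \<open>auto simp: e1\<close>)
      moreover have "2 * (n - i) + k' < N" using ik k' by simp
      ultimately show ?thesis by blast
    qed
    show ?case
    proof (cases k)
      case 0
      have "wp (push_line (rvar CL)) (\<lambda>t s2. t \<le> 40 + rcost (rvar CL) \<and> (\<exists>N'<N. Inv N' s2)) s'"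
        by (rule push) (use U.scanned_push_first[OF sc[unfolded 0] i] 0 fx in simp_all)
      then show ?thesis using 0 ik by (auto elim!: wp_mono)
    next
      case (Suc k')
      note sc' = sc[unfolded Suc]
      define q where "q = entry s' SG SR k'"
      have q: "idx s' SG k' = fst q" "idx s' SR k' = snd q" by (simp_all add: q_def entry_def)
      then have q0: "k' = 0 \<Longrightarrow> idx s' SG 0 = fst q" "k' = 0 \<Longrightarrow> idx s' SR 0 = snd q" by auto
      have sl: "gain (num s r) (L i) = num s r (idx s LR i) - num s r (idx s LG i)"
        "gain (num s r) q = num s r (snd q) - num s r (fst q)" for r
        by (simp_all add: Li gain_def)
      have L: "fst (L i) = idx s LG i" "snd (L i) = idx s LR i" by (simp_all add: Li)
      show ?thesis
      proof (cases "gain (num s 2) q < gain (num s 2) (L i)")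
        case True
        define t where "t = U.crossing q (L i)"
        let ?s = "rupd TMP 0 t s'"
        have t: "t = (num s 1 (snd q) - num s 1 (fst q) - (num s 1 (idx s LR i) - num s 1 (idx s LG i))) /
            (num s 2 (idx s LR i) - num s 2 (idx s LG i) - (num s 2 (snd q) - num s 2 (fst q)))"
          unfolding t_def U.crossing_def sl ..
        consider "\<not> (k' = 0 \<and> lfree)" "t \<le> num s' PB k'"
          | "k' = 0 \<and> lfree \<or> num s' PB k' < t" "rfree \<or> t < num s CU 0"
          | "k' = 0 \<and> lfree \<or> num s' PB k' < t" "\<not> (rfree \<or> t < num s CU 0)" by linarith
        then show ?thesis
        proof cases
          case 1
          have "\<exists>N'<N. Inv N' (iupd SN 0 k' ?s)"
            by (rule pop[OF _ _ Suc U.scanned_pop_hidden[OF sc' i]]) (use True 1 in \<open>auto simp: q_def t_def\<close>)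
          with 1 show ?thesis by (simp add: Suc ik fx True[unfolded sl] q t[unfolded One_nat_def, symmetric] not_less) auto
        next
          case 2
          have P: "wp (push_line (rvar TMP)) (\<lambda>t s2. t \<le> 40 + rcost (rvar TMP) \<and> (\<exists>N'<N. Inv N' s2)) ?s"
            by (rule push) (use U.scanned_push[OF sc' i _ t_def[unfolded q_def]] True 2 Suc in \<open>auto simp: q_def\<close>)
          show ?thesis
            using 2 by - (elim disjE conjE; simp add: Suc ik fx True[unfolded sl] q q0 t[unfolded One_nat_def, symmetric];
              rule wp_mono[OF P]; simp add: Suc ik)
        next
          case 3
          have "\<exists>N'<N. Inv N' (iupd LI 0 (Suc i) ?s)"
            by (rule skip) (use U.scanned_skip_late[OF sc' i] True 3 Suc in \<open>auto simp: q_def t_def\<close>)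
          with 3 show ?thesis by - (elim disjE conjE; simp add: Suc ik fx True[unfolded sl] q q0 t[unfolded One_nat_def, symmetric])
        qed
      next
        case False
        show ?thesis
        proof (cases "gain (num s 1) (L i) < gain (num s 1) q")
          case lt: True
          have "\<exists>N'<N. Inv N' (iupd LI 0 (Suc i) s')"
            by (rule skip) (use U.scanned_skip_parallel[OF sc' i] False lt Suc in \<open>auto simp: q_def\<close>)
          then show ?thesis by (simp add: Suc ik fx False[unfolded sl] lt[unfolded sl One_nat_def] q)
        next
          case lt: False
          have "\<exists>N'<N. Inv N' (iupd SN 0 k' s')"
            by (rule pop[OF _ _ Suc U.scanned_pop_parallel[OF sc' i]]) (use False lt in \<open>auto simp: q_def\<close>)
          then show ?thesis by (simp add: Suc ik fx False[unfolded sl] lt[unfolded sl One_nat_def] q)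
        qed
      qed
    qed
  next
    case (3 t N s')
    then obtain i k where ik: "i \<le> n" "k \<le> i" "idx s' LI 0 = i" "idx s' SN 0 = k"
      and sc: "U.scanned i (entry s' SG SR) (num s' PB) k"
      and fr: "idx_kept {SG, SR, SN, LI} s s'" "num_kept {PB, TMP} s s'"
      unfolding Inv_def by blast
    have "i = n" using 3(2) ik fr(1) n by simp
    then show ?case using 3(3) ik sc fr by simp
  qed
qed

lemma wp_emit_pieces:
  fixes s :: state
  defines "S \<equiv> entry s SG SR" and "p \<equiv> num s PB" and "k \<equiv> idx s SN 0"
    and "ic \<equiv> gain (num s 1)" and "sl \<equiv> gain (num s 2)"
    and "lfree \<equiv> idx s SK 0 = 0" and "rfree \<equiv> idx s EK 0 = 0"
  assumes X: "X = ivl (decode_bound (idx s SK 0) (num s CL 0)) (decode_bound (idx s EK 0) (num s CU 0))" "X \<noteq> {}"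
    and env: "upper_envelope sl L n X lfree rfree (num s CL 0) (num s CU 0)"
    and scanned: "upper_envelope.scanned ic sl L n X lfree rfree (num s CL 0) (num s CU 0) n S p k"
    and n: "0 < n" and ok: "output_ok V s R" "R \<inter> X = {}"
    and V: "\<And>x q. x \<in> X \<Longrightarrow> q < n \<Longrightarrow>
      (\<And>q'. q' < n \<Longrightarrow> ic (L q') + x * sl (L q') \<le> ic (L q) + x * sl (L q)) \<Longrightarrow>
      V x (fst (L q)) (num s WA 0 + ic (L q) + x * (num s WB 0 + sl (L q)))"
  shows "wp emit_pieces (\<lambda>t s'. t \<le> 150 * k + 40 \<and> output_ok V s' (R \<union> X) \<and>
     idx_kept {1, 2, 3, 4, SK, KI} s s' \<and> num_kept {3, 4, 5, 6} s s') s"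
proof -
  interpret U: upper_envelope ic sl L n X lfree rfree "num s CL 0" "num s CU 0" by (fact env)
  have chain: "U.chain S p k" using scanned by (simp add: U.scanned_def)
  have k: "0 < k" using U.scanned_nonempty[OF scanned n] X(2) by auto
  have p0: "p 0 = num s CL 0" using chain k by (simp add: U.chain_def)
  define T where "T = (\<lambda>j. if j = 0 then {} else if j < k then {x\<in>X. x < p j} else X)"
  define P where "P = (\<lambda>j. {x\<in>X. (j = 0 \<or> p j \<le> x) \<and> (Suc j < k \<longrightarrow> x < p (Suc j))})"
  have lower: "j = 0 \<or> lfree \<or> num s CL 0 < p j" if "j < k" for j
    using that
  proof (induction j)
    case (Suc j)
    then show ?case using U.chainD(3)[OF chain, of j] p0 by (cases "j = 0") force+
  qed simp
  have upper: "j = 0 \<or> rfree \<or> p j < num s CU 0" if "j < k" for j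
    using that U.chainD(4)[OF chain, of "j - 1"] by (cases j) auto
  have inX: "x \<in> X" if "j < k" "0 < j" "p j \<le> x" "rfree \<or> x < num s CU 0" for j x
    using that lower[of j] upper[of j] unfolding X(1) ivl_def lfree_def rfree_def
    by (auto intro!: above_greater below_less)
  have P_ivl: "ivl (decode_bound (if j = 0 then idx s SK 0 else 1) (p j))
      (decode_bound (if Suc j < k then 2 else idx s EK 0) (if Suc j < k then p (Suc j) else num s CU 0)) = P j"
    if j: "j < k" for j
  proof -
    have 1: "above (decode_bound (if j = 0 then idx s SK 0 else 1) (p j)) x \<longleftrightarrow>
        above (decode_bound (idx s SK 0) (num s CL 0)) x \<and> (j = 0 \<or> p j \<le> x)" for x
    proof (cases "j = 0")
      case False
      then have "p j \<le> x \<Longrightarrow> above (decode_bound (idx s SK 0) (num s CL 0)) x"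
        using lower[OF j] unfolding lfree_def by (auto intro!: above_greater)
      then show ?thesis using False above_decode[of "p j" x] by auto
    qed (simp add: p0)
    have 2: "below (decode_bound (if Suc j < k then 2 else idx s EK 0) (if Suc j < k then p (Suc j) else num s CU 0)) x \<longleftrightarrow>
        below (decode_bound (idx s EK 0) (num s CU 0)) x \<and> (Suc j < k \<longrightarrow> x < p (Suc j))" for x
    proof (cases "Suc j < k")
      case True
      then have "x < p (Suc j) \<Longrightarrow> below (decode_bound (idx s EK 0) (num s CU 0)) x"
        using upper[OF True] unfolding rfree_def by (auto intro!: below_less)
      then show ?thesis using True below_decode[of "p (Suc j)" x] by auto
    qed simp
    show ?thesis unfolding ivl_def 1 2 P_def X(1) by auto
  qed
  have P_ne: "P j \<noteq> {}" if j: "j < k" for j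
  proof (cases "j = 0")
    case False
    then have "p j \<in> X" using inX[OF j, of "p j"] upper[OF j] by auto
    then have "p j \<in> P j" using U.chainD(3)[OF chain, of j] False by (auto simp: P_def)
    then show ?thesis by auto
  next
    case True
    show ?thesis
    proof (cases "Suc 0 < k")
      case False
      then show ?thesis using True X(2) by (auto simp: P_def)
    next
      case k1: True
      obtain x where x: "lfree \<or> num s CL 0 < x" "x < p 1"
        using lower[OF k1] dense[of "num s CL 0" "p 1"] lt_ex[of "p 1"] by auto
      have "rfree \<or> x < num s CU 0" using upper[OF k1] x(2) by auto
      then have "x \<in> X" using x unfolding X(1) ivl_def lfree_def rfree_def
        by (auto intro!: above_greater below_less)
      then have "x \<in> P 0" using x k1 by (simp add: P_def)
      then show ?thesis using True by auto
    qed
  qed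
  have T_Suc: "T (Suc j) = T j \<union> P j" and disj: "P j \<inter> (R \<union> T j) = {}" if j: "j < k" for j
    using that ok(2) U.chainD(3)[OF chain, of j] by (auto simp: T_def P_def)
  have VP: "V x (fst (S j)) (num s WA 0 + ic (S j) + x * (num s WB 0 + sl (S j)))" if j: "j < k" "x \<in> P j" for j x
  proof -
    obtain q where q: "q < n" "S j = L q" using scanned j by (auto simp: U.scanned_def)
    have "ic (L q') + x * sl (L q') \<le> ic (S j) + x * sl (S j)" if "q' < n" for q'
      using U.scanned_optimal[OF scanned j(1), of x q'] j(2) that by (auto simp: P_def U.val_def)
    then show ?thesis using V[of x q] q j(2) by (auto simp: P_def)
  qed
  define Inv where "Inv = (\<lambda>j (s' :: state). output_ok V s' (R \<union> T j) \<and>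
      (j < k \<longrightarrow> idx s' SK 0 = (if j = 0 then idx s SK 0 else 1)) \<and>
     idx_kept {1, 2, 3, 4, SK, KI} s s' \<and> num_kept {3, 4, 5, 6} s s')"
  show ?thesis
    unfolding emit_pieces_def
  proof (rule wp_For[where Inv = Inv and n = k and K = 120], goal_cases)
    case 1
    have "output_ok V (iupd KI 0 0 s) R"
      using ok by (simp add: output_ok_def out_count_def out_piece_def[abs_def] out_element_def out_value_def)
    then show ?case using k by (auto simp: Inv_def T_def)
  next
    case (2 i s')
    then show ?case by (simp add: Inv_def k_def)
  next
    case (3 j s')
    have ok': "output_ok V s' (R \<union> T j)" and SKj: "idx s' SK 0 = (if j = 0 then idx s SK 0 else 1)"
      and fr: "idx_kept {1, 2, 3, 4, SK, KI} s s'" "num_kept {3, 4, 5, 6} s s'"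
      using 3(1,2) by (simp_all add: Inv_def)
    define c where "c = idx s' 1 0"
    have new: "Inv (Suc j) s3"
      if "idx_kept {1, 2, 3, 4, SK, KI} s' s3"
        "num_kept {3, 4, 5, 6} s' s3" "Suc j < k \<longrightarrow> idx s3 SK 0 = 1"
        "idx s3 1 0 = Suc c" "idx s3 2 = (idx s' 2)(c := idx s' SK 0)"
        "idx s3 3 = (idx s' 3)(c := if Suc j < k then 2 else idx s EK 0)"
        "idx s3 4 = (idx s' 4)(c := fst (S j))" "num s3 3 = (num s' 3)(c := p j)"
        "num s3 4 = (num s' 4)(c := if Suc j < k then p (Suc j) else num s CU 0)"
        "num s3 5 = (num s' 5)(c := num s WA 0 + ic (S j))"
        "num s3 6 = (num s' 6)(c := num s WB 0 + sl (S j))" for s3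
    proof -
      have "output_ok V s3 (R \<union> T j \<union> P j)"
      proof (rule output_ok_extend[OF ok', where c = c])
        show "out_piece s3 c = P j" using P_ivl[OF 3(1)] that SKj by (simp add: out_piece_def)
        show "P j \<inter> (R \<union> T j) = {}" by (rule disj[OF 3(1)])
        show "P j \<noteq> {}" by (rule P_ne[OF 3(1)])
        show "V x (out_element s3 c) (out_value s3 c x)" if "x \<in> P j" for x
          using VP[OF 3(1) that] \<open>idx s3 4 = _\<close> \<open>num s3 5 = _\<close> \<open>num s3 6 = _\<close>
          by (simp add: out_element_def out_value_def)
      qed (use that in \<open>auto simp: out_count_def out_piece_def out_element_def out_value_def c_def\<close>)
      then show ?thesis unfolding Inv_def using T_Suc[OF 3(1)] that(1-3) fr by (simp add: Un_assoc)
    qed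
    have q: "idx s' SG j = fst (S j)" "idx s' SR j = snd (S j)" using fr by (simp_all add: S_def entry_def)
    have fx: "num s' PB = p" "idx s' EK = idx s EK" "num s' CU = num s CU" "idx s' SN 0 = k" "num s' WA = num s WA"
      "num s' WB = num s WB" "num s' (Suc 0) = num s (Suc 0)" "num s' 2 = num s 2"
      using fr by (simp_all add: p_def k_def)
    have c': "idx s' (Suc 0) 0 = c" by (simp add: c_def)
    have ic: "ic (S j) = num s (Suc 0) (snd (S j)) - num s (Suc 0) (fst (S j))"
      and sl: "sl (S j) = num s 2 (snd (S j)) - num s 2 (fst (S j))" by (simp_all add: ic_def sl_def gain_def)
    show ?case
    proof (cases "Suc j < k")
      case True
      show ?thesis
        by (simp add: 3(3) q fx c' True new ic sl)
    next
      case False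
      show ?thesis
        using False by (simp add: 3(3) q fx c' new ic sl)
    qed
  next
    case (4 t s')
    then show ?case using k by (simp add: Inv_def T_def)
  qed
qed

lemma wp_emit_cell:
  fixes s :: state
  defines "ic \<equiv> gain (num s 1)" and "sl \<equiv> gain (num s 2)"
  assumes X: "X = ivl (decode_bound (idx s SK 0) (num s CL 0)) (decode_bound (idx s EK 0) (num s CU 0))" "X \<noteq> {}"
    and L: "sorted_entries s n E" and n: "0 < n" and ok: "output_ok V s R" "R \<inter> X = {}"
    and V: "\<And>x g r. x \<in> X \<Longrightarrow> (g, r) \<in> E \<Longrightarrow>
      (\<And>q. q \<in> E \<Longrightarrow> ic q + x * sl q \<le> ic (g, r) + x * sl (g, r)) \<Longrightarrow>
      V x g (num s WA 0 + ic (g, r) + x * (num s WB 0 + sl (g, r)))"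
  shows "wp emit_cell (\<lambda>t s'. t \<le> 600 * n + 100 \<and> output_ok V s' (R \<union> X) \<and>
     idx_kept {1, 2, 3, 4, SK, KI, SG, SR, SN, LI} s s' \<and>
     num_kept {3, 4, 5, 6, PB, TMP} s s') s"
proof -
  let ?L = "entry s LG LR"
  have LE: "idx s LEN 0 = n" "?L ` {..<n} = E"
    "\<And>i j. i < j \<Longrightarrow> j < n \<Longrightarrow> sl (?L i) \<le> sl (?L j)"
    using L by (simp_all add: sorted_entries_def sl_def)
  have env: "upper_envelope sl ?L n X (idx s SK 0 = 0) (idx s EK 0 = 0) (num s CL 0) (num s CU 0)"
    by standard (use LE(3) X(1) above_lower below_upper in \<open>auto simp: ivl_def\<close>)
  show ?thesis
    unfolding emit_cell_def wp_Seq
  proof (rule wp_mono[OF wp_scan_lines[OF env[unfolded sl_def] LE(1)]], goal_cases)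
    case (1 t s')
    have fr: "idx_kept {SG, SR, SN, LI} s s'" "num_kept {PB, TMP} s s'"
      and t: "t \<le> 400 * n + 40" "idx s' SN 0 \<le> n"
      and sc: "upper_envelope.scanned (gain (num s 1)) (gain (num s 2)) ?L n X (idx s SK 0 = 0) (idx s EK 0 = 0)
        (num s CL 0) (num s CU 0) n (entry s' SG SR) (num s' PB) (idx s' SN 0)"
      using 1 by blast+
    have fx: "idx s' SK = idx s SK" "idx s' EK = idx s EK" "num s' CL = num s CL" "num s' CU = num s CU"
      "num s' 1 = num s 1" "num s' 2 = num s 2" "num s' WA = num s WA" "num s' WB = num s WB"
      using fr by simp_all
    have ok': "output_ok V s' R"
      using ok(1) fr by (simp add: output_ok_def out_count_def out_piece_def[abs_def] out_element_def out_value_def)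
    show ?case
    proof (rule wp_mono[OF wp_emit_pieces[where X = X and L = ?L and n = n and V = V and R = R]], goal_cases)
      case 1
      show ?case using X(1) fx by simp
    next
      case 3
      show ?case using env fx by (simp only: sl_def)
    next
      case 4
      show ?case using sc by (simp only: fx)
    next
      case (8 x q)
      have "?L q \<in> E" using 8(2) LE(2) by blast
      moreover have "ic q' + x * sl q' \<le> ic (?L q) + x * sl (?L q)" if "q' \<in> E" for q'
        using 8(3) that LE(2) unfolding fx ic_def sl_def by blast
      ultimately show ?case
        using V[of x "fst (?L q)" "snd (?L q)"] 8(1) unfolding fx ic_def sl_def by simp
    next
      case (9 t' s'')
      then show ?case using t fr by simp
    qed (use X n ok ok' in auto)
  qed
qed

end

section \<open>Collecting the events\<close>

definition cross :: "(nat \<Rightarrow> real) \<Rightarrow> (nat \<Rightarrow> real) \<Rightarrow> nat \<Rightarrow> nat \<Rightarrow> real" where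
  "cross \<alpha> \<beta> e f = (\<alpha> f - \<alpha> e) / (\<beta> e - \<beta> f)"

definition inside :: "nat \<Rightarrow> real \<Rightarrow> nat \<Rightarrow> real \<Rightarrow> real \<Rightarrow> bool" where
  "inside lc lo uc hi x \<longleftrightarrow> (lc = 0 \<or> lo < x) \<and> (uc = 0 \<or> x < hi)"

text \<open>Each crossing is listed once, oriented such that \<open>e\<close> comes before \<open>f\<close> to the left of it. Crossings at an
  end point of the interval are left out, since the order just inside the interval determines
  an optimal basis at the end point as well.\<close>

definition overtakings :: "nat \<Rightarrow> (nat \<Rightarrow> real) \<Rightarrow> (nat \<Rightarrow> real) \<Rightarrow> nat \<Rightarrow> real \<Rightarrow> nat \<Rightarrow> real \<Rightarrow> (nat \<times> nat) set" where
  "overtakings m \<alpha> \<beta> lc lo uc hi =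
     {(e, f). e < m \<and> f < m \<and> \<beta> f < \<beta> e \<and> inside lc lo uc hi (cross \<alpha> \<beta> e f)}"

abbreviation lkind :: iexp where "lkind \<equiv> IRead 0 (IConst 1)"
abbreviation ukind :: iexp where "ukind \<equiv> IRead 0 (IConst 2)"
abbreviation lbnd :: rexp where "lbnd \<equiv> RRead 0 (IConst 0)"
abbreviation ubnd :: rexp where "ubnd \<equiv> RRead 0 (IConst 1)"
abbreviation IZero :: "iexp \<Rightarrow> bexp" where "IZero x \<equiv> ILess x (IConst 1)"

definition build_events :: com where
  "build_events = iset NEV (IConst 0) ;; RWrite KEY (IConst 0) ubnd ;;
     For CI melems (For CJ melems
       (If (RLess (RRead 2 (ivar CJ)) (RRead 2 (ivar CI)))
         (rset TMP (RDiv (RSub (RRead 1 (ivar CJ)) (RRead 1 (ivar CI)))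
            (RSub (RRead 2 (ivar CI)) (RRead 2 (ivar CJ)))) ;;
          If (BAnd (BOr (IZero lkind) (RLess lbnd (rvar TMP))) (BOr (IZero ukind) (RLess (rvar TMP) ubnd)))
            (incr NEV ;; IWrite EVE (ivar NEV) (ivar CI) ;; IWrite EVF (ivar NEV) (ivar CJ) ;;
             RWrite KEY (ivar NEV) (rvar TMP))
            Skip)
         Skip))"

text \<open>Index arithmetic has no division, so the table \<open>HALF\<close> gives the parents of nodes.\<close>

definition build_tree :: com where
  "build_tree = iset LV (succ (ivar NEV)) ;;
     For CI (ivar LV)
       (IWrite HALF (IAdd (ivar CI) (ivar CI)) (ivar CI) ;;
        IWrite HALF (succ (IAdd (ivar CI) (ivar CI))) (ivar CI)) ;;
     For CI (ivar LV)
       (iset CUR (IAdd (ivar LV) (ivar CI)) ;; iset VAL (ivar CI) ;; set_leaf)"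

definition lists_events :: "state \<Rightarrow> (nat \<times> nat) set \<Rightarrow> bool" where
  "lists_events s A \<longleftrightarrow> (let N = idx s NEV 0 in
     entry s EVE EVF ` {1..N} = A \<and> inj_on (entry s EVE EVF) {1..N} \<and>
     (\<forall>i\<in>{1..N}. num s KEY i = cross (num s 1) (num s 2) (idx s EVE i) (idx s EVF i)))"

lemma lists_events_insert:
  assumes L: "lists_events s A" and new: "(e, f) \<notin> A" and N: "idx s NEV 0 = N"
    and s': "idx s' NEV 0 = Suc N" "idx s' EVE = (idx s EVE)(Suc N := e)" "idx s' EVF = (idx s EVF)(Suc N := f)"
      "num s' KEY = (num s KEY)(Suc N := cross (num s 1) (num s 2) e f)" "num s' 1 = num s 1" "num s' 2 = num s 2"
  shows "lists_events s' (insert (e, f) A)"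
proof -
  have E: "entry s' EVE EVF i = (if i = Suc N then (e, f) else entry s EVE EVF i)" for i
    using s' by (simp add: entry_def)
  have At: "{1..Suc N} = insert (Suc N) {1..N}" by auto
  have L': "entry s EVE EVF ` {1..N} = A" "inj_on (entry s EVE EVF) {1..N}"
    "\<forall>i\<in>{1..N}. num s KEY i = cross (num s 1) (num s 2) (idx s EVE i) (idx s EVF i)"
    using L unfolding lists_events_def Let_def N by - (elim conjE, assumption)+
  have cong: "entry s' EVE EVF i = entry s EVE EVF i" if "i \<in> {1..N}" for i using that E by simp
  have img: "entry s' EVE EVF ` {1..N} = A" unfolding L'(1)[symmetric] by (rule image_cong[OF refl cong])
  have inj: "inj_on (entry s' EVE EVF) {1..N}" by (subst inj_on_cong[OF cong], assumption, rule L'(2))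
  have "entry s' EVE EVF (Suc N) = (e, f)" by (simp add: E)
  then have "entry s' EVE EVF ` {1..Suc N} = insert (e, f) A" "inj_on (entry s' EVE EVF) {1..Suc N}"
    unfolding At using img inj new by auto
  moreover have "num s' KEY i = cross (num s' 1) (num s' 2) (idx s' EVE i) (idx s' EVF i)" if "i \<in> {1..Suc N}" for i
    using that L'(3) s' by auto
  ultimately show ?thesis unfolding lists_events_def Let_def s'(1) by blast
qed

context oracle_machine
begin

lemma wp_build_events:
  fixes s :: state
  defines "P \<equiv> overtakings m (num s 1) (num s 2) (idx s 0 1) (num s 0 0) (idx s 0 2) (num s 0 1)"
  assumes m: "idx s 0 0 = m"
  shows "wp build_events (\<lambda>t s'. t \<le> m * (m * 150 + 60) + 60 \<and> lists_events s' P \<and> num s' KEY 0 = num s 0 1 \<and>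
     idx_kept {NEV, EVE, EVF, CI, CJ} s s' \<and> num_kept {KEY, TMP} s s') s"
proof -
  define seen where "seen = (\<lambda>i j. P \<inter> {(e, f). e < i \<or> e = i \<and> f < j})"
  define Inv where "Inv = (\<lambda>i j (s' :: state). lists_events s' (seen i j) \<and> num s' KEY 0 = num s 0 1 \<and>
     idx_kept {NEV, EVE, EVF, CI, CJ} s s' \<and> num_kept {KEY, TMP} s s')"
  have le: "lists_events (iupd r i v s') A = lists_events s' A" if "r \<in> {CI, CJ}" for r i v s' A
    using that by (auto simp: lists_events_def entry_def[abs_def])
  have lt: "lists_events (rupd TMP i v s') A = lists_events s' A" for i v s' A
    by (auto simp: lists_events_def entry_def[abs_def])
  have InvC: "Inv i j (iupd CI k v s') = Inv i j s'" "Inv i j (iupd CJ k v s') = Inv i j s'"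
    "Inv i j (rupd TMP k x s') = Inv i j s'" for i j k v x s'
    unfolding Inv_def by (simp_all add: le lt)
  have row: "seen i m = seen (Suc i) 0" for i
    by (auto simp: seen_def P_def overtakings_def less_Suc_eq)
  show ?thesis
    unfolding build_events_def wp_Seq wp_IWrite wp_RWrite
  proof (rule wp_For[where Inv = "\<lambda>i. Inv i 0" and n = m and K = "m * 135 + 30"], goal_cases)
    case 1
    show ?case by (simp add: Inv_def lists_events_def seen_def)
  next
    case (2 i s')
    then show ?case using m by (simp add: Inv_def)
  next
    case outer: (3 i s')
    show ?case
    proof (rule wp_For[where Inv = "\<lambda>j s'. Inv i j s' \<and> idx s' CI 0 = i" and n = m and K = 120], goal_cases)
      case 1
      then show ?case using outer by (simp add: InvC)
    next
      case (2 j s')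
      then show ?case using m by (simp add: Inv_def)
    next
      case (3 j s2)
      define N where "N = idx s2 NEV 0"
      have L: "lists_events s2 (seen i j)" and K0: "num s2 KEY 0 = num s 0 1"
        and fr: "idx_kept {NEV, EVE, EVF, CI, CJ} s s2" "num_kept {KEY, TMP} s s2"
        and ci: "idx s2 CI 0 = i"
        using 3(2) by (simp_all add: Inv_def)
      have fx: "num s2 0 = num s 0" "num s2 (Suc 0) = num s (Suc 0)" "num s2 2 = num s 2" "idx s2 0 = idx s 0"
        using fr by simp_all
      let ?c = "cross (num s 1) (num s 2) i j"
      have D: "seen i (Suc j) = (if (i, j) \<in> P then insert (i, j) (seen i j) else seen i j)"
        by (auto simp: seen_def less_Suc_eq)
      have ijP: "(i, j) \<in> P \<longleftrightarrow> num s 2 j < num s 2 i \<and> inside (idx s 0 1) (num s 0 0) (idx s 0 2) (num s 0 1) ?c"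
        using outer(1) 3(1) by (simp add: P_def overtakings_def)
      have skip: "Inv i (Suc j) s2" if "(i, j) \<notin> P" using 3(2) that by (simp add: Inv_def D)
      have new: "Inv i (Suc j) (rupd KEY (Suc N) ?c (iupd EVF (Suc N) j (iupd EVE (Suc N) i (iupd NEV 0 (Suc N) (rupd TMP 0 ?c s2)))))"
        if P: "(i, j) \<in> P"
      proof -
        have nd: "(i, j) \<notin> seen i j" by (simp add: seen_def)
        show ?thesis
          unfolding Inv_def D if_P[OF P]
          by (intro conjI lists_events_insert[OF L nd N_def[symmetric]]) (use fr K0 in auto)
      qed
      have c: "?c = (num s (Suc 0) j - num s (Suc 0) i) / (num s 2 i - num s 2 j)" by (simp add: cross_def)
      show ?case
      proof (cases "num s 2 j < num s 2 i")
        case True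
        then show ?thesis
          using new skip unfolding ijP
          by (simp add: 3(3) ci fx InvC c[unfolded One_nat_def, symmetric] inside_def N_def[symmetric])
      next
        case False
        then show ?thesis using skip ijP by (simp add: 3(3) ci fx InvC)
      qed
    next
      case (4 t s2)
      moreover from this have "Inv (Suc i) 0 s2" by (simp add: Inv_def row)
      ultimately show ?case by (simp add: InvC)
    qed
  next
    case (4 t s')
    have "seen m 0 = P" by (auto simp: seen_def P_def overtakings_def)
    then show ?case using 4 by (simp add: Inv_def algebra_simps)
  qed
qed

lemma wp_build_tree:
  fixes s :: state
  defines "n \<equiv> Suc (idx s NEV 0)"
  assumes T0: "idx s TREE = (\<lambda>_. 0)"
  shows "wp build_tree (\<lambda>t s'. t \<le> n * (70 * floor_log (2 * n) + 200) + 60 \<and> idx s' LV 0 = n \<and>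
     tournament (num s KEY) (idx s' TREE) n \<and> (\<forall>i<n. idx s' TREE (n + i) = i) \<and>
     (\<forall>j<2 * n. idx s' HALF j = j div 2) \<and>
     idx_kept {LV, HALF, TREE, CUR, VAL, CI} s s' \<and> num s' = num s) s"
proof -
  define Inv1 where "Inv1 = (\<lambda>i (s' :: state). idx s' LV 0 = n \<and> (\<forall>j<2 * i. idx s' HALF j = j div 2) \<and>
     idx_kept {LV, HALF, CI} s s' \<and> num s' = num s)"
  define Inv2 where "Inv2 = (\<lambda>i (s' :: state). idx s' LV 0 = n \<and>
     tournament (num s KEY) (idx s' TREE) n \<and> (\<forall>j<i. idx s' TREE (n + j) = j) \<and>
     (\<forall>j<2 * n. idx s' HALF j = j div 2) \<and>
     idx_kept {LV, HALF, TREE, CUR, VAL, CI} s s' \<and> num s' = num s)"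
  show ?thesis
    unfolding build_tree_def wp_Seq wp_IWrite
  proof (rule wp_For[where Inv = Inv1 and n = n and K = 40], goal_cases)
    case 1
    show ?case by (simp add: Inv1_def n_def)
  next
    case (2 i s')
    then show ?case by (simp add: Inv1_def)
  next
    case (3 i s')
    have half: "((idx s' HALF)(i + i := i, Suc (i + i) := i)) j = j div 2" if "j < 2 * Suc i" for j
    proof -
      have "j < 2 * i \<or> j = i + i \<or> j = Suc (i + i)" using \<open>j < 2 * Suc i\<close> by arith
      then consider "j < 2 * i" | "j = i + i" | "j = Suc (i + i)" by blast
      then show ?thesis using 3(2) by cases (auto simp: Inv1_def)
    qed
    have "Inv1 (Suc i) (iupd CI 0 (Suc i) (iupd HALF (Suc (i + i)) i (iupd HALF (i + i) i s')))"
      unfolding Inv1_def using 3(2) half by (simp add: Inv1_def)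
    then show ?case using 3(3) by simp
  next
    case (4 t1 s1)
    note one = 4
    show ?case
    proof (rule wp_For[where Inv = Inv2 and n = n and K = "70 * floor_log (2 * n) + 100"], goal_cases)
      case 1
      have "idx s1 TREE = (\<lambda>_. 0)" using one(1) T0 by (simp add: Inv1_def)
      then have "tournament (num s KEY) (idx s1 TREE) n" by (simp add: tournament_def node_ok_def)
      then show ?case using one(1) by (simp add: Inv1_def Inv2_def)
    next
      case (2 i s')
      then show ?case by (simp add: Inv2_def)
    next
      case (3 i s')
      let ?s = "iupd VAL 0 i (iupd CUR 0 (n + i) s')"
      have LV: "idx s' LV 0 = n" "num s' = num s" using 3(2) by (simp_all add: Inv2_def)
      have "floor_log (n + i) \<le> floor_log (2 * n)" using 3(1) by (intro floor_log_le_iff) simp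
      moreover have "wp set_leaf (\<lambda>t s2. t \<le> 70 * floor_log (n + i) + 70 \<and>
          tournament (num ?s KEY) (idx s2 TREE) n \<and>
          (\<forall>j\<ge>n. idx s2 TREE j = (if j = n + i then idx ?s VAL 0 else idx ?s TREE j)) \<and>
          idx_kept {TREE, CUR} ?s s2 \<and> num s2 = num ?s) ?s"
        by (rule wp_set_leaf) (use 3 in \<open>auto simp: Inv2_def\<close>)
      ultimately have "wp set_leaf (\<lambda>t s2. t \<le> 70 * floor_log (2 * n) + 70 \<and> idx s2 CI 0 = i \<and>
          Inv2 (Suc i) (iupd CI 0 (Suc i) s2)) ?s"
      proof (elim wp_mono, goal_cases)
        case (1 t s2)
        then show ?case using 3 unfolding Inv2_def by (auto simp: less_Suc_eq)
      qed
      then show ?case by (auto simp: LV 3(3) elim!: wp_mono)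
    next
      case (4 t s')
      have "t \<le> n * (70 * floor_log (2 * n) + 114) + 14" using 4(3) by (simp add: algebra_simps)
      moreover have "t1 \<le> n * 54 + 14" using one(3) by (simp add: algebra_simps)
      moreover have "4 \<le> 4 * n" by (simp add: n_def)
      ultimately show ?case using 4(1) by (simp add: Inv2_def algebra_simps)
    qed
  qed
qed

end

section \<open>The order of the elements along the interval\<close>

text \<open>If the slope of \<open>e\<close> were at most that of \<open>f\<close>, then \<open>f\<close> could overtake \<open>e\<close> only if both
  weights agreed at \<open>x\<close> and at \<open>x'\<close>, and then the indices decide in the same way at both points.\<close>

lemma before_flip:
  assumes "before \<alpha> \<beta> x e f" "before \<alpha> \<beta> x' f e" "x < x'"
  shows "\<beta> f < \<beta> e" "x \<le> cross \<alpha> \<beta> e f" "cross \<alpha> \<beta> e f \<le> x'"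
proof -
  have le: "\<alpha> e + x * \<beta> e \<le> \<alpha> f + x * \<beta> f" "\<alpha> f + x' * \<beta> f \<le> \<alpha> e + x' * \<beta> e"
    using assms(1,2) by (auto simp: before_def)
  show lt: "\<beta> f < \<beta> e"
  proof (rule ccontr)
    assume "\<not> ?thesis"
    then have "x * (\<beta> f - \<beta> e) \<le> x' * (\<beta> f - \<beta> e)" using assms(3) by (intro mult_right_mono) auto
    then have "\<alpha> e + x * \<beta> e = \<alpha> f + x * \<beta> f" "\<alpha> f + x' * \<beta> f = \<alpha> e + x' * \<beta> e"
      using le by (auto simp: algebra_simps)
    then show False using assms(1,2) by (auto simp: before_def)
  qed
  then have p: "0 < \<beta> e - \<beta> f" by simp
  show "x \<le> cross \<alpha> \<beta> e f" "cross \<alpha> \<beta> e f \<le> x'"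
    unfolding cross_def pos_le_divide_eq[OF p] pos_divide_le_eq[OF p] using le by (auto simp: algebra_simps)
qed

lemma cross_equal:
  assumes "\<beta> f < \<beta> e"
  shows "\<alpha> e + cross \<alpha> \<beta> e f * \<beta> e = \<alpha> f + cross \<alpha> \<beta> e f * \<beta> f"
proof -
  have "cross \<alpha> \<beta> e f * (\<beta> e - \<beta> f) = \<alpha> f - \<alpha> e" using assms by (simp add: cross_def)
  then show ?thesis by (simp add: algebra_simps)
qed

lemma before_cross_iff:
  assumes "\<beta> f < \<beta> e"
  shows "x < cross \<alpha> \<beta> e f \<Longrightarrow> before \<alpha> \<beta> x e f" "cross \<alpha> \<beta> e f < x \<Longrightarrow> before \<alpha> \<beta> x f e"
proof -
  have p: "0 < \<beta> e - \<beta> f" using assms by simp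
  show "x < cross \<alpha> \<beta> e f \<Longrightarrow> before \<alpha> \<beta> x e f" "cross \<alpha> \<beta> e f < x \<Longrightarrow> before \<alpha> \<beta> x f e"
    unfolding cross_def pos_less_divide_eq[OF p] pos_divide_less_eq[OF p] before_def by (auto simp: algebra_simps)
qed

lemma inside_ivl: "inside lc lo uc hi x \<Longrightarrow> x \<in> ivl (decode_bound lc lo) (decode_bound uc hi)"
  by (simp add: inside_def ivl_def above_greater below_less)

locale interdiction_sweep = parametric_matroid m F a b I
  for m :: nat and F :: "nat set set" and a b :: "nat \<Rightarrow> rat" and I :: "real set" +
  fixes l u :: bound and d :: nat
  assumes I_ivl: "I = ivl l u" and rank_pos: "1 \<le> matroid_rank F"

sublocale interdiction_sweep \<subseteq> matroid_machine m F d ..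

context interdiction_sweep
begin

text \<open>The coefficients as they are stored in the input arrays, that is, extended by 0.\<close>

definition \<alpha> :: "nat \<Rightarrow> real" where "\<alpha> i = (if i < m then of_rat (a i) else 0)"
definition \<beta> :: "nat \<Rightarrow> real" where "\<beta> i = (if i < m then of_rat (b i) else 0)"

abbreviation "prec \<equiv> before \<alpha> \<beta>"

lemma weight_eq: "e < m \<Longrightarrow> weight a b x e = \<alpha> e + x * \<beta> e"
  by (simp add: weight_def \<alpha>_def \<beta>_def)

lemma sum_weight_eq: "S \<subseteq> {..<m} \<Longrightarrow> sum (weight a b x) S = sum \<alpha> S + x * sum \<beta> S"
  by (subst sum.cong[OF refl, of S _ "\<lambda>e. \<alpha> e + x * \<beta> e"])
    (auto simp: weight_eq sum.distrib sum_distrib_left)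

lemma interdiction_value_eq:
  assumes "min_weight_basis (restriction F ({..<m} - {g})) (weight a b x) B"
  shows "interdiction_value m F a b g x = sum (weight a b x) B"
proof -
  let ?M = "min_weight_basis (restriction F ({..<m} - {g})) (weight a b x)"
  have "?M (SOME B. ?M B)" using assms by (rule someI)
  then have "sum (weight a b x) (SOME B. ?M B) = sum (weight a b x) B"
    using assms unfolding min_weight_basis_def by (intro antisym) auto
  then show ?thesis unfolding interdiction_value_def Let_def .
qed

text \<open>The optimal basis of the matroid without \<open>g\<close> is \<open>B\<close> or \<open>B - g + r\<close>.\<close>

lemma entry_value:
  assumes opt: "exchange_optimal (prec x) B" and E: "entry_set (prec x) B E"
    and w: "\<And>e f. e < m \<Longrightarrow> f < m \<Longrightarrow> prec x e f \<Longrightarrow> weight a b y e \<le> weight a b y f"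
  shows "(g, r) \<in> E \<Longrightarrow> interdiction_value m F a b g y =
      sum \<alpha> B + gain \<alpha> (g, r) + y * (sum \<beta> B + gain \<beta> (g, r))"
    and "g < m \<Longrightarrow> g \<notin> B \<Longrightarrow> interdiction_value m F a b g y = sum \<alpha> B + y * sum \<beta> B"
proof -
  interpret D: matroid "{..<m} - {g}" "restriction F ({..<m} - {g})" for g
    using restriction_matroid[of "{..<m} - {g}"] by (simp add: Int_absorb2 Diff_subset)
  note B = exchange_optimalD[OF opt]
  have min: "D.exchange_optimal g (prec x) A \<Longrightarrow> interdiction_value m F a b g y = sum (weight a b y) A" for g A
    by (rule interdiction_value_eq[OF D.exchange_optimal_min_weight[OF strict_linear_before]]) (auto intro: w)
  show out: "interdiction_value m F a b g y = sum \<alpha> B + y * sum \<beta> B" if "g < m" "g \<notin> B" for g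
    using min[OF exchange_optimal_delete_outside[OF opt that(2)]] sum_weight_eq[OF B(3)] by simp
  show "interdiction_value m F a b g y = sum \<alpha> B + gain \<alpha> (g, r) + y * (sum \<beta> B + gain \<beta> (g, r))"
    if gr: "(g, r) \<in> E"
    using entry_setD(3)[OF E gr]
  proof (elim disjE conjE)
    assume "g = r" "g < m" "g \<notin> B"
    then show ?thesis using out by (simp add: gain_def)
  next
    assume g: "g \<in> B" "is_replacement (prec x) B g r"
    have r: "r < m" "r \<notin> B" using is_replacement_ground[OF g(2)] g(2) by (auto simp: is_replacement_def)
    have "interdiction_value m F a b g y = sum (weight a b y) (insert r (B - {g}))"
      by (rule min[OF exchange_optimal_delete[OF strict_linear_before opt g]])
    also have "\<dots> = sum \<alpha> (insert r (B - {g})) + y * sum \<beta> (insert r (B - {g}))"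
      using B(3) r by (intro sum_weight_eq) auto
    also have "\<dots> = sum \<alpha> B + gain \<alpha> (g, r) + y * (sum \<beta> B + gain \<beta> (g, r))"
      using B(4) g r by (simp add: sum_diff1 gain_def algebra_simps)
    finally show ?thesis .
  qed
qed

text \<open>By \<open>entry_value\<close> each interdiction value is the line of some entry and each entry is the line
  of its first component, so a maximal entry names a most vital element.\<close>

lemma best_entry_correct:
  assumes opt: "exchange_optimal (prec x) B" and E: "entry_set (prec x) B E"
    and w: "\<And>e f. e < m \<Longrightarrow> f < m \<Longrightarrow> prec x e f \<Longrightarrow> weight a b y e \<le> weight a b y f"
    and gr: "(g, r) \<in> E"
    and best: "\<And>q. q \<in> E \<Longrightarrow> gain \<alpha> q + y * gain \<beta> q \<le> gain \<alpha> (g, r) + y * gain \<beta> (g, r)"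
  shows "most_vital m F a b y g \<and>
    optimal_value m F a b y = sum \<alpha> B + gain \<alpha> (g, r) + y * (sum \<beta> B + gain \<beta> (g, r))"
proof -
  let ?v = "interdiction_value m F a b"
  have val1: "?v g y = sum \<alpha> B + gain \<alpha> (g, r) + y * (sum \<beta> B + gain \<beta> (g, r))" if "(g, r) \<in> E" for g r
    by (rule entry_value(1)[OF opt E _ that]) (rule w)
  have val2: "?v g y = sum \<alpha> B + y * sum \<beta> B" if "g < m" "g \<notin> B" for g
    by (rule entry_value(2)[OF opt E _ that]) (rule w)
  have le: "?v h y \<le> ?v g y" if h: "h < m" for h
  proof -
    obtain q where q: "q \<in> E" "?v h y = sum \<alpha> B + gain \<alpha> q + y * (sum \<beta> B + gain \<beta> q)"
    proof (cases "h \<in> B")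
      case True
      then obtain r' where "(h, r') \<in> E" using entry_setD(2)[OF E] by blast
      then show ?thesis using that[of "(h, r')"] val1 by blast
    next
      case False
      obtain h' where "(h', h') \<in> E" using entry_setD(1)[OF E] by blast
      then show ?thesis using that[of "(h', h')"] val2[OF h False] by (simp add: gain_def)
    qed
    then show ?thesis using best[OF q(1)] val1[OF gr] by (simp add: algebra_simps)
  qed
  have g: "g < m" using entry_setD(3)[OF E gr] exchange_optimalD(3)[OF opt] by auto
  then have "most_vital m F a b y g" using le by (auto simp: most_vital_def)
  moreover have "optimal_value m F a b y = ?v g y"
    unfolding optimal_value_def using le g by (intro Max_eqI) auto
  ultimately show ?thesis using val1[OF gr] by simp
qed

abbreviation inside_I :: "real \<Rightarrow> bool" where
  "inside_I \<equiv> inside (bound_code l) (bound_val l) (bound_code u) (bound_val u)"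

definition events :: "(nat \<times> nat) set" where
  "events = overtakings m \<alpha> \<beta> (bound_code l) (bound_val l) (bound_code u) (bound_val u)"

lemma events_iff: "(e, f) \<in> events \<longleftrightarrow> e < m \<and> f < m \<and> \<beta> f < \<beta> e \<and> inside_I (cross \<alpha> \<beta> e f)"
  by (simp add: events_def overtakings_def)

lemma finite_events: "finite events" "card events \<le> m * m"
proof -
  have sub: "events \<subseteq> {..<m} \<times> {..<m}" by (auto simp: events_iff)
  then show "finite events" by (rule finite_subset) simp
  have "card events \<le> card ({..<m} \<times> {..<m})" by (rule card_mono[OF _ sub]) simp
  then show "card events \<le> m * m" by (simp add: card_cartesian_product)
qed

lemma events_distinct:
  assumes ef: "(e, f) \<in> events" and gh: "(g, h) \<in> events" and eq: "cross \<alpha> \<beta> e f = cross \<alpha> \<beta> g h"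
  shows "(e, f) = (g, h)"
proof -
  let ?x = "cross \<alpha> \<beta> e f"
  have ep: "equality_point a b e f (cross \<alpha> \<beta> e f)" if "(e, f) \<in> events" for e f
    using that cross_equal[of \<beta> f e \<alpha>] by (auto simp: events_iff equality_point_def weight_eq \<beta>_def of_rat_less)
  have "?x \<in> I"
    using inside_ivl[of "bound_code l" "bound_val l" "bound_code u" "bound_val u" ?x] ef I_ivl
    by (simp add: events_iff)
  then have "{e, f} = {g, h}"
    using distinct_equality_points[of e f g h ?x] ep[OF ef] ep[OF gh] ef gh eq by (auto simp: events_iff)
  then show ?thesis using ef gh by (auto simp: events_iff doubleton_eq_iff)
qed

text \<open>A part of the interval without events in its interior; its ends may be events.\<close>

definition cell :: "nat \<Rightarrow> real \<Rightarrow> nat \<Rightarrow> real \<Rightarrow> bool" where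
  "cell lc lo uc hi \<longleftrightarrow> (\<forall>x. inside lc lo uc hi x \<longrightarrow> inside_I x) \<and>
     (\<forall>(e, f)\<in>events. \<not> inside lc lo uc hi (cross \<alpha> \<beta> e f))"

text \<open>The order at one interior point is compatible with the weights on the whole cell, including
  its ends: a strict violation at \<open>y\<close> would need a crossing between \<open>x\<close> and \<open>y\<close> and different from \<open>y\<close>. If the
  cell is a single point, the order at this point itself is taken.\<close>

lemma cell_order:
  assumes c: "cell lc lo uc hi" and x: "inside lc lo uc hi x \<or> x = y"
    and y: "y \<in> ivl (decode_bound lc lo) (decode_bound uc hi)"
    and ef: "e < m" "f < m" "prec x e f"
  shows "weight a b y e \<le> weight a b y f"
proof (rule ccontr)
  assume "\<not> ?thesis"
  then have lt: "\<alpha> f + y * \<beta> f < \<alpha> e + y * \<beta> e" using ef by (simp add: weight_eq)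
  then have yfe: "prec y f e" by (simp add: before_def)
  have "x \<noteq> y" using lt ef(3) by (auto simp: before_def)
  then have inx: "inside lc lo uc hi x" using x by simp
  have yb: "lc = 0 \<or> lo \<le> y" "uc = 0 \<or> y \<le> hi"
    using y above_lower below_upper by (auto simp: ivl_def)
  have no: "False" if "g < m" "h < m" "\<beta> h < \<beta> g" "inside lc lo uc hi (cross \<alpha> \<beta> g h)" for g h
    using c that by (auto simp: cell_def events_iff)
  show False
  proof (cases "x < y")
    case True
    note fl = before_flip[OF ef(3) yfe True]
    have "cross \<alpha> \<beta> e f \<noteq> y" using cross_equal[OF fl(1), of \<alpha>] lt by auto
    then show False using no[of e f] fl inx yb ef by (auto simp: inside_def)
  next
    case False
    then have "y < x" using \<open>x \<noteq> y\<close> by simp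
    note fl = before_flip[OF yfe ef(3) this]
    have "cross \<alpha> \<beta> f e \<noteq> y" using cross_equal[OF fl(1), of \<alpha>] lt by auto
    then show False using no[of f e] fl inx yb ef by (auto simp: inside_def)
  qed
qed

text \<open>Any other pair that changes its order between the two cells has a crossing in between, which
  can only be the common end \<open>c\<close> of the cells. But distinct pairs have distinct equality points.\<close>

lemma cell_transposed:
  assumes old: "cell lc lo 2 c" "inside lc lo 2 c x" and new: "cell 1 c uc hi" "inside 1 c uc hi x'"
    and ef: "(e, f) \<in> events" "cross \<alpha> \<beta> e f = c"
  shows "transposed (prec x) (prec x') e f"
proof -
  have xx: "x < c" "c < x'" using old(2) new(2) by (auto simp: inside_def)
  have ein: "e < m" "f < m" "\<beta> f < \<beta> e" using ef by (auto simp: events_iff)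
  have "prec x' g h" if g: "g < m" "h < m" "{g, h} \<noteq> {e, f}" "prec x g h" for g h
  proof (rule ccontr)
    assume "\<not> ?thesis"
    then have "prec x' h g"
      using strict_linear.total[OF strict_linear_before, of g h] strict_linear.irrefl[OF strict_linear_before] g(4)
      by metis
    note fl = before_flip[OF g(4) this]
    let ?z = "cross \<alpha> \<beta> g h"
    have z: "\<beta> h < \<beta> g" "x \<le> ?z" "?z \<le> x'" using fl xx by auto
    have "inside_I x" "inside_I x'" using old new by (auto simp: cell_def)
    then have "inside_I ?z" using z by (auto simp: inside_def)
    then have gh: "(g, h) \<in> events" using g z by (simp add: events_iff)
    have "\<not> inside lc lo 2 c ?z" "\<not> inside 1 c uc hi ?z" using old new gh by (auto simp: cell_def)
    then have "?z = c" using z old(2) new(2) by (auto simp: inside_def)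
    then have "(g, h) = (e, f)" using events_distinct[OF gh ef(1)] ef(2) by simp
    then show False using g(3) by simp
  qed
  then show ?thesis
    unfolding transposed_def using ein before_cross_iff[where \<alpha> = \<alpha>, OF ein(3)] ef(2) xx by auto
qed

lemma m_ge_2: "2 \<le> m"
proof (rule ccontr)
  assume "\<not> ?thesis"
  then have "m \<le> 1" by simp
  obtain B where B: "is_basis F B" using ex_basis by blast
  have "card B \<noteq> 0" "B \<subseteq> {..<m}"
    using rank_eq_card_basis[OF B] rank_pos indep_subset_ground[OF basis_indep[OF B]] by auto
  then have m1: "m = 1" using \<open>m \<le> 1\<close> by (cases m) auto
  then obtain C where C: "is_basis (restriction F ({..<m} - {0})) C" "card C = matroid_rank F"
    using deletion_rank[of 0] by auto
  then have "C \<subseteq> {..<m} - {0}" by (auto simp: is_basis_def restriction_def)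
  then have "C = {}" using m1 by auto
  then show False using C(2) rank_pos by simp
qed

lemma ex_replacement:
  assumes B: "is_basis F B" and g: "g \<in> B"
  shows "\<exists>j. j \<notin> B \<and> insert j (B - {g}) \<in> F"
proof -
  have BF: "B \<in> F" "B \<subseteq> {..<m}" "finite B"
    using basis_indep[OF B] indep_subset_ground finite_indep by auto
  obtain C where C: "is_basis (restriction F ({..<m} - {g})) C" "card C = matroid_rank F"
    using deletion_rank[of g] g BF by auto
  then have CF: "C \<in> F" "g \<notin> C" by (auto simp: is_basis_def restriction_def)
  have "B - {g} \<in> F" by (rule indep_mono[OF BF(1)]) auto
  moreover have "card (B - {g}) < card C"
    using C(2) rank_eq_card_basis[OF B] BF g by (metis card_Diff1_less)
  ultimately obtain j where "j \<in> C - (B - {g})" "insert j (B - {g}) \<in> F"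
    using indep_augment[OF _ CF(1)] by blast
  then show ?thesis using CF(2) by (intro exI[of _ j]) auto
qed

lemma ex_outside:
  assumes B: "is_basis F B"
  shows "\<exists>h<m. h \<notin> B"
proof -
  have "card B \<noteq> 0" using rank_eq_card_basis[OF B] rank_pos by simp
  then obtain g where "g \<in> B" by fastforce
  then obtain j where "j \<notin> B" "insert j (B - {g}) \<in> F" using ex_replacement[OF B] by blast
  then show ?thesis using indep_subset_ground by blast
qed

end

section \<open>The sweep\<close>

abbreviation next_id :: iexp where "next_id \<equiv> IRead TREE (IConst 1)"

definition next_bound :: com where
  "next_bound = rset CU (RRead KEY next_id) ;;
     If (ILess (IConst 0) next_id) (iset EK (IConst 2)) (iset EK ukind)"

text \<open>Some point in the interior of the first cell, or the only point of a cell that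
  is a single point.\<close>

definition sample_point :: com where
  "sample_point =
     If (IZero (ivar SK))
       (If (IZero (ivar EK)) (rset X0 (RConst 0)) (rset X0 (RSub (rvar CU) (RConst 1))))
       (If (IZero (ivar EK)) (rset X0 (RAdd (rvar CL) (RConst 1)))
         (rset X0 (RDiv (RAdd (rvar CL) (rvar CU)) (RConst 2))))"

definition advance :: com where
  "advance = iset EE (IRead EVE next_id) ;; iset FF (IRead EVF next_id) ;; rset CL (RRead KEY next_id) ;;
     iset SK (IConst 1) ;; iset CUR (IAdd (ivar LV) next_id) ;; iset VAL (IConst 0) ;; set_leaf ;; update"

abbreviation nonempty_interval :: bexp where
  "nonempty_interval \<equiv> BOr (IZero lkind) (BOr (IZero ukind) (BOr (RLess lbnd ubnd)
     (BAnd (BNot (RLess ubnd lbnd)) (BAnd (IEq lkind (IConst 1)) (IEq ukind (IConst 1))))))"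

definition sweep :: com where
  "sweep = If nonempty_interval
     (build_events ;; build_tree ;; iset SK lkind ;; rset CL lbnd ;; next_bound ;; sample_point ;;
      greedy_basis ;; build_entries ;; emit_cell ;;
      While (ILess (IConst 0) next_id) (advance ;; next_bound ;; emit_cell))
     Skip"

lemma ivl_nonempty_iff:
  "ivl l u \<noteq> {} \<longleftrightarrow> bound_code l = 0 \<or> bound_code u = 0 \<or> bound_val l < bound_val u \<or>
     bound_val l = bound_val u \<and> bound_code l = 1 \<and> bound_code u = 1"
proof
  assume "ivl l u \<noteq> {}"
  then obtain x where "above l x" "below u x" by (auto simp: ivl_def)
  then show "bound_code l = 0 \<or> bound_code u = 0 \<or> bound_val l < bound_val u \<or>
     bound_val l = bound_val u \<and> bound_code l = 1 \<and> bound_code u = 1"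
    by (cases l; cases u) auto
next
  assume *: "bound_code l = 0 \<or> bound_code u = 0 \<or> bound_val l < bound_val u \<or>
     bound_val l = bound_val u \<and> bound_code l = 1 \<and> bound_code u = 1"
  have "\<exists>x. (bound_code l = 0 \<or> bound_val l < x) \<and> (bound_code u = 0 \<or> x < bound_val u)"
    if "\<not> (bound_val l = bound_val u \<and> bound_code l = 1 \<and> bound_code u = 1)"
    using * that dense[of "bound_val l" "bound_val u"] lt_ex[of "bound_val u"] gt_ex[of "bound_val l"] by auto
  then consider x where "inside (bound_code l) (bound_val l) (bound_code u) (bound_val u) x"
    | "bound_val l = bound_val u" "bound_code l = 1" "bound_code u = 1"
    by (auto simp: inside_def)
  then show "ivl l u \<noteq> {}"
  proof cases
    case 1
    then show ?thesis using inside_ivl by fastforce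
  next
    case 2
    then show ?thesis by (cases l; cases u) (auto simp: ivl_def)
  qed
qed

context interdiction_sweep
begin

definition correct_piece :: "real \<Rightarrow> nat \<Rightarrow> real \<Rightarrow> bool" where
  "correct_piece x e y \<longleftrightarrow> most_vital m F a b x e \<and> optimal_value m F a b x = y"

lemma correct_output_iff: "correct_output m F a b I s \<longleftrightarrow> output_ok correct_piece s I"
  by (simp add: correct_output_def output_ok_def correct_piece_def)

definition prepared :: "state \<Rightarrow> nat \<Rightarrow> bool" where
  "prepared s n \<longleftrightarrow> idx s 0 = idx (input_state m a b l u) 0 \<and> num s 0 = num (input_state m a b l u) 0 \<and>
     num s 1 = \<alpha> \<and> num s 2 = \<beta> \<and> idx s LV 0 = n \<and> n = Suc (idx s NEV 0) \<and>
     (\<forall>j<2 * n. idx s HALF j = j div 2) \<and> num s KEY 0 = bound_val u \<and> lists_events s events"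

lemma prepared_cong:
  assumes "prepared s n" "\<forall>r\<in>{0, LV, NEV, HALF, EVE, EVF}. idx s' r = idx s r" "\<forall>r\<in>{0, 1, 2, KEY}. num s' r = num s r"
  shows "prepared s' n"
proof -
  have "lists_events s' events = lists_events s events"
    using assms(2,3) by (simp add: lists_events_def entry_def[abs_def])
  then show ?thesis using assms by (simp add: prepared_def)
qed

lemma input_simps:
  "idx (input_state m a b l u) 0 0 = m" "idx (input_state m a b l u) 0 (Suc 0) = bound_code l"
  "idx (input_state m a b l u) 0 2 = bound_code u" "num (input_state m a b l u) 0 0 = bound_val l"
  "num (input_state m a b l u) 0 (Suc 0) = bound_val u"
  "num (input_state m a b l u) (Suc 0) = \<alpha>" "num (input_state m a b l u) 2 = \<beta>"
  "r \<noteq> 0 \<Longrightarrow> idx (input_state m a b l u) r = (\<lambda>_. 0)"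
  by (auto simp: input_state_def \<alpha>_def \<beta>_def fun_eq_iff)

lemma prepared_simps:
  assumes "prepared s n"
  shows "idx s 0 0 = m" "idx s 0 (Suc 0) = bound_code l" "idx s 0 2 = bound_code u" "num s 0 0 = bound_val l"
    "num s 0 (Suc 0) = bound_val u" "num s (Suc 0) = \<alpha>" "num s 2 = \<beta>" "idx s LV 0 = n" "num s KEY 0 = bound_val u"
  using assms by (simp_all add: prepared_def input_simps)

lemma prepared_events:
  assumes "prepared s n"
  shows "i \<in> {1..<n} \<Longrightarrow> entry s EVE EVF i \<in> events"
    and "i \<in> {1..<n} \<Longrightarrow> num s KEY i = cross \<alpha> \<beta> (idx s EVE i) (idx s EVF i)"
    and "i \<in> {1..<n} \<Longrightarrow> inside_I (num s KEY i)"
    and "p \<in> events \<Longrightarrow> \<exists>i\<in>{1..<n}. p = entry s EVE EVF i \<and> cross \<alpha> \<beta> (fst p) (snd p) = num s KEY i"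
    and "i \<in> {1..<n} \<Longrightarrow> j \<in> {1..<n} \<Longrightarrow> num s KEY i = num s KEY j \<Longrightarrow> i = j"
    and "n = Suc (card events)"
proof -
  have N: "{1..idx s NEV 0} = {1..<n}" using assms by (auto simp: prepared_def)
  have ab: "num s 1 = \<alpha>" "num s 2 = \<beta>" using assms by (simp_all add: prepared_def)
  have L: "lists_events s events" using assms by (simp add: prepared_def)
  have L: "entry s EVE EVF ` {1..<n} = events" "inj_on (entry s EVE EVF) {1..<n}"
    "\<forall>i\<in>{1..<n}. num s KEY i = cross \<alpha> \<beta> (idx s EVE i) (idx s EVF i)"
    using L[unfolded lists_events_def Let_def N ab] by - (elim conjE, assumption)+
  show ev: "i \<in> {1..<n} \<Longrightarrow> entry s EVE EVF i \<in> events" for i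
    unfolding L(1)[symmetric] by (rule imageI)
  show key: "i \<in> {1..<n} \<Longrightarrow> num s KEY i = cross \<alpha> \<beta> (idx s EVE i) (idx s EVF i)" for i using L(3) by blast
  show "i \<in> {1..<n} \<Longrightarrow> inside_I (num s KEY i)"
    using ev[of i] key[of i] by (simp add: entry_def events_iff)
  show "\<exists>i\<in>{1..<n}. p = entry s EVE EVF i \<and> cross \<alpha> \<beta> (fst p) (snd p) = num s KEY i" if pe: "p \<in> events"
  proof -
    obtain i where "i \<in> {1..<n}" "p = entry s EVE EVF i" using pe unfolding L(1)[symmetric] by blast
    then show ?thesis using key[of i] by (auto simp: entry_def)
  qed
  show "i = j" if "i \<in> {1..<n}" "j \<in> {1..<n}" "num s KEY i = num s KEY j"
  proof -
    have "entry s EVE EVF i = entry s EVE EVF j"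
      using events_distinct[of "idx s EVE i" "idx s EVF i" "idx s EVE j" "idx s EVF j"] ev[OF that(1)] ev[OF that(2)]
        key[OF that(1)] key[OF that(2)] that(3) by (simp add: entry_def)
    then show ?thesis using inj_onD[OF L(2)] that by blast
  qed
  have "card events = card {1..<n}" unfolding L(1)[symmetric] by (rule card_image[OF L(2)])
  then show "n = Suc (card events)" using assms by (simp add: prepared_def)
qed

text \<open>\<open>A\<close> is the set of events that are still to come.\<close>

definition queue :: "state \<Rightarrow> nat \<Rightarrow> nat set \<Rightarrow> bool" where
  "queue s n A \<longleftrightarrow> A \<subseteq> {1..<n} \<and> tournament (num s KEY) (idx s TREE) n \<and>
     (\<forall>i<n. idx s TREE (n + i) = (if i \<in> A then i else 0))"

lemma queue_root:
  assumes Q: "queue s n A" and n: "0 < n"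
  shows "A = {} \<Longrightarrow> idx s TREE (Suc 0) = 0"
    and "A \<noteq> {} \<Longrightarrow> idx s TREE (Suc 0) \<in> A"
    and "i \<in> A \<Longrightarrow> num s KEY (idx s TREE (Suc 0)) \<le> num s KEY i"
proof -
  have T: "tournament (num s KEY) (idx s TREE) n" and A: "A \<subseteq> {1..<n}"
    and lf: "\<And>i. i < n \<Longrightarrow> idx s TREE (n + i) = (if i \<in> A then i else 0)" using Q by (auto simp: queue_def)
  obtain j where j: "n \<le> j" "j < 2 * n" "idx s TREE 1 = idx s TREE j"
    using tournament_root_leaf[OF T, of 1] n by auto
  have "j - n < n" "n + (j - n) = j" using j by auto
  then have root: "idx s TREE (Suc 0) = (if j - n \<in> A then j - n else 0)" using lf[of "j - n"] j(3) by simp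
  then show "A = {} \<Longrightarrow> idx s TREE (Suc 0) = 0" by simp
  have min: "idx s TREE (Suc 0) \<in> A \<and> num s KEY (idx s TREE (Suc 0)) \<le> num s KEY i" if i: "i \<in> A" for i
  proof -
    have "i < n" "i \<noteq> 0" using A i by auto
    then have le: "event_time (num s KEY) (idx s TREE (Suc 0)) \<le> event_time (num s KEY) i"
      using tournament_root_minimal[OF T, of "n + i"] lf[of i] i by simp
    have "idx s TREE (Suc 0) \<noteq> 0"
    proof
      assume "idx s TREE (Suc 0) = 0"
      then show False using le \<open>i \<noteq> 0\<close> by (simp add: event_time_def)
    qed
    then show ?thesis using root le \<open>i \<noteq> 0\<close> by (auto simp: event_time_def split: if_splits)
  qed
  then show "A \<noteq> {} \<Longrightarrow> idx s TREE (Suc 0) \<in> A" by blast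
  show "i \<in> A \<Longrightarrow> num s KEY (idx s TREE (Suc 0)) \<le> num s KEY i" using min by blast
qed

lemma optimal_state_cong:
  assumes "optimal_state P s q" "\<forall>r\<in>{BAS, LEN, LG, LR, MK}. idx s' r = idx s r" "\<forall>r\<in>{1, 2, WA, WB}. num s' r = num s r"
  shows "optimal_state P s' q"
  using assms by (simp add: optimal_state_def sorted_entries_def entry_def[abs_def])

lemma wp_emit_optimal:
  fixes s :: state
  defines "X \<equiv> ivl (decode_bound (idx s SK 0) (num s CL 0)) (decode_bound (idx s EK 0) (num s CU 0))"
  assumes s: "prepared s n" and opt: "optimal_state (prec x) s q" and q: "0 < q" and X: "X \<noteq> {}"
    and c: "cell (idx s SK 0) (num s CL 0) (idx s EK 0) (num s CU 0)"
    and x: "\<And>y. y \<in> X \<Longrightarrow> inside (idx s SK 0) (num s CL 0) (idx s EK 0) (num s CU 0) x \<or> x = y"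
    and out: "output_ok correct_piece s R" "R \<inter> X = {}"
  shows "wp emit_cell (\<lambda>t s'. t \<le> 600 * q + 100 \<and> output_ok correct_piece s' (R \<union> X) \<and>
     idx_kept {1, 2, 3, 4, SK, KI, SG, SR, SN, LI} s s' \<and>
     num_kept {3, 4, 5, 6, PB, TMP} s s') s"
proof -
  obtain E where E: "sorted_entries s q E" "entry_set (prec x) (support (idx s BAS)) E"
    and B: "exchange_optimal (prec x) (support (idx s BAS))"
    and W: "num s WA 0 = sum \<alpha> (support (idx s BAS))" "num s WB 0 = sum \<beta> (support (idx s BAS))"
    using opt prepared_simps[OF s] by (auto simp: optimal_state_def)
  have ab: "num s 1 = \<alpha>" "num s 2 = \<beta>" using s by (simp_all add: prepared_def)
  show ?thesis
  proof (rule wp_emit_cell[OF X_def[THEN meta_eq_to_obj_eq] X E(1) q out], goal_cases)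
    case (1 y g r)
    have "most_vital m F a b y g \<and> optimal_value m F a b y =
        sum \<alpha> (support (idx s BAS)) + gain \<alpha> (g, r) + y * (sum \<beta> (support (idx s BAS)) + gain \<beta> (g, r))"
    proof (rule best_entry_correct[OF B E(2) _ 1(2)])
      show "weight a b y e \<le> weight a b y f" if "e < m" "f < m" "prec x e f" for e f
        using cell_order[OF c x[OF 1(1)] 1(1)[unfolded X_def] that] .
      show "gain \<alpha> q + y * gain \<beta> q \<le> gain \<alpha> (g, r) + y * gain \<beta> (g, r)" if "q \<in> E" for q
        using 1(3)[OF that] unfolding ab .
    qed
    then show ?case unfolding correct_piece_def ab W .
  qed
qed

definition next_kind :: "nat set \<Rightarrow> nat" where
  "next_kind A = (if A = {} then bound_code u else 2)"

lemma wp_next_bound: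
  assumes "prepared s n" "queue s n A"
  shows "wp next_bound (\<lambda>t s'. t \<le> 30 \<and>
     s' = iupd EK 0 (next_kind A) (rupd CU 0 (num s KEY (idx s TREE (Suc 0))) s)) s"
proof -
  have n: "0 < n" using assms(1) by (simp add: prepared_def)
  note r = queue_root[OF assms(2) n]
  have A: "A \<subseteq> {1..<n}" using assms(2) by (simp add: queue_def)
  show ?thesis
  proof (cases "A = {}")
    case True
    then show ?thesis using r(1) prepared_simps[OF assms(1)] by (simp add: next_bound_def next_kind_def)
  next
    case False
    then have "0 < idx s TREE (Suc 0)" using r(2) A by auto
    then show ?thesis using False by (simp add: next_bound_def next_kind_def)
  qed
qed

text \<open>No event lies strictly between the last event and the minimum of the queue.\<close>

lemma next_cell:
  assumes s: "prepared s n" and Q: "queue s n A" and low: "lc = 0 \<or> (\<forall>x. lo < x \<longrightarrow> bound_code l = 0 \<or> bound_val l < x)"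
    "lc = 0 \<longrightarrow> bound_code l = 0"
    and seen: "\<And>i. i \<in> {1..<n} - A \<Longrightarrow> lc \<noteq> 0 \<and> num s KEY i \<le> lo"
  shows "cell lc lo (next_kind A) (num s KEY (idx s TREE (Suc 0)))"
  unfolding cell_def
proof (intro conjI allI impI ballI)
  let ?c = "num s KEY (idx s TREE (Suc 0))"
  have n: "0 < n" using s by (simp add: prepared_def)
  note r = queue_root[OF Q n]
  have A: "A \<subseteq> {1..<n}" using Q by (simp add: queue_def)
  fix x assume x: "inside lc lo (next_kind A) ?c x"
  have "bound_code u = 0 \<or> x < bound_val u"
  proof (cases "A = {}")
    case True
    then show ?thesis using x r(1) prepared_simps[OF s] by (auto simp: inside_def next_kind_def)
  next
    case False
    then have "inside_I ?c" using r(2) A prepared_events(3)[OF s] by blast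
    then show ?thesis using x False by (auto simp: inside_def next_kind_def)
  qed
  then show "inside_I x" using x low by (auto simp: inside_def)
next
  let ?c = "num s KEY (idx s TREE (Suc 0))"
  have n: "0 < n" using s by (simp add: prepared_def)
  fix p assume "p \<in> events"
  then obtain i where i: "i \<in> {1..<n}" "cross \<alpha> \<beta> (fst p) (snd p) = num s KEY i"
    using prepared_events(4)[OF s] by blast
  have "\<not> inside lc lo (next_kind A) ?c (num s KEY i)"
    using seen[of i] queue_root(3)[OF Q n, of i] i(1) by (cases "i \<in> A") (auto simp: inside_def next_kind_def)
  then show "case p of (e, f) \<Rightarrow> \<not> inside lc lo (next_kind A) ?c (cross \<alpha> \<beta> e f)"
    using i(2) by (simp add: case_prod_beta)
qed

text \<open>The part of the interval for which pieces have been written once the cell that ends at the next event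
  has been processed.\<close>

definition swept :: "state \<Rightarrow> nat set \<Rightarrow> real set" where
  "swept s A = {y \<in> I. A \<noteq> {} \<longrightarrow> y < num s KEY (idx s TREE (Suc 0))}"

lemma mem_I: "y \<in> I \<longleftrightarrow> above l y \<and> below u y"
  by (simp add: I_ivl ivl_def)

lemma swept_step:
  assumes s: "prepared s n" and Q: "queue s n A" and c: "inside_I c"
  shows "{y \<in> I. y < c} \<inter> ivl (decode_bound 1 c) (decode_bound (next_kind A) (num s KEY (idx s TREE (Suc 0)))) = {}"
    and "next_kind A = 0 \<or> c < num s KEY (idx s TREE (Suc 0)) \<Longrightarrow>
      {y \<in> I. y < c} \<union> ivl (decode_bound 1 c) (decode_bound (next_kind A) (num s KEY (idx s TREE (Suc 0)))) = swept s A"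
proof -
  let ?c = "num s KEY (idx s TREE (Suc 0))"
  let ?X = "ivl (decode_bound 1 c) (decode_bound (next_kind A) ?c)"
  have n: "0 < n" using s by (simp add: prepared_def)
  note r = queue_root[OF Q n]
  have A: "A \<subseteq> {1..<n}" using Q by (simp add: queue_def)
  have ab: "above (decode_bound 1 c) y \<longleftrightarrow> c \<le> y" for y by (rule above_decode)
  show "{y \<in> I. y < c} \<inter> ?X = {}" unfolding ivl_def ab by auto
  assume lt: "next_kind A = 0 \<or> c < ?c"
  have al: "above l y" if "c \<le> y" for y
    using c that above_greater[of "bound_code l" "bound_val l" y] by (auto simp: inside_def)
  show "{y \<in> I. y < c} \<union> ?X = swept s A"
  proof (cases "A = {}")
    case True
    have "decode_bound (next_kind A) ?c = u" using True r(1) prepared_simps[OF s] by (simp add: next_kind_def)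
    then show ?thesis using True al unfolding swept_def ivl_def ab by (auto simp: mem_I)
  next
    case False
    have "inside_I ?c" using r(2)[OF False] A prepared_events(3)[OF s] by blast
    then have "below u y" if "y < ?c" for y
      using that below_less[of "bound_code u" y "bound_val u"] by (auto simp: inside_def)
    moreover have "below (decode_bound (next_kind A) ?c) y \<longleftrightarrow> y < ?c" for y
      using False by (simp add: next_kind_def below_decode)
    moreover have "c < ?c" using lt False by (simp add: next_kind_def)
    ultimately show ?thesis using False al unfolding swept_def ivl_def ab by (auto simp: mem_I)
  qed
qed

lemma swept_first:
  assumes s: "prepared s n" and Q: "queue s n A"
  shows "ivl (decode_bound (bound_code l) (bound_val l)) (decode_bound (next_kind A) (num s KEY (idx s TREE (Suc 0)))) = swept s A"
proof -
  let ?c = "num s KEY (idx s TREE (Suc 0))"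
  have n: "0 < n" using s by (simp add: prepared_def)
  note r = queue_root[OF Q n]
  have A: "A \<subseteq> {1..<n}" using Q by (simp add: queue_def)
  show ?thesis
  proof (cases "A = {}")
    case True
    have "decode_bound (next_kind A) ?c = u" using True r(1) prepared_simps[OF s] by (simp add: next_kind_def)
    then show ?thesis using True unfolding swept_def ivl_def by (simp add: mem_I)
  next
    case False
    have "inside_I ?c" using r(2)[OF False] A prepared_events(3)[OF s] by blast
    then have "below u y" if "y < ?c" for y
      using that below_less[of "bound_code u" y "bound_val u"] by (auto simp: inside_def)
    moreover have "below (decode_bound (next_kind A) ?c) y \<longleftrightarrow> y < ?c" for y
      using False by (simp add: next_kind_def below_decode)
    ultimately show ?thesis using False unfolding swept_def ivl_def by (auto simp: mem_I)
  qed
qed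

text \<open>The invariant of the main loop. The cell just processed and the sample point \<open>x\<close> whose order
  determines the current basis are not stored by the program.\<close>

definition sweep_state :: "nat \<Rightarrow> nat \<Rightarrow> nat \<Rightarrow> state \<Rightarrow> bool" where
  "sweep_state n q N s \<longleftrightarrow> prepared s n \<and> (\<exists>A. queue s n A \<and> card A = N \<and>
     (\<forall>i\<in>{1..<n} - A. \<forall>j\<in>A. num s KEY i \<le> num s KEY j) \<and>
     output_ok correct_piece s (swept s A) \<and>
     (A \<noteq> {} \<longrightarrow> (\<exists>lc lo x. cell lc lo 2 (num s KEY (idx s TREE (Suc 0))) \<and>
        inside lc lo 2 (num s KEY (idx s TREE (Suc 0))) x \<and> optimal_state (prec x) s q)))"

text \<open>The order of the new cell is the one at any of its interior points \<open>x'\<close>. It differs from the order of the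
  old cell by a transposition, so \<open>wp_update\<close> applies.\<close>

lemma wp_advance:
  assumes s: "prepared s n" and Q: "queue s n A" and A: "A \<noteq> {}"
    and order: "\<And>i j. i \<in> {1..<n} - A \<Longrightarrow> j \<in> A \<Longrightarrow> num s KEY i \<le> num s KEY j"
    and old: "cell lc lo 2 c" "inside lc lo 2 c x" "optimal_state (prec x) s q"
    and c: "c = num s KEY (idx s TREE (Suc 0))"
  shows "wp advance (\<lambda>t s'. t \<le> 70 * floor_log (2 * n) + q * (d + 300) + d + 600 \<and> prepared s' n \<and>
     (\<exists>A'. queue s' n A' \<and> Suc (card A') = card A \<and>
       (\<forall>i\<in>{1..<n} - A'. \<forall>j\<in>A'. num s' KEY i \<le> num s' KEY j) \<and>
       (let c' = num s' KEY (idx s' TREE (Suc 0)) in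
          cell 1 c (next_kind A') c' \<and> (next_kind A' = 0 \<or> c < c') \<and>
          (\<exists>x'. inside 1 c (next_kind A') c' x' \<and> optimal_state (prec x') s' q))) \<and>
     idx s' SK 0 = 1 \<and> num s' CL 0 = c \<and>
     (\<forall>r\<in>{1, 2, 3, 4}. idx s' r = idx s r) \<and> (\<forall>r\<in>{3, 4, 5, 6}. num s' r = num s r)) s"
proof -
  have n: "0 < n" using s by (simp add: prepared_def)
  have An: "A \<subseteq> {1..<n}" using Q by (simp add: queue_def)
  define i where "i = idx s TREE (Suc 0)"
  have i: "i \<in> A" "\<And>j. j \<in> A \<Longrightarrow> num s KEY i \<le> num s KEY j" "c = num s KEY i"
    using queue_root(2,3)[OF Q n] A c by (auto simp: i_def)
  have in': "i \<in> {1..<n}" using i(1) An by auto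
  define A' where "A' = A - {i}"
  have fA: "finite A" using An finite_subset by blast
  have cA: "Suc (card A') = card A" unfolding A'_def using fA i(1) by (rule card_Suc_Diff1)
  define e f where "e = idx s EVE i" and "f = idx s EVF i"
  have ef: "(e, f) \<in> events" "cross \<alpha> \<beta> e f = c"
    using prepared_events(1,2)[OF s in'] i(3) by (simp_all add: e_def f_def entry_def)
  have inI: "inside_I c" using prepared_events(3)[OF s in'] i(3) by simp
  let ?s = "iupd VAL 0 0 (iupd CUR 0 (n + i) (iupd SK 0 1 (rupd CL 0 c (iupd FF 0 f (iupd EE 0 e s)))))"
  have ne: "n + i < 2 * n" using in' by simp
  have fl: "floor_log (n + i) \<le> floor_log (2 * n)" using ne by (intro floor_log_le_iff) simp
  have "wp set_leaf (\<lambda>t s1. wp update (\<lambda>t' s'. t + t' \<le> 70 * floor_log (2 * n) + q * (d + 300) + d + 470 \<and>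
     prepared s' n \<and>
     (\<exists>A'. queue s' n A' \<and> Suc (card A') = card A \<and>
       (\<forall>i\<in>{1..<n} - A'. \<forall>j\<in>A'. num s' KEY i \<le> num s' KEY j) \<and>
       (let c' = num s' KEY (idx s' TREE (Suc 0)) in
          cell 1 c (next_kind A') c' \<and> (next_kind A' = 0 \<or> c < c') \<and>
          (\<exists>x'. inside 1 c (next_kind A') c' x' \<and> optimal_state (prec x') s' q))) \<and>
     idx s' SK 0 = 1 \<and> num s' CL 0 = c \<and>
     (\<forall>r\<in>{1, 2, 3, 4}. idx s' r = idx s r) \<and> (\<forall>r\<in>{3, 4, 5, 6}. num s' r = num s r)) s1) ?s"
  proof (rule wp_mono[OF wp_set_leaf[where n = n and c = "n + i"]], goal_cases)
    case 1
    then show ?case using Q by (simp add: queue_def)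
  next
    case (2 j)
    then show ?case using s by (simp add: prepared_def)
  next
    case (6 t s1)
    have fr: "idx_kept {TREE, CUR} ?s s1" "num s1 = num ?s"
      and T: "tournament (num ?s KEY) (idx s1 TREE) n"
        "\<forall>j\<ge>n. idx s1 TREE j = (if j = n + i then idx ?s VAL 0 else idx ?s TREE j)"
      and t: "t \<le> 70 * floor_log (2 * n) + 70"
      using 6 fl by (blast, blast, blast, blast, auto intro: order.trans)
    have s1: "prepared s1 n" by (rule prepared_cong[OF s]) (use fr in auto)
    have Q1: "queue s1 n A'"
      using Q T fr unfolding queue_def A'_def by auto
    define c' where "c' = num s1 KEY (idx s1 TREE (Suc 0))"
    have key: "num s1 KEY = num s KEY" using fr by simp
    note r1 = queue_root[OF Q1 n]
    have lt: "next_kind A' = 0 \<or> c < c'"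
    proof (cases "A' = {}")
      case True
      then show ?thesis using r1(1) prepared_simps[OF s1] inI by (auto simp: next_kind_def inside_def c'_def)
    next
      case False
      let ?j = "idx s1 TREE (Suc 0)"
      have j: "?j \<in> A" "?j \<noteq> i" using r1(2)[OF False] by (auto simp: A'_def)
      then have "num s KEY ?j \<noteq> num s KEY i" using prepared_events(5)[OF s, of ?j i] An in' by auto
      then show ?thesis using i(2)[OF j(1)] i(3) by (simp add: c'_def key)
    qed
    have seen: "num s KEY j \<le> c" if "j \<in> {1..<n} - A'" for j
      using that order[of j i] i by (auto simp: A'_def)
    have new: "cell 1 c (next_kind A') c'"
      unfolding c'_def by (rule next_cell[OF s1 Q1]) (use inI seen key in \<open>auto simp: inside_def\<close>)
    obtain x' where x': "inside 1 c (next_kind A') c' x'"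
      using lt dense[of c c'] gt_ex[of c] by (auto simp: inside_def)
    have tr: "transposed (prec x) (prec x') e f" by (rule cell_transposed[OF old(1,2) new x' ef])
    have ef1: "idx s1 EE 0 = e" "idx s1 FF 0 = f" using fr by auto
    have "optimal_state (prec x) s1 q" by (rule optimal_state_cong[OF old(3)]) (use fr in auto)
    note upd = wp_update[OF strict_linear_before strict_linear_before tr[folded ef1] this]
    show ?case
    proof (rule wp_mono[OF upd], elim conjE, goal_cases)
      case (1 t' s')
      note fr' = 1(3,4)
      have s': "prepared s' n" by (rule prepared_cong[OF s1]) (use fr' in auto)
      have tk: "idx s' TREE = idx s1 TREE" "num s' KEY = num s1 KEY" using fr' by simp_all
      have "queue s' n A'" using Q1 unfolding queue_def tk .
      moreover have "\<forall>i\<in>{1..<n} - A'. \<forall>j\<in>A'. num s' KEY i \<le> num s' KEY j"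
      proof (intro ballI)
        fix i' j assume "i' \<in> {1..<n} - A'" "j \<in> A'"
        then have "num s KEY i' \<le> c" "c \<le> num s KEY j" using seen i(2)[of j] i(3) by (auto simp: A'_def)
        then show "num s' KEY i' \<le> num s' KEY j" unfolding tk key by simp
      qed
      moreover have "let c' = num s' KEY (idx s' TREE (Suc 0)) in
          cell 1 c (next_kind A') c' \<and> (next_kind A' = 0 \<or> c < c') \<and>
          (\<exists>x'. inside 1 c (next_kind A') c' x' \<and> optimal_state (prec x') s' q)"
        unfolding Let_def tk c'_def[symmetric] using new lt x' 1(2) by blast
      moreover have "t + t' \<le> 70 * floor_log (2 * n) + q * (d + 300) + d + 470" using t 1(1) by simp
      moreover have "idx s' SK 0 = 1" "num s' CL 0 = c" "\<forall>r\<in>{1, 2, 3, 4}. idx s' r = idx s r"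
        "\<forall>r\<in>{3, 4, 5, 6}. num s' r = num s r" using fr' fr by auto
      ultimately show ?case using s' cA by blast
    qed
  qed (use ne in auto)
  note W = this
  show ?thesis
    unfolding advance_def
    by (simp add: prepared_simps(8)[OF s] i_def[symmetric] e_def[symmetric] f_def[symmetric] i(3)[symmetric],
      rule wp_mono[OF W[unfolded One_nat_def]], erule wp_mono) (elim conjE, intro conjI; simp)
qed

lemma wp_sweep_loop:
  assumes S: "sweep_state n q N s" and q: "0 < q"
  shows "wp (While (ILess (IConst 0) next_id) (advance ;; next_bound ;; emit_cell))
    (\<lambda>t s'. t \<le> N * (70 * floor_log (2 * n) + q * (d + 900) + d + 800) + 10 \<and> output_ok correct_piece s' I) s"
proof (rule wp_While[where Inv = "sweep_state n q" and n = N and K = "70 * floor_log (2 * n) + q * (d + 900) + d + 750"], goal_cases)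
  case (2 N s)
  then obtain A where s: "prepared s n" and Q: "queue s n A" "card A = N"
    and order: "\<forall>i\<in>{1..<n} - A. \<forall>j\<in>A. num s KEY i \<le> num s KEY j"
    and out: "output_ok correct_piece s (swept s A)"
    and opt: "A \<noteq> {} \<longrightarrow> (\<exists>lc lo x. cell lc lo 2 (num s KEY (idx s TREE (Suc 0))) \<and>
        inside lc lo 2 (num s KEY (idx s TREE (Suc 0))) x \<and> optimal_state (prec x) s q)"
    unfolding sweep_state_def by blast
  have n: "0 < n" using s by (simp add: prepared_def)
  have A: "A \<noteq> {}" using queue_root(1)[OF Q(1) n] 2(2) by auto
  define c where "c = num s KEY (idx s TREE (Suc 0))"
  obtain lc lo x where old: "cell lc lo 2 c" "inside lc lo 2 c x" "optimal_state (prec x) s q"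
    using opt A c_def by auto
  have An: "A \<subseteq> {1..<n}" using Q(1) by (simp add: queue_def)
  have inI: "inside_I c" using prepared_events(3)[OF s] queue_root(2)[OF Q(1) n A] An c_def by blast
  have sw: "swept s A = {y \<in> I. y < c}" using A by (simp add: swept_def c_def)
  show ?case unfolding wp_Seq
  proof (rule wp_mono[OF wp_advance[OF s Q(1) A _ old c_def]], goal_cases)
    case (1 i j)
    then show ?case using order by blast
  next
    case (2 t1 s1)
    then obtain A' where s1: "prepared s1 n" and Q1: "queue s1 n A'" "Suc (card A') = card A"
      and order1: "\<forall>i\<in>{1..<n} - A'. \<forall>j\<in>A'. num s1 KEY i \<le> num s1 KEY j"
      and new: "cell 1 c (next_kind A') (num s1 KEY (idx s1 TREE (Suc 0)))"
        "next_kind A' = 0 \<or> c < num s1 KEY (idx s1 TREE (Suc 0))"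
      and x': "\<exists>x'. inside 1 c (next_kind A') (num s1 KEY (idx s1 TREE (Suc 0))) x' \<and> optimal_state (prec x') s1 q"
      and b1: "idx s1 SK 0 = 1" "num s1 CL 0 = c"
      and fr1: "\<forall>r\<in>{1, 2, 3, 4}. idx s1 r = idx s r" "\<forall>r\<in>{3, 4, 5, 6}. num s1 r = num s r"
      and t1: "t1 \<le> 70 * floor_log (2 * n) + q * (d + 300) + d + 600"
      unfolding Let_def by blast
    define c' where "c' = num s1 KEY (idx s1 TREE (Suc 0))"
    obtain x' where x': "inside 1 c (next_kind A') c' x'" "optimal_state (prec x') s1 q" using x' c'_def by blast
    let ?s = "iupd EK 0 (next_kind A') (rupd CU 0 c' s1)"
    let ?X = "ivl (decode_bound 1 c) (decode_bound (next_kind A') c')"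
    have s2: "prepared ?s n" by (rule prepared_cong[OF s1]) auto
    have opt2: "optimal_state (prec x') ?s q" by (rule optimal_state_cong[OF x'(2)]) auto
    have out2: "output_ok correct_piece ?s {y \<in> I. y < c}"
      using out fr1 unfolding sw by (simp add: output_ok_def out_count_def out_piece_def[abs_def] out_element_def out_value_def)
    have "wp emit_cell (\<lambda>t s'. t \<le> 600 * q + 100 \<and> output_ok correct_piece s' ({y \<in> I. y < c} \<union> ?X) \<and>
       idx_kept {1, 2, 3, 4, SK, KI, SG, SR, SN, LI} ?s s' \<and>
       num_kept {3, 4, 5, 6, PB, TMP} ?s s') ?s"
    proof -
      have b: "idx ?s SK 0 = 1" "num ?s CL 0 = c" "idx ?s EK 0 = next_kind A'" "num ?s CU 0 = c'" using b1 by auto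
      show ?thesis
        using wp_emit_optimal[OF s2 opt2 q, where R = "{y \<in> I. y < c}"] x'(1) new(1) inside_ivl[OF x'(1)] out2
          swept_step(1)[OF s1 Q1(1) inI] unfolding b c'_def[symmetric] by blast
    qed
    then have em: "wp emit_cell (\<lambda>t s'. t \<le> 600 * q + 100 \<and> sweep_state n q (card A') s') ?s"
    proof (rule wp_mono, goal_cases)
      case (1 t s')
      have fr2: "idx_kept {1, 2, 3, 4, SK, KI, SG, SR, SN, LI} ?s s'"
        "num_kept {3, 4, 5, 6, PB, TMP} ?s s'"
        and t: "t \<le> 600 * q + 100" and ok: "output_ok correct_piece s' ({y \<in> I. y < c} \<union> ?X)"
        using 1 by blast+
      have s': "prepared s' n" by (rule prepared_cong[OF s2]) (use fr2 in auto)
      have tk: "idx s' TREE = idx s1 TREE" "num s' KEY = num s1 KEY" using fr2 by simp_all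
      have "queue s' n A'" using Q1(1) unfolding queue_def tk .
      moreover have opt3: "optimal_state (prec x') s' q"
        by (rule optimal_state_cong[OF opt2]) (use fr2 in auto)
      moreover have "output_ok correct_piece s' (swept s' A')"
        using ok swept_step(2)[OF s1 Q1(1) inI new(2)] unfolding swept_def tk c'_def by simp
      moreover have "A' \<noteq> {} \<longrightarrow> (\<exists>lc lo x. cell lc lo 2 (num s' KEY (idx s' TREE (Suc 0))) \<and>
        inside lc lo 2 (num s' KEY (idx s' TREE (Suc 0))) x \<and> optimal_state (prec x) s' q)"
      proof
        assume "A' \<noteq> {}"
        then have k2: "next_kind A' = 2" by (simp add: next_kind_def)
        show "\<exists>lc lo x. cell lc lo 2 (num s' KEY (idx s' TREE (Suc 0))) \<and>
          inside lc lo 2 (num s' KEY (idx s' TREE (Suc 0))) x \<and> optimal_state (prec x) s' q"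
          unfolding tk using new(1)[unfolded k2] x'(1)[unfolded k2 c'_def] opt3 by blast
      qed
      moreover have "\<forall>i\<in>{1..<n} - A'. \<forall>j\<in>A'. num s' KEY i \<le> num s' KEY j" using order1 unfolding tk .
      ultimately show ?case
        unfolding sweep_state_def using s' t by blast
    qed
    show ?case
    proof (rule wp_mono[OF wp_next_bound[OF s1 Q1(1)]], elim conjE, goal_cases)
      case (1 t2 s2)
      have "card A' < N" using Q(2) Q1(2) by simp
      then show ?case unfolding 1(2) c'_def[symmetric] using t1 1(1)
        by (intro wp_mono[OF em]) (auto simp: algebra_simps)
    qed
  qed
next
  case (3 t N' s')
  then obtain A where s: "prepared s' n" and Q: "queue s' n A" and out: "output_ok correct_piece s' (swept s' A)"
    unfolding sweep_state_def by blast
  have n: "0 < n" using s by (simp add: prepared_def)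
  have "A \<subseteq> {1..<n}" using Q by (simp add: queue_def)
  then have "A = {}" using queue_root(2)[OF Q n] 3(2) by fastforce
  then have "swept s' A = I" by (simp add: swept_def)
  moreover have "t \<le> N * (70 * floor_log (2 * n) + q * (d + 900) + d + 800) + 10"
    by (rule order.trans[OF 3(3)]) (simp add: algebra_simps)
  ultimately show ?case using out by simp
qed (rule S)

lemma wp_sample_point:
  assumes X: "ivl (decode_bound (idx s SK 0) (num s CL 0)) (decode_bound (idx s EK 0) (num s CU 0)) = X" "X \<noteq> {}"
  shows "wp sample_point (\<lambda>t s'. t \<le> 40 \<and>
     (\<exists>x. s' = rupd X0 0 x s \<and>
        (\<forall>y\<in>X. inside (idx s SK 0) (num s CL 0) (idx s EK 0) (num s CU 0) x \<or> x = y))) s"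
proof -
  let ?x = "if idx s SK 0 = 0 then if idx s EK 0 = 0 then 0 else num s CU 0 - 1
    else if idx s EK 0 = 0 then num s CL 0 + 1 else (num s CL 0 + num s CU 0) / 2"
  have "inside (idx s SK 0) (num s CL 0) (idx s EK 0) (num s CU 0) ?x \<or> ?x = y" if "y \<in> X" for y
  proof -
    have "idx s SK 0 = 0 \<or> num s CL 0 \<le> y" "idx s EK 0 = 0 \<or> y \<le> num s CU 0"
      using that above_lower below_upper unfolding X(1)[symmetric] ivl_def by blast+
    then show ?thesis by (auto simp: inside_def)
  qed
  then show ?thesis
    unfolding sample_point_def by (auto intro!: exI[of _ ?x])
qed

lemma greedy_opt:
  assumes "B \<in> F" "\<forall>x<m. x \<in> B \<longleftrightarrow> insert x {y \<in> B. prec z y x} \<in> F"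
  shows "exchange_optimal (prec z) B"
  by (rule greedy_exchange_optimal[OF strict_linear_before _ assms(1)])
    (use assms indep_subset_ground in auto)

definition sweep_cost :: "nat \<Rightarrow> nat \<Rightarrow> nat" where
  "sweep_cost n q = m * (m * 150 + 60) + (n * (70 * floor_log (2 * n) + 200)) + m * (80 * m + d + 250) +
     m * (m * (d + 400) + 800) + 600 * q + n * (70 * floor_log (2 * n) + q * (d + 900) + d + 800) + 1500"

lemma wp_sweep:
  "wp sweep (\<lambda>t s. t \<le> sweep_cost (Suc (card events)) (Suc (matroid_rank F)) \<and>
     output_ok correct_piece s I) (input_state m a b l u)"
proof -
  let ?s0 = "input_state m a b l u"
  let ?q = "Suc (matroid_rank F)" and ?n = "Suc (card events)"
  have "beval ?s0 nonempty_interval \<longleftrightarrow> ivl l u \<noteq> {}"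
    unfolding ivl_nonempty_iff by (auto simp: input_simps)
  then have ne: "beval ?s0 nonempty_interval \<longleftrightarrow> I \<noteq> {}" by (simp add: I_ivl)
  show ?thesis
  proof (cases "I = {}")
    case True
    then have "output_ok correct_piece ?s0 I"
      by (simp add: output_ok_def out_count_def input_simps disjoint_family_on_def)
    then show ?thesis unfolding sweep_def wp_If ne by (simp add: True sweep_cost_def)
  next
    case False
    have "wp (build_events ;; build_tree ;; iset SK lkind ;; rset CL lbnd ;; next_bound ;; sample_point ;;
        greedy_basis ;; build_entries ;; emit_cell ;;
        While (ILess (IConst 0) next_id) (advance ;; next_bound ;; emit_cell))
      (\<lambda>t s. t + 100 \<le> sweep_cost ?n ?q \<and> output_ok correct_piece s I) ?s0"
      unfolding wp_Seq
    proof (rule wp_mono[OF wp_build_events], goal_cases)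
      case 1
      show ?case by (simp add: input_simps)
    next
      case (2 t1 s1)
      have fr1: "idx_kept {NEV, EVE, EVF, CI, CJ} ?s0 s1"
        "num_kept {KEY, TMP} ?s0 s1" and t1: "t1 \<le> m * (m * 150 + 60) + 60"
        and ev1: "lists_events s1 events" "num s1 KEY 0 = bound_val u"
        using 2 by (simp_all add: input_simps events_def)
      show ?case
      proof (rule wp_mono[OF wp_build_tree], goal_cases)
        case 1
        then show ?case using fr1 by (simp add: input_simps)
      next
        case (2 t2 s2)
        define n where "n = Suc (idx s1 NEV 0)"
        have fr2: "idx_kept {LV, HALF, TREE, CUR, VAL, CI} s1 s2" "num s2 = num s1"
          and t2: "t2 \<le> n * (70 * floor_log (2 * n) + 200) + 60"
          and tr2: "idx s2 LV 0 = n" "tournament (num s1 KEY) (idx s2 TREE) n" "\<forall>i<n. idx s2 TREE (n + i) = i"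
            "\<forall>j<2 * n. idx s2 HALF j = j div 2"
          using 2 unfolding n_def by blast+
        have "lists_events s2 events" using ev1(1) fr2 by (simp add: lists_events_def entry_def[abs_def])
        then have P2: "prepared s2 n"
          unfolding prepared_def using fr1 fr2 tr2 ev1(2) by (simp add: input_simps n_def)
        define A where "A = {1..<n}"
        have Q2: "queue s2 n A" unfolding queue_def A_def using tr2 fr2 by auto
        have nq: "n = ?n" by (rule prepared_events(6)[OF P2])
        have cA: "card A = card events" using nq by (simp add: A_def)
        define c where "c = num s2 KEY (idx s2 TREE (Suc 0))"
        let ?s3 = "rupd CL 0 (bound_val l) (iupd SK 0 (bound_code l) s2)"
        let ?s4 = "iupd EK 0 (next_kind A) (rupd CU 0 c ?s3)"
        let ?X = "ivl (decode_bound (bound_code l) (bound_val l)) (decode_bound (next_kind A) c)"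
        have P3: "prepared ?s3 n" and P4: "prepared ?s4 n" by (rule prepared_cong[OF P2]; simp)+
        have Q3: "queue ?s3 n A" using Q2 by (simp add: queue_def)
        have b4: "idx ?s4 SK 0 = bound_code l" "num ?s4 CL 0 = bound_val l" "idx ?s4 EK 0 = next_kind A" "num ?s4 CU 0 = c"
          by simp_all
        have X: "?X = swept s2 A" using swept_first[OF P2 Q2] by (simp add: c_def)
        have n0: "0 < n" by (simp add: n_def)
        have Xne: "?X \<noteq> {}"
        proof (cases "A = {}")
          case True
          then show ?thesis using False unfolding X swept_def by auto
        next
          case A: False
          have "inside_I c" using queue_root(2)[OF Q2 n0 A] prepared_events(3)[OF P2] by (auto simp: c_def A_def)
          then obtain y where y: "inside (bound_code l) (bound_val l) 2 c y"
            using dense[of "bound_val l" c] lt_ex[of c] by (auto simp: inside_def)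
          have "y \<in> ?X" using inside_ivl[OF y] A by (simp add: next_kind_def)
          then show ?thesis by blast
        qed
        have cell: "cell (bound_code l) (bound_val l) (next_kind A) c"
          unfolding c_def by (rule next_cell[OF P2 Q2]) (auto simp: A_def)
        have rest: "wp sample_point (\<lambda>t5. wp greedy_basis (\<lambda>t6. wp build_entries (\<lambda>t7. wp emit_cell (\<lambda>t8.
           wp (While (ILess (IConst 0) next_id) (advance ;; next_bound ;; emit_cell))
             (\<lambda>t9 s. t1 + t2 + t5 + t6 + t7 + t8 + t9 + 200 \<le> sweep_cost ?n ?q \<and> output_ok correct_piece s I))))) ?s4"
        proof (rule wp_mono[OF wp_sample_point[where X = ?X]], goal_cases)
          case 1
          show ?case by simp
        next
          case 2
          show ?case by (rule Xne)
        next
          case (3 t5 s5)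
          then obtain x where s5: "s5 = rupd X0 0 x ?s4" and t5: "t5 \<le> 40"
            and x: "\<And>y. y \<in> ?X \<Longrightarrow> inside (bound_code l) (bound_val l) (next_kind A) c x \<or> x = y"
            unfolding b4 by blast
          have P5: "prepared s5 n" unfolding s5 by (rule prepared_cong[OF P4]) auto
          have ab5: "num s5 1 = \<alpha>" "num s5 2 = \<beta>" "num s5 X0 0 = x" using P5 s5 by (auto simp: prepared_def)
          have "idx s5 BAS = (\<lambda>_. 0)" using fr1 fr2 by (simp add: s5 input_simps)
          then have S5: "support (idx s5 BAS) = {}" by (simp add: support_def)
          show ?case
          proof (rule wp_mono[OF wp_greedy_basis[OF prepared_simps(1)[OF P5] S5]], goal_cases)
            case (1 t6 s6)
            define B where "B = support (idx s6 BAS)"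
            have t6: "t6 \<le> m * (80 * m + d + 250) + 100"
              and B: "B \<in> F" "\<forall>y<m. y \<in> B \<longleftrightarrow> insert y {z \<in> B. prec x z y} \<in> F"
              and W6: "num s6 WA 0 = sum \<alpha> B" "num s6 WB 0 = sum \<beta> B"
              and fr6: "idx_kept {CI, CAND, BEST, CJ, BAS, RES} s5 s6"
                "num_kept {WA, WB} s5 s6"
              using 1 unfolding B_def ab5 by blast+
            have opt: "exchange_optimal (prec x) B" by (rule greedy_opt[OF B])
            note basis = exchange_optimalD(1)[OF opt]
            have cB: "Suc (card B) = ?q" using rank_eq_card_basis[OF basis] by simp
            have P6: "prepared s6 n" by (rule prepared_cong[OF P5]) (use fr6 in auto)
            have ab6: "num s6 1 = \<alpha>" "num s6 2 = \<beta>" "num s6 X0 0 = x"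
              using P6 fr6 ab5 by (simp_all add: prepared_def)
            show ?case
            proof (rule wp_mono[OF wp_build_entries[OF prepared_simps(1)[OF P6]]], goal_cases)
              case (1 g)
              then show ?case using ex_replacement[OF basis] by (simp add: B_def)
            next
              case 2
              show ?case using ex_outside[OF basis] by (simp add: B_def)
            next
              case (3 t7 s7)
              obtain E where E: "sorted_entries s7 ?q E" "entry_set (prec x) B E"
                using 3 unfolding ab6 B_def[symmetric] cB by blast
              have t7: "t7 \<le> m * (m * (d + 400) + 800) + 600" and B7: "support (idx s7 BAS) = B"
                and fr7: "idx_kept {BAS, CAND, CI, CJ, BEST, GG, RR, HH, LG, LR, MK, XG, XR, YG, YR, XN, YN, XP, YP, LEN} s6 s7" "num s7 = num s6"
                using 3 unfolding B_def by blast+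
              have P7: "prepared s7 n" by (rule prepared_cong[OF P6]) (use fr7 in auto)
              have O7: "optimal_state (prec x) s7 ?q"
                unfolding optimal_state_def B7 using opt E W6 fr7 ab6 by auto
              have b7: "idx s7 SK 0 = bound_code l" "num s7 CL 0 = bound_val l" "idx s7 EK 0 = next_kind A" "num s7 CU 0 = c"
                using fr7 fr6 by (auto simp: s5)
              have "idx s7 1 0 = 0" using fr7 fr6 fr1 fr2 by (simp add: s5 input_simps)
              then have out7: "output_ok correct_piece s7 {}"
                by (simp add: output_ok_def out_count_def disjoint_family_on_def)
              have em: "wp emit_cell (\<lambda>t s'. t \<le> 600 * ?q + 100 \<and> output_ok correct_piece s' ({} \<union> ?X) \<and>
                 idx_kept {1, 2, 3, 4, SK, KI, SG, SR, SN, LI} s7 s' \<and>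
                 num_kept {3, 4, 5, 6, PB, TMP} s7 s') s7"
                using wp_emit_optimal[OF P7 O7, where R = "{}"] Xne cell x out7 unfolding b7 by blast
              show ?case
              proof (rule wp_mono[OF em], goal_cases)
                case (1 t8 s8)
                have fr8: "idx_kept {1, 2, 3, 4, SK, KI, SG, SR, SN, LI} s7 s8"
                  "num_kept {3, 4, 5, 6, PB, TMP} s7 s8"
                  and t8: "t8 \<le> 600 * ?q + 100" and out8: "output_ok correct_piece s8 ?X"
                  using 1 by auto
                have P8: "prepared s8 n" by (rule prepared_cong[OF P7]) (use fr8 in auto)
                have O8: "optimal_state (prec x) s8 ?q" by (rule optimal_state_cong[OF O7]) (use fr8 in auto)
                have tk: "idx s8 TREE = idx s2 TREE" "num s8 KEY = num s2 KEY"
                  using fr8 fr7 fr6 by (simp_all add: s5)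
                have "queue s8 n A" using Q2 unfolding queue_def tk .
                moreover have "output_ok correct_piece s8 (swept s8 A)"
                  using out8 unfolding X swept_def tk .
                moreover have "A \<noteq> {} \<longrightarrow> (\<exists>lc lo x. cell lc lo 2 (num s8 KEY (idx s8 TREE (Suc 0))) \<and>
                    inside lc lo 2 (num s8 KEY (idx s8 TREE (Suc 0))) x \<and> optimal_state (prec x) s8 ?q)"
                proof
                  assume A: "A \<noteq> {}"
                  then have k2: "next_kind A = 2" by (simp add: next_kind_def)
                  have inI: "inside_I c" using queue_root(2)[OF Q2 n0 A] prepared_events(3)[OF P2] by (auto simp: c_def A_def)
                  obtain y z where yz: "y \<in> ?X" "z \<in> ?X" "y \<noteq> z"
                  proof -
                    obtain y where y: "inside (bound_code l) (bound_val l) 2 c y"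
                      using inI dense[of "bound_val l" c] lt_ex[of c] by (auto simp: inside_def)
                    then obtain z where z: "y < z" "z < c" using dense[of y c] by (auto simp: inside_def)
                    then have z': "inside (bound_code l) (bound_val l) 2 c z" using y by (auto simp: inside_def)
                    show ?thesis using that[of y z] inside_ivl[OF y] inside_ivl[OF z'] z(1) unfolding k2 by simp
                  qed
                  then have "inside (bound_code l) (bound_val l) 2 c x" using x[of y] x[of z] k2 by auto
                  then show "\<exists>lc lo x. cell lc lo 2 (num s8 KEY (idx s8 TREE (Suc 0))) \<and>
                    inside lc lo 2 (num s8 KEY (idx s8 TREE (Suc 0))) x \<and> optimal_state (prec x) s8 ?q"
                    using cell O8 unfolding tk c_def[symmetric] k2 by blast
                qed
                ultimately have SS: "sweep_state n ?q (card events) s8"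
                  unfolding sweep_state_def using P8 cA by (auto simp: A_def intro!: exI[of _ A])
                show ?case
                proof (rule wp_mono[OF wp_sweep_loop[OF SS]], goal_cases)
                  case (2 t9 s9)
                  have "card events * (70 * floor_log (2 * n) + ?q * (d + 900) + d + 800) \<le>
                      ?n * (70 * floor_log (2 * n) + ?q * (d + 900) + d + 800)"
                    by (intro mult_right_mono) auto
                  then have "t9 \<le> ?n * (70 * floor_log (2 * ?n) + ?q * (d + 900) + d + 800) + 10"
                    using 2 nq by simp
                  then show ?case using 2 t1 t2 t5 t6 t7 t8 unfolding sweep_cost_def nq by linarith
                qed simp
              qed
            qed
          qed
        qed
        have nb: "wp next_bound (\<lambda>t4 s. t4 \<le> 30 \<and> s = ?s4) ?s3"
          using wp_next_bound[OF P3 Q3] by (simp add: c_def)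
        show ?case
        proof (simp add: prepared_simps[OF P2], rule wp_mono[OF nb[simplified]], goal_cases)
          case (1 t4 s4)
          show ?case
            unfolding conjunct2[OF 1]
            by (rule wp_mono[OF rest[simplified]], erule wp_mono, erule wp_mono, erule wp_mono, erule wp_mono)
              (use 1 in auto)
        qed
      qed
    qed
    then show ?thesis
      unfolding sweep_def wp_If ne by (simp add: False, elim wp_mono) auto
  qed
qed

text \<open>All terms without logarithm are at most a constant times \<open>m\<^sup>2 k d\<close>. The depth \<open>G\<close> of the
  tournament tree satisfies \<open>2\<^sup>G \<le> m\<^sup>4\<close>, where \<open>m \<ge> 2\<close> is needed: a single element could not be deleted without
  loss of rank.\<close>

lemma sweep_cost_le:
  assumes d: "1 \<le> d"
  shows "real (sweep_cost (Suc (card events)) (Suc (matroid_rank F))) \<le>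
    11000 * (real m ^ 2 * (real (matroid_rank F) * real d +
      real (matroid_rank F) powr (1/3) * ln (real m * real (matroid_rank F))))"
proof -
  define k u D n G where "k = matroid_rank F" and "u = m * m" and "D = k * d" and "n = Suc (card events)"
    and "G = floor_log (2 * n)"
  have k: "1 \<le> k" using rank_pos by (simp add: k_def)
  have D: "1 \<le> D" "d \<le> D" "k \<le> D" using k d by (auto simp: D_def)
  have u: "m \<le> u" "1 \<le> u" "4 \<le> u" using m_ge_2 mult_le_mono[OF m_ge_2 m_ge_2] by (auto simp: u_def)
  have n: "n \<le> u + 1" "n \<le> 2 * u" using finite_events(2) u by (auto simp: n_def u_def)
  have uD: "u \<le> u * D" "D \<le> u * D" "1 \<le> u * D" using u D by auto
  have "Suc k * (d + 900) \<le> (2 * k) * (901 * d)" using k d by (intro mult_le_mono) auto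
  then have q: "Suc k * (d + 900) \<le> 1802 * D" by (simp add: D_def)
  have "m * (m * 150 + 60) \<le> 210 * (u * D)"
  proof -
    have "m * (m * 150 + 60) = 150 * u + 60 * m" by (simp add: u_def algebra_simps)
    then show ?thesis using u(1) uD(1) by linarith
  qed
  moreover have "n * (70 * G + 200) \<le> 140 * (u * G) + 400 * (u * D)"
  proof -
    have "n * (70 * G + 200) \<le> (2 * u) * (70 * G + 200)" by (rule mult_le_mono1[OF n(2)])
    moreover have "(2 * u) * (70 * G + 200) = 140 * (u * G) + 400 * u" by (simp add: algebra_simps)
    ultimately show ?thesis using uD(1) by linarith
  qed
  moreover have "m * (80 * m + d + 250) \<le> 331 * (u * D)"
  proof -
    have "m * d \<le> u * D" using u(1) D(2) by (rule mult_le_mono)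
    moreover have "m * (80 * m + d + 250) = 80 * u + m * d + 250 * m" by (simp add: u_def algebra_simps)
    ultimately show ?thesis using u(1) uD(1) by linarith
  qed
  moreover have "m * (m * (d + 400) + 800) \<le> 1201 * (u * D)"
  proof -
    have "m * (m * d) \<le> u * D" using D(2) by (simp add: u_def)
    moreover have "m * (m * (d + 400) + 800) = m * (m * d) + 400 * u + 800 * m" by (simp add: u_def algebra_simps)
    ultimately show ?thesis using u(1) uD(1) by linarith
  qed
  moreover have "600 * Suc k \<le> 600 * (2 * (u * D))"
    using D(3) uD(2,3) by (intro mult_le_mono2) linarith
  moreover have "n * (70 * G + Suc k * (d + 900) + d + 800) \<le> 140 * (u * G) + 5206 * (u * D)"
  proof -
    have "n * (70 * G + Suc k * (d + 900) + d + 800) \<le> (2 * u) * (70 * G + 2603 * D)"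
    proof (rule mult_le_mono[OF n(2)])
      show "70 * G + Suc k * (d + 900) + d + 800 \<le> 70 * G + 2603 * D" using q D by linarith
    qed
    then show ?thesis by (simp add: algebra_simps)
  qed
  ultimately have "sweep_cost n (Suc k) \<le> 280 * (u * G) + 10100 * (u * D)"
    unfolding sweep_cost_def G_def[symmetric] using uD by linarith
  then have cost: "real (sweep_cost n (Suc k)) \<le> 280 * (real u * real G) + 10100 * (real u * real D)"
    by (metis (mono_tags) of_nat_add of_nat_le_iff of_nat_mult of_nat_numeral)
  have m2: "2 \<le> real m" using m_ge_2 by simp
  have k1: "1 \<le> real k" using k by simp
  have "2 ^ G \<le> 2 * n" unfolding G_def by (rule floor_log_exp2_le) (simp add: n_def)
  also have "\<dots> \<le> u * u" using n(1) u(3) mult_le_mono1[OF u(3), of u] by linarith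
  finally have "2 ^ G \<le> m ^ 4" by (simp add: u_def power4_eq_xxxx mult.assoc)
  then have "(2::real) ^ G \<le> real m ^ 4" by (metis of_nat_le_iff of_nat_numeral of_nat_power)
  then have "ln ((2::real) ^ G) \<le> ln (real m ^ 4)" using m2 by (subst ln_le_cancel_iff) auto
  then have "real G * ln 2 \<le> 4 * ln (real m)" using m2 by (simp add: ln_realpow)
  moreover have "real G * (1/2) \<le> real G * ln 2" using ln2_ge_two_thirds by (intro mult_left_mono) auto
  moreover have "ln (real m) \<le> ln (real m * real k)" using m2 k1 by simp
  moreover have "1 * ln (real m * real k) \<le> real k powr (1/3) * ln (real m * real k)"
  proof (rule mult_right_mono)
    have "1 \<le> real m * real k" using mult_mono[of 1 "real m" 1 "real k"] m2 k1 by simp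
    then show "0 \<le> ln (real m * real k)" by simp
    show "1 \<le> real k powr (1/3)" using k1 by (intro ge_one_powr_ge_zero) auto
  qed
  ultimately have G: "real G \<le> 8 * (real k powr (1/3) * ln (real m * real k))" by linarith
  have "280 * (real u * real G) \<le> 280 * (real u * (8 * (real k powr (1/3) * ln (real m * real k))))"
    using G by (intro mult_left_mono) auto
  moreover have "0 \<le> real u * (real k powr (1/3) * ln (real m * real k))"
  proof -
    have "0 \<le> real k powr (1/3) * ln (real m * real k)" using G of_nat_0_le_iff[of G] by linarith
    then show ?thesis by (rule mult_nonneg_nonneg[OF of_nat_0_le_iff])
  qed
  moreover have "0 \<le> real u * real D" by simp
  ultimately have "real (sweep_cost n (Suc k)) \<le>
      11000 * (real u * real D) + 11000 * (real u * (real k powr (1/3) * ln (real m * real k)))"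
    using cost by linarith
  also have "\<dots> = 11000 * (real m ^ 2 * (real k * real d + real k powr (1/3) * ln (real m * real k)))"
    by (simp add: u_def D_def power2_eq_square algebra_simps)
  finally show ?thesis by (simp add: n_def k_def)
qed

end

theorem theorem4p2:
  "\<exists>(P :: com) (C :: real).
     \<forall>(f :: nat \<Rightarrow> nat) (m :: nat) (k :: nat) (F :: nat set set) (a :: nat \<Rightarrow> rat) (b :: nat \<Rightarrow> rat)
        (I :: real set) (l :: bound) (u :: bound).
       (\<forall>n. 1 \<le> f n) \<longrightarrow>
       parametric_matroid m F a b I \<longrightarrow> matroid_rank F = k \<longrightarrow> 1 \<le> k \<longrightarrow> I = ivl l u \<longrightarrow>
       (\<exists>t s. exec m F (f m) P (input_state m a b l u) t s \<and>
              correct_output m F a b I s \<and>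
              real t \<le> C * (real m ^ 2 *
                (real k * real (f m) +
                 real k powr (1/3) * ln (real m * real k))))"
proof (intro exI[of _ sweep] exI[of _ "11000 :: real"] allI impI)
  fix f :: "nat \<Rightarrow> nat" and m k :: nat and F :: "nat set set" and a b :: "nat \<Rightarrow> rat"
    and I :: "real set" and l u :: bound
  assume f: "\<forall>n. 1 \<le> f n" and pm: "parametric_matroid m F a b I"
    and k: "matroid_rank F = k" "1 \<le> k" and I: "I = ivl l u"
  interpret parametric_matroid m F a b I by (fact pm)
  interpret interdiction_sweep m F a b I l u "f m"
    by unfold_locales (use k I in auto)
  obtain t s where "exec m F (f m) sweep (input_state m a b l u) t s"
    and t: "t \<le> sweep_cost (Suc (card events)) (Suc (matroid_rank F))" and "correct_output m F a b I s"
    using wp_sweep unfolding wp_def correct_output_iff by blast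
  moreover have "real t \<le> 11000 * (real m ^ 2 * (real k * real (f m) + real k powr (1/3) * ln (real m * real k)))"
    using order.trans[OF _ sweep_cost_le, of "real t"] t f k(1) by simp
  ultimately show "\<exists>t s. exec m F (f m) sweep (input_state m a b l u) t s \<and>
      correct_output m F a b I s \<and>
      real t \<le> 11000 * (real m ^ 2 * (real k * real (f m) + real k powr (1/3) * ln (real m * real k)))"
    by blast
qed

end
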